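(* For every integer $m\ge 1$, there exists a compact set $E^m\subseteq\mathbb{C}$ with exactly $m$ connected components, all nondegenerate (i.e. containing more than one point), such that $\gamma(E^m)=\gamma_c(E^m)$ but the Ahlfors function for $E^m$ is not the Cauchy transform of any complex Borel measure supported on $E^m$; that is, if $f$ denotes the Ahlfors function for $E^m$, there is no finite complex Borel measure $\mu$ supported on $E^m$ with $f=\mathcal{C}_\mu$ on $\mathbb{C}_\infty\setminus E^m$.
   Context: $\mathbb{C}_\infty$ is the Riemann sphere. Analytic capacity: for $E\subseteq\mathbb{C}$ compact, let $\Omega$ be the component of $\mathbb{C}_\infty\setminus E$ containing $\infty$, and let $H^\infty(\Omega)$ be the class of bounded holomorphic functions on $\Omega$. Then $\gamma(E):=\sup\{|f'(\infty)| : f\in H^\infty(\Omega),\ |f|\le 1\}$, where $f'(\infty):=\lim_{z\to\infty} z(f(z)-f(\infty))$. Ahlfors function: if $\gamma(E)>0$, the Ahlfors function for $E$ is the unique $f\in H^\infty(\Omega)$ with $|f|\le 1$ and $f'(\infty)=\gamma(E)$; by convention it is extended to be identically zero on each bounded component of $\mathbb{C}_\infty\setminus E$ (components of $\mathbb{C}_\infty \setminus E$ other than $\Omega$). Cauchy transform: for a finite complex Borel measure $\mu$ supported on $E$, $\mathcal{C}_\mu(z):=\int \frac{1}{\xi-z}\,d\mu(\xi)$ for $z\in\mathbb{C}_\infty\setminus E$ (with $\mathcal{C}_\mu(\infty)=0$). Cauchy capacity: $\gamma_c(E):=\sup\{|\mu(E)|\}$, the supremum being over all finite complex Borel measures $\mu$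 supported on $E$ such that $|\mathcal{C}_\mu|\le 1$ on $\mathbb{C}_\infty\setminus E$. *)

theory Defs
  imports "HOL-Complex_Analysis.Complex_Analysis"
begin

section \<open>The Riemann sphere\<close>

text \<open>Points of the sphere are values of type \<^typ>\<open>complex option\<close>, with \<^term>\<open>None\<close> as the point
  at infinity.\<close>

abbreviation riemann_sphere :: "complex option topology" where
  "riemann_sphere \<equiv> Alexandroff_compactification euclidean"

definition sphere_compl :: "complex set \<Rightarrow> complex option set" where
  "sphere_compl E = - (Some ` E)"

definition outer_domain :: "complex set \<Rightarrow> complex option set" where
  "outer_domain E =
     connected_component_of_set (subtopology riemann_sphere (sphere_compl E)) None"

definition chart_at_infinity :: "complex \<Rightarrow> complex option" where
  "chart_at_infinity w = (if w = 0 then None else Some (1 / w))"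

text \<open>Holomorphy on an open subset of the sphere, expressed in the two standard charts.\<close>

definition sphere_holomorphic_on :: "(complex option \<Rightarrow> complex) \<Rightarrow> complex option set \<Rightarrow> bool" where
  "sphere_holomorphic_on f U \<longleftrightarrow>
     (f \<circ> Some) holomorphic_on (Some -` U) \<and>
     (f \<circ> chart_at_infinity) holomorphic_on (chart_at_infinity -` U)"

section \<open>Analytic capacity and the Ahlfors function\<close>

definition H_infty :: "complex option set \<Rightarrow> (complex option \<Rightarrow> complex) set" where
  "H_infty U = {f. sphere_holomorphic_on f U \<and> bounded (f ` U)}"

definition deriv_at_infinity :: "(complex option \<Rightarrow> complex) \<Rightarrow> complex" where
  "deriv_at_infinity f = Lim at_infinity (\<lambda>z. z * (f (Some z) - f None))"

definition analytic_capacity :: "complex set \<Rightarrow> real" where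
  "analytic_capacity E =
     Sup {cmod (deriv_at_infinity f) | f.
            f \<in> H_infty (outer_domain E) \<and> (\<forall>p\<in>outer_domain E. cmod (f p) \<le> 1)}"

text \<open>The function is determined by the conditions on the outer domain; it vanishes by convention
  on the other components of the complement of \<open>E\<close>. It is also given the value \<open>0\<close> at the points of
  \<open>E\<close> itself, only to make it a total function. The definition is meaningful for compact \<open>E\<close> with
  positive analytic capacity.\<close>

definition ahlfors_function :: "complex set \<Rightarrow> complex option \<Rightarrow> complex" where
  "ahlfors_function E =
     (THE f. f \<in> H_infty (outer_domain E) \<and>
             (\<forall>p\<in>outer_domain E. cmod (f p) \<le> 1) \<and>
             deriv_at_infinity f = complex_of_real (analytic_capacity E) \<and>
             (\<forall>p. p \<notin> outer_domain E \<longrightarrow> f p = 0))"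

section \<open>Complex Borel measures and integration\<close>

text \<open>A finite complex Borel measure is a countably additive complex-valued function on the Borel
  sets; its values on other sets are irrelevant. That the empty set has measure \<open>0\<close> follows from
  convergence of the series for the constantly empty family.\<close>

definition complex_borel_measure :: "(complex set \<Rightarrow> complex) \<Rightarrow> bool" where
  "complex_borel_measure \<mu> \<longleftrightarrow>
     (\<forall>A :: nat \<Rightarrow> complex set. range A \<subseteq> sets borel \<longrightarrow> disjoint_family A \<longrightarrow>
        (\<lambda>n. \<mu> (A n)) sums \<mu> (\<Union>n. A n))"

definition supported_on :: "(complex set \<Rightarrow> complex) \<Rightarrow> complex set \<Rightarrow> bool" where
  "supported_on \<mu> E \<longleftrightarrow> (\<forall>A\<in>sets borel. A \<inter> E = {} \<longrightarrow> \<mu> A = 0)"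

text \<open>The positive part in the Jordan decomposition of a finite signed Borel measure \<open>\<nu>\<close>, namely
  \<open>A \<mapsto> sup {\<nu> B | B \<subseteq> A Borel}\<close>. Negative values are truncated by \<^term>\<open>ennreal\<close>, which does not
  change the supremum because \<open>B = {}\<close> contributes \<open>0\<close>. The negative part of \<open>\<nu>\<close> is the positive
  part of \<open>- \<nu>\<close>.\<close>

definition positive_part_measure :: "(complex set \<Rightarrow> real) \<Rightarrow> complex measure" where
  "positive_part_measure \<nu> =
     measure_of UNIV (sets borel) (\<lambda>A. SUP B\<in>{B \<in> sets borel. B \<subseteq> A}. ennreal (\<nu> B))"

definition signed_integral :: "(complex set \<Rightarrow> real) \<Rightarrow> (complex \<Rightarrow> complex) \<Rightarrow> complex" where
  "signed_integral \<nu> g =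
     (LINT x|positive_part_measure \<nu>. g x) - (LINT x|positive_part_measure (\<lambda>A. - \<nu> A). g x)"

definition complex_measure_integral :: "(complex set \<Rightarrow> complex) \<Rightarrow> (complex \<Rightarrow> complex) \<Rightarrow> complex"
  where
  "complex_measure_integral \<mu> g =
     signed_integral (\<lambda>A. Re (\<mu> A)) g + \<i> * signed_integral (\<lambda>A. Im (\<mu> A)) g"

section \<open>Cauchy transform and Cauchy capacity\<close>

definition cauchy_transform :: "(complex set \<Rightarrow> complex) \<Rightarrow> complex option \<Rightarrow> complex" where
  "cauchy_transform \<mu> p =
     (case p of None \<Rightarrow> 0 | Some z \<Rightarrow> complex_measure_integral \<mu> (\<lambda>\<xi>. 1 / (\<xi> - z)))"

definition cauchy_capacity :: "complex set \<Rightarrow> real" where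
  "cauchy_capacity E =
     Sup {cmod (\<mu> E) | \<mu>.
            complex_borel_measure \<mu> \<and> supported_on \<mu> E \<and>
            (\<forall>p\<in>sphere_compl E. cmod (cauchy_transform \<mu> p) \<le> 1)}"

end

theory Submission
  imports Defs
begin

text \<open>The idea is to take \<open>E\<close> to be the closure of a bounded domain \<open>U\<close>, together with \<open>m - 1\<close> discs in bounded
  components of the complement; such discs change neither the outer domain nor the analytic capacity.

  For \<open>\<gamma> = \<gamma>\<^sub>c\<close>, exhaust \<open>U\<close> by continua \<open>K n\<close>. A level curve of the Riemann map \<open>f n\<close> of the exterior of
  \<open>K n\<close> that is close to \<open>K n\<close> lies in \<open>U\<close>. The measure \<open>f n dz / (2 \<pi> i)\<close> on it has a Cauchy transform equal to
  \<open>f n\<close> outside and to \<open>0\<close> inside the curve, and mass \<open>\<gamma> (K n)\<close> up to sign; by a normal families argument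
  these masses tend to \<open>\<gamma> E\<close>.

  The domain \<open>U\<close> consists of a square with infinitely many narrow towers of rings on top. The holes of a
  tower are separated from the exterior by a thin wall of fixed length. Since the Ahlfors function vanishes
  in the holes and is bounded away from \<open>0\<close> near the towers, a representing measure would need mass bounded
  below on each tower, which dominated convergence excludes.\<close>

section \<open>Signed Borel measures\<close>

text \<open>The two claims are compatible because \<gamma>_c is a supremum: only the masses of
  admissible measures must approach \<gamma>, while their variations may blow up. A Cauchy transform
  that jumps from \<open>f\<close> to \<open>0\<close> across an arc carries
  \<open>f dz / (2 \<pi> i)\<close> there, up to sign, so walls of infinite length leave no finite
  measure. Boundary values are avoided: the jump is tested on pairs of points \<open>z\<close>,
  \<open>q\<close> on the two sides of a wall by \<open>1 / (\<xi> - z) - 1 / (\<xi> - q)\<close>.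
  The constants balance two demands. With weights \<open>width j\<close> the pairs of a tower must
  have total weight \<open>1\<close>, which fixes the number of rings; and from a distance of order
  \<open>abscissa j\<close> their sum, of order \<open>width j / (abscissa j)^2\<close>, must tend
  to \<open>0\<close>, so \<open>width j\<close> must be a higher power than the square. The cube
  makes the number of rings the integer \<open>8 ^ (j + 2)\<close>. The function theory takes place
  in the chart \<open>w = 1 / z\<close>, where the outer domains in question are bounded, simply
  connected and contain \<open>0\<close>. There the Schwarz lemma settles the extremal problem and
  bounds the Ahlfors function from below.\<close>

definition signed_borel_measure :: "(complex set \<Rightarrow> real) \<Rightarrow> bool" where
  "signed_borel_measure \<nu> \<longleftrightarrow>
     (\<forall>A :: nat \<Rightarrow> complex set. range A \<subseteq> sets borel \<longrightarrow> disjoint_family A \<longrightarrow>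
        (\<lambda>n. \<nu> (A n)) sums \<nu> (\<Union>n. A n))"

lemma signed_borel_measureD:
  assumes "signed_borel_measure \<nu>" "\<And>n::nat. A n \<in> sets borel" "disjoint_family A"
  shows "(\<lambda>n. \<nu> (A n)) sums \<nu> (\<Union>n. A n)"
  using assms unfolding signed_borel_measure_def by blast

lemma signed_borel_measure_uminus:
  "signed_borel_measure \<nu> \<Longrightarrow> signed_borel_measure (\<lambda>A. - \<nu> A)"
  unfolding signed_borel_measure_def using sums_minus by blast

lemma signed_borel_measure_empty:
  assumes "signed_borel_measure \<nu>"
  shows "\<nu> {} = 0"
proof -
  have "(\<lambda>n::nat. \<nu> {}) sums \<nu> (\<Union>n::nat. {})"
    by (rule signed_borel_measureD[OF assms]) (auto simp: disjoint_family_on_def)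
  then have "summable (\<lambda>n::nat. \<nu> {})"
    by (rule sums_summable)
  then show ?thesis
    by (simp add: summable_const_iff)
qed

lemma signed_borel_measure_Un:
  assumes \<nu>: "signed_borel_measure \<nu>" and AB: "A \<in> sets borel" "B \<in> sets borel" "A \<inter> B = {}"
  shows "\<nu> (A \<union> B) = \<nu> A + \<nu> B"
proof -
  have "(\<lambda>n. \<nu> (binaryset A B n)) sums \<nu> (\<Union>n. binaryset A B n)"
  proof (rule signed_borel_measureD[OF \<nu>])
    show "binaryset A B n \<in> sets borel" for n
      using AB by (auto simp: binaryset_def)
    show "disjoint_family (binaryset A B)"
      using AB(3) by (auto simp: disjoint_family_on_def binaryset_def)
  qed
  moreover have "(\<lambda>n. \<nu> (binaryset A B n)) sums (\<nu> A + \<nu> B)"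
    by (rule binaryset_sums) (rule signed_borel_measure_empty[OF \<nu>])
  ultimately show ?thesis
    by (metis UN_binaryset_eq sums_unique2)
qed

lemma signed_borel_measure_split:
  assumes "signed_borel_measure \<nu>" "A \<in> sets borel" "B \<in> sets borel"
  shows "\<nu> A = \<nu> (A \<inter> B) + \<nu> (A - B)"
proof -
  have "\<nu> ((A \<inter> B) \<union> (A - B)) = \<nu> (A \<inter> B) + \<nu> (A - B)"
    by (rule signed_borel_measure_Un[OF assms(1)]) (use assms in auto)
  moreover have "(A \<inter> B) \<union> (A - B) = A" by blast
  ultimately show ?thesis by simp
qed

text \<open>If \<nu> were unbounded, pieces of measure at least \<open>1\<close> in absolute value
  could be peeled off forever, each time leaving a set on which \<nu> is still unbounded. The pieces
  are disjoint, and their series cannot converge.\<close>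

lemma signed_borel_measure_bounded:
  assumes \<nu>: "signed_borel_measure \<nu>"
  shows "\<exists>M. \<forall>B\<in>sets borel. \<bar>\<nu> B\<bar> \<le> M"
proof (rule ccontr)
  assume contra: "\<not> ?thesis"
  define unb where "unb A \<longleftrightarrow> A \<in> sets borel \<and> (\<forall>M. \<exists>B\<in>sets borel. B \<subseteq> A \<and> \<bar>\<nu> B\<bar> > M)" for A
  have step: "\<exists>B. unb B \<and> B \<subseteq> A \<and> \<bar>\<nu> (A - B)\<bar> \<ge> 1" if A: "unb A" for A
  proof -
    obtain C where C: "C \<in> sets borel" "C \<subseteq> A" "\<bar>\<nu> C\<bar> > \<bar>\<nu> A\<bar> + 1"
      using A unfolding unb_def by blast
    have AC: "\<nu> A = \<nu> C + \<nu> (A - C)"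
      using signed_borel_measure_split[OF \<nu>, of A C] A C by (simp add: unb_def Int_absorb1)
    have Ab: "A \<in> sets borel" using A by (simp add: unb_def)
    \<comment> \<open>\<nu> is unbounded on \<open>C\<close> or on \<open>A - C\<close>; that part
      is kept. The choice of \<open>C\<close> makes the discarded part large in both cases:
      \<open>\<nu> (A - C) = \<nu> A - \<nu> C\<close>, or \<open>\<nu> C\<close> itself.\<close>
    show ?thesis
    proof (cases "unb C")
      case True
      then show ?thesis using C AC by (intro exI[of _ C]) auto
    next
      case False
      then obtain M1 where M1: "\<And>B. B \<in> sets borel \<Longrightarrow> B \<subseteq> C \<Longrightarrow> \<bar>\<nu> B\<bar> \<le> M1"
        unfolding unb_def using C by (meson not_le)
      have "\<exists>B\<in>sets borel. B \<subseteq> A - C \<and> \<bar>\<nu> B\<bar> > M" for M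
      proof -
        obtain B where B: "B \<in> sets borel" "B \<subseteq> A" "\<bar>\<nu> B\<bar> > M + M1"
          using A unfolding unb_def by blast
        have "\<bar>\<nu> (B \<inter> C)\<bar> \<le> M1" using M1[of "B \<inter> C"] B C by auto
        with signed_borel_measure_split[OF \<nu>, of B C] B C have "\<bar>\<nu> (B - C)\<bar> > M" by linarith
        then show ?thesis using B C by (intro bexI[of _ "B - C"]) auto
      qed
      then have "unb (A - C)" using Ab C by (auto simp: unb_def)
      moreover have "A - (A - C) = C" using C by blast
      ultimately show ?thesis using C by (intro exI[of _ "A - C"]) auto
    qed
  qed
  have U: "unb UNIV"
    using contra by (auto simp: unb_def not_le)
  obtain S where S: "\<And>n. unb (S n)" "\<And>n. S (Suc n) \<subseteq> S n \<and> \<bar>\<nu> (S n - S (Suc n))\<bar> \<ge> 1"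
    using dependent_nat_choice[of "\<lambda>_. unb" "\<lambda>_ A B. B \<subseteq> A \<and> \<bar>\<nu> (A - B)\<bar> \<ge> 1"] U step by metis
  have dec: "S n \<subseteq> S m" if "m \<le> n" for m n
    using that S(2) by (metis lift_Suc_antimono_le)
  have "(\<lambda>n. \<nu> (S n - S (Suc n))) sums \<nu> (\<Union>n. S n - S (Suc n))"
  proof (rule signed_borel_measureD[OF \<nu>])
    show "S n - S (Suc n) \<in> sets borel" for n
      using S(1) by (auto simp: unb_def)
    have "(S m - S (Suc m)) \<inter> (S n - S (Suc n)) = {}" if "m < n" for m n
      using dec[of "Suc m" n] that by auto
    then show "disjoint_family (\<lambda>n. S n - S (Suc n))"
      unfolding disjoint_family_on_def by (metis inf_commute linorder_neqE_nat)
  qed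
  then have "(\<lambda>n. \<nu> (S n - S (Suc n))) \<longlonglongrightarrow> 0"
    using sums_summable summable_LIMSEQ_zero by blast
  then have "\<forall>\<^sub>F n in sequentially. dist (\<nu> (S n - S (Suc n))) 0 < 1"
    by (rule tendstoD) simp
  then obtain n where "\<bar>\<nu> (S n - S (Suc n))\<bar> < 1"
    using eventually_happens'[OF sequentially_bot] by auto
  with S(2)[of n] show False by linarith
qed

text \<open>The supremum of \<open>positive_part_measure\<close> taken in the reals. It is finite by
  the boundedness of \<nu>, and additivity can be proved with subtraction at hand.\<close>

definition positive_variation :: "(complex set \<Rightarrow> real) \<Rightarrow> complex set \<Rightarrow> real" where
  "positive_variation \<nu> A = (SUP B\<in>{B \<in> sets borel. B \<subseteq> A}. \<nu> B)"

context
  fixes \<nu> :: "complex set \<Rightarrow> real"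
  assumes \<nu>: "signed_borel_measure \<nu>"
begin

lemma bdd_above_variation: "bdd_above (\<nu> ` {B \<in> sets borel. B \<subseteq> A})"
proof -
  obtain M where M: "\<And>B. B \<in> sets borel \<Longrightarrow> \<bar>\<nu> B\<bar> \<le> M"
    using signed_borel_measure_bounded[OF \<nu>] by blast
  have "\<nu> B \<le> M" if "B \<in> sets borel" for B
    using M[OF that] by linarith
  then show ?thesis by (auto intro!: bdd_aboveI2)
qed

lemma positive_variation_upper:
  "B \<in> sets borel \<Longrightarrow> B \<subseteq> A \<Longrightarrow> \<nu> B \<le> positive_variation \<nu> A"
  unfolding positive_variation_def by (rule cSUP_upper[OF _ bdd_above_variation]) simp

lemma positive_variation_least:
  assumes "\<And>B. B \<in> sets borel \<Longrightarrow> B \<subseteq> A \<Longrightarrow> \<nu> B \<le> c"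
  shows "positive_variation \<nu> A \<le> c"
proof -
  have "{B \<in> sets borel. B \<subseteq> A} \<noteq> {}" by (auto intro: exI[of _ "{}"])
  then show ?thesis
    unfolding positive_variation_def by (rule cSUP_least) (use assms in auto)
qed

lemma positive_variation_nonneg: "0 \<le> positive_variation \<nu> A"
  using positive_variation_upper[of "{}" A] signed_borel_measure_empty[OF \<nu>] by simp

lemma positive_variation_empty: "positive_variation \<nu> {} = 0"
proof (rule antisym)
  show "positive_variation \<nu> {} \<le> 0"
    by (rule positive_variation_least) (use signed_borel_measure_empty[OF \<nu>] in auto)
qed (rule positive_variation_nonneg)

lemma positive_variation_mono: "A \<subseteq> A' \<Longrightarrow> positive_variation \<nu> A \<le> positive_variation \<nu> A'"
  by (rule positive_variation_least) (auto intro: positive_variation_upper)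

lemma positive_variation_Un:
  assumes "A \<in> sets borel" "B \<in> sets borel" "A \<inter> B = {}"
  shows "positive_variation \<nu> (A \<union> B) = positive_variation \<nu> A + positive_variation \<nu> B"
proof (rule antisym)
  show "positive_variation \<nu> (A \<union> B) \<le> positive_variation \<nu> A + positive_variation \<nu> B"
  proof (rule positive_variation_least)
    fix C assume C: "C \<in> sets borel" "C \<subseteq> A \<union> B"
    have "\<nu> C = \<nu> (C \<inter> A) + \<nu> (C - A)"
      by (rule signed_borel_measure_split[OF \<nu>]) (use C assms in auto)
    moreover have "\<nu> (C \<inter> A) \<le> positive_variation \<nu> A" "\<nu> (C - A) \<le> positive_variation \<nu> B"
      by (rule positive_variation_upper; use C assms in auto)+
    ultimately show "\<nu> C \<le> positive_variation \<nu> A + positive_variation \<nu> B" by simp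
  qed
  have "positive_variation \<nu> A \<le> positive_variation \<nu> (A \<union> B) - positive_variation \<nu> B"
  proof (rule positive_variation_least)
    fix C assume C: "C \<in> sets borel" "C \<subseteq> A"
    have "positive_variation \<nu> B \<le> positive_variation \<nu> (A \<union> B) - \<nu> C"
    proof (rule positive_variation_least)
      fix D assume D: "D \<in> sets borel" "D \<subseteq> B"
      have "\<nu> (C \<union> D) = \<nu> C + \<nu> D"
        by (rule signed_borel_measure_Un[OF \<nu>]) (use C D assms in auto)
      moreover have "\<nu> (C \<union> D) \<le> positive_variation \<nu> (A \<union> B)"
        by (rule positive_variation_upper) (use C D in auto)
      ultimately show "\<nu> D \<le> positive_variation \<nu> (A \<union> B) - \<nu> C" by simp
    qed
    then show "\<nu> C \<le> positive_variation \<nu> (A \<union> B) - positive_variation \<nu> B" by simp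
  qed
  then show "positive_variation \<nu> A + positive_variation \<nu> B \<le> positive_variation \<nu> (A \<union> B)" by simp
qed

text \<open>Finite additivity and monotonicity bound the partial sums; for the converse a subset
  \<open>B\<close> of the union is cut into the pieces \<open>B \<inter> A n\<close>.\<close>

lemma positive_variation_sums:
  fixes A :: "nat \<Rightarrow> complex set"
  assumes A: "\<And>n. A n \<in> sets borel" and dis: "disjoint_family A"
  shows "(\<lambda>n. positive_variation \<nu> (A n)) sums positive_variation \<nu> (\<Union>n. A n)"
proof -
  let ?p = "positive_variation \<nu>"
  have fin: "(\<Sum>i<n. ?p (A i)) = ?p (\<Union>i<n. A i)" for n
  proof (induction n)
    case 0
    show ?case by (simp add: positive_variation_empty)
  next
    case (Suc n)
    have "A i \<inter> A n = {}" if "i < n" for i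
      using dis that by (simp add: disjoint_family_on_def)
    then have "(\<Union>i<n. A i) \<inter> A n = {}"
      by blast
    then have "?p ((\<Union>i<n. A i) \<union> A n) = ?p (\<Union>i<n. A i) + ?p (A n)"
      by (intro positive_variation_Un) (use A in auto)
    moreover have "(\<Union>i<Suc n. A i) = (\<Union>i<n. A i) \<union> A n"
      by (simp add: lessThan_Suc Un_commute)
    ultimately show ?case using Suc by simp
  qed
  have le: "(\<Sum>i<n. ?p (A i)) \<le> ?p (\<Union>n. A n)" for n
    unfolding fin by (rule positive_variation_mono) auto
  have sm: "summable (\<lambda>n. ?p (A n))"
    by (rule summableI_nonneg_bounded[OF positive_variation_nonneg le])
  have "(\<Sum>n. ?p (A n)) \<le> ?p (\<Union>n. A n)"
    by (rule suminf_le_const[OF sm le])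
  moreover have "?p (\<Union>n. A n) \<le> (\<Sum>n. ?p (A n))"
  proof (rule positive_variation_least)
    fix B assume B: "B \<in> sets borel" "B \<subseteq> (\<Union>n. A n)"
    have "(\<lambda>n. \<nu> (B \<inter> A n)) sums \<nu> (\<Union>n. B \<inter> A n)"
      by (rule signed_borel_measureD[OF \<nu>]) (use A B disjoint_family_subset[OF dis, of "\<lambda>n. B \<inter> A n"] in auto)
    moreover have "(\<Union>n. B \<inter> A n) = B" using B by blast
    ultimately have s: "(\<lambda>n. \<nu> (B \<inter> A n)) sums \<nu> B" by simp
    have "\<nu> (B \<inter> A n) \<le> ?p (A n)" for n
      by (rule positive_variation_upper) (use A B in auto)
    with s sm show "\<nu> B \<le> (\<Sum>n. ?p (A n))"
      by (metis sums_iff suminf_le)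
  qed
  ultimately show ?thesis
    using sm by (metis antisym summable_sums)
qed

lemma sets_positive_part_measure [simp]: "sets (positive_part_measure \<nu>) = sets borel"
  unfolding positive_part_measure_def
  using sets.sigma_sets_eq[of "borel :: complex measure"] by (subst sets_measure_of) auto

lemma space_positive_part_measure [simp]: "space (positive_part_measure \<nu>) = UNIV"
  unfolding positive_part_measure_def by simp

text \<open>\<open>measure_of\<close> falls back to the zero measure unless its set function is
  countably additive; \<open>positive_variation_sums\<close> rules this default out.\<close>

lemma emeasure_positive_part_measure:
  assumes A: "A \<in> sets borel"
  shows "emeasure (positive_part_measure \<nu>) A = ennreal (positive_variation \<nu> A)"
proof -
  have eq: "(SUP B\<in>{B \<in> sets borel. B \<subseteq> C}. ennreal (\<nu> B)) = ennreal (positive_variation \<nu> C)" for C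
  proof (rule antisym)
    show "(SUP B\<in>{B \<in> sets borel. B \<subseteq> C}. ennreal (\<nu> B)) \<le> ennreal (positive_variation \<nu> C)"
      by (intro SUP_least ennreal_leI positive_variation_upper) auto
    show "ennreal (positive_variation \<nu> C) \<le> (SUP B\<in>{B \<in> sets borel. B \<subseteq> C}. ennreal (\<nu> B))" 
      (is "_ \<le> ?s")
    proof (cases "?s = top")
      case True
      then show ?thesis by (metis top_greatest)
    next
      case False
      then obtain s where s: "?s = ennreal s" "0 \<le> s"
        by (cases ?s) auto
      have "\<nu> B \<le> s" if "B \<in> sets borel" "B \<subseteq> C" for B
      proof -
        have "ennreal (\<nu> B) \<le> ?s" using that by (intro SUP_upper) auto
        then show ?thesis using s by (simp add: ennreal_le_iff)
      qed
      then have "positive_variation \<nu> C \<le> s" by (rule positive_variation_least)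
      then show ?thesis using s by (simp add: ennreal_leI)
    qed
  qed
  show ?thesis
  proof (rule emeasure_measure_of)
    show "positive_part_measure \<nu> = measure_of UNIV (sets borel) (\<lambda>A. ennreal (positive_variation \<nu> A))"
      unfolding positive_part_measure_def eq ..
    show "positive (sets (positive_part_measure \<nu>)) (\<lambda>A. ennreal (positive_variation \<nu> A))"
      by (simp add: positive_def positive_variation_empty)
    show "countably_additive (sets (positive_part_measure \<nu>)) (\<lambda>A. ennreal (positive_variation \<nu> A))"
      unfolding countably_additive_def sets_positive_part_measure
    proof (intro allI impI)
      fix B :: "nat \<Rightarrow> complex set"
      assume "range B \<subseteq> sets borel" "disjoint_family B"
      then have "(\<lambda>n. positive_variation \<nu> (B n)) sums positive_variation \<nu> (\<Union>n. B n)"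
        by (intro positive_variation_sums) auto
      then show "(\<Sum>i. ennreal (positive_variation \<nu> (B i))) = ennreal (positive_variation \<nu> (\<Union>i. B i))"
        by (intro suminf_ennreal_eq positive_variation_nonneg)
    qed
    show "A \<in> sets (positive_part_measure \<nu>)"
      using A by simp
    show "sets borel \<subseteq> Pow (UNIV :: complex set)"
      by simp
  qed
qed

lemma finite_measure_positive_part: "finite_measure (positive_part_measure \<nu>)"
proof (rule finite_measureI)
  have "emeasure (positive_part_measure \<nu>) UNIV = ennreal (positive_variation \<nu> UNIV)"
    by (rule emeasure_positive_part_measure) simp
  then show "emeasure (positive_part_measure \<nu>) (space (positive_part_measure \<nu>)) \<noteq> \<infinity>"
    by simp
qed

lemma measure_positive_part_measure:
  "A \<in> sets borel \<Longrightarrow> measure (positive_part_measure \<nu>) A = positive_variation \<nu> A"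
  unfolding measure_def
  by (subst emeasure_positive_part_measure) (auto intro: enn2real_ennreal positive_variation_nonneg)

lemma null_positive_part_measure:
  assumes "A \<in> sets borel" "\<And>B. B \<in> sets borel \<Longrightarrow> B \<subseteq> A \<Longrightarrow> \<nu> B = 0"
  shows "emeasure (positive_part_measure \<nu>) A = 0"
proof -
  have "positive_variation \<nu> A \<le> 0"
    by (rule positive_variation_least) (simp add: assms)
  then show ?thesis
    unfolding emeasure_positive_part_measure[OF assms(1)] by (rule ennreal_neg)
qed

end

text \<open>Passing from \<open>B\<close> to \<open>A - B\<close> turns the supremum of \<nu> over
  subsets of \<open>A\<close> into that of \<open>- \<nu>\<close>, shifted by
  \<open>\<nu> A\<close>.\<close>

lemma jordan_decomposition:
  assumes \<nu>: "signed_borel_measure \<nu>" and A: "A \<in> sets borel"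
  shows "\<nu> A = measure (positive_part_measure \<nu>) A - measure (positive_part_measure (\<lambda>A. - \<nu> A)) A"
proof -
  note \<nu>' = signed_borel_measure_uminus[OF \<nu>]
  have c: "\<nu> A = \<nu> B + \<nu> (A - B)" if "B \<in> sets borel" "B \<subseteq> A" for B
    using signed_borel_measure_split[OF \<nu> A that(1)] that by (simp add: Int_absorb1)
  have "positive_variation \<nu> A \<le> \<nu> A + positive_variation (\<lambda>A. - \<nu> A) A"
  proof (rule positive_variation_least[OF \<nu>])
    fix B assume B: "B \<in> sets borel" "B \<subseteq> A"
    have "- \<nu> (A - B) \<le> positive_variation (\<lambda>A. - \<nu> A) A"
      by (rule positive_variation_upper[OF \<nu>']) (use A B in auto)
    with c[OF B] show "\<nu> B \<le> \<nu> A + positive_variation (\<lambda>A. - \<nu> A) A" by simp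
  qed
  moreover have "positive_variation (\<lambda>A. - \<nu> A) A \<le> positive_variation \<nu> A - \<nu> A"
  proof (rule positive_variation_least[OF \<nu>'])
    fix B assume B: "B \<in> sets borel" "B \<subseteq> A"
    have "\<nu> (A - B) \<le> positive_variation \<nu> A"
      by (rule positive_variation_upper[OF \<nu>]) (use A B in auto)
    with c[OF B] show "- \<nu> B \<le> positive_variation \<nu> A - \<nu> A" by simp
  qed
  ultimately show ?thesis
    by (simp add: measure_positive_part_measure \<nu> \<nu>' A)
qed

text \<open>Serves to show that two decompositions of a signed measure into positive ones give the
  same integral. An equality of differences is written as one of sums to stay within
  \<open>ennreal\<close>.\<close>

lemma nn_integral_measure_add_eq:
  assumes sets: "sets M1 = sets (borel::complex measure)" "sets M2 = sets (borel::complex measure)"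
      "sets M3 = sets (borel::complex measure)" "sets M4 = sets (borel::complex measure)"
    and eq: "\<And>A. A \<in> sets borel \<Longrightarrow>
      emeasure M1 A + emeasure M2 A = emeasure M3 A + emeasure M4 A"
    and g: "g \<in> borel_measurable borel"
  shows "(\<integral>\<^sup>+x. g x \<partial>M1) + (\<integral>\<^sup>+x. g x \<partial>M2) = (\<integral>\<^sup>+x. g x \<partial>M3) + (\<integral>\<^sup>+x. g x \<partial>M4)"
  using g
proof (induction g rule: borel_measurable_induct)
  case (cong f g)
  then show ?case by (simp cong: nn_integral_cong)
next
  case (set A)
  then show ?case using sets eq by simp
next
  case (mult u c)
  have m: "u \<in> borel_measurable M1" "u \<in> borel_measurable M2" "u \<in> borel_measurable M3" "u \<in> borel_measurable M4"
    using mult sets by (simp_all cong: measurable_cong_sets)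
  show ?case using mult m by (simp add: nn_integral_cmult flip: distrib_left)
next
  case (add u v)
  have m: "u \<in> borel_measurable M1" "u \<in> borel_measurable M2" "u \<in> borel_measurable M3" "u \<in> borel_measurable M4"
    "v \<in> borel_measurable M1" "v \<in> borel_measurable M2" "v \<in> borel_measurable M3" "v \<in> borel_measurable M4"
    using add sets by (simp_all cong: measurable_cong_sets)
  have "(\<integral>\<^sup>+x. u x + v x \<partial>M1) + (\<integral>\<^sup>+x. u x + v x \<partial>M2) =
    ((\<integral>\<^sup>+x. u x \<partial>M1) + (\<integral>\<^sup>+x. u x \<partial>M2)) + ((\<integral>\<^sup>+x. v x \<partial>M1) + (\<integral>\<^sup>+x. v x \<partial>M2))"
    using m by (simp add: nn_integral_add ac_simps)
  also have "\<dots> = (\<integral>\<^sup>+x. u x + v x \<partial>M3) + (\<integral>\<^sup>+x. u x + v x \<partial>M4)"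
    unfolding add.IH using m by (simp add: nn_integral_add ac_simps)
  finally show ?case by (simp add: add.commute)
next
  case (seq U)
  have m: "U i \<in> borel_measurable M1" "U i \<in> borel_measurable M2" "U i \<in> borel_measurable M3" "U i \<in> borel_measurable M4" for i
    using seq sets by (simp_all cong: measurable_cong_sets)
  have inc: "incseq (\<lambda>i. \<integral>\<^sup>+x. U i x \<partial>M)" for M
    using \<open>incseq U\<close> by (auto simp: incseq_def le_fun_def intro!: nn_integral_mono)
  have sup: "(\<integral>\<^sup>+x. (SUP i. U i) x \<partial>M) = (SUP i. \<integral>\<^sup>+x. U i x \<partial>M)" if "\<And>i. U i \<in> borel_measurable M" for M
    using nn_integral_monotone_convergence_SUP[OF \<open>incseq U\<close>, of M] that by (simp add: image_comp)
  show ?case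
    unfolding sup[OF m(1)] sup[OF m(2)] sup[OF m(3)] sup[OF m(4)]
    by (simp add: inc seq.IH flip: ennreal_SUP_add)
qed

lemma integral_measure_diff_eq_nonneg:
  fixes g :: "complex \<Rightarrow> real"
  assumes sets: "sets M1 = sets (borel::complex measure)" "sets M2 = sets (borel::complex measure)"
      "sets M3 = sets (borel::complex measure)" "sets M4 = sets (borel::complex measure)"
    and eq: "\<And>A. A \<in> sets borel \<Longrightarrow>
      emeasure M1 A + emeasure M2 A = emeasure M3 A + emeasure M4 A"
    and g: "g \<in> borel_measurable borel" "\<And>x. 0 \<le> g x"
      "integrable M1 g" "integrable M2 g" "integrable M3 g" "integrable M4 g"
  shows "(LINT x|M1. g x) + (LINT x|M2. g x) = (LINT x|M3. g x) + (LINT x|M4. g x)"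
proof -
  have e: "(\<integral>\<^sup>+x. ennreal (g x) \<partial>M) = ennreal (LINT x|M. g x)" if "integrable M g" for M
    by (rule nn_integral_eq_integral[OF that]) (use g in auto)
  have nn: "0 \<le> (LINT x|M. g x)" for M using g by simp
  have "(\<integral>\<^sup>+x. ennreal (g x) \<partial>M1) + (\<integral>\<^sup>+x. ennreal (g x) \<partial>M2)
      = (\<integral>\<^sup>+x. ennreal (g x) \<partial>M3) + (\<integral>\<^sup>+x. ennreal (g x) \<partial>M4)"
    by (rule nn_integral_measure_add_eq[OF sets eq]) (use g in auto)
  then have "ennreal ((LINT x|M1. g x) + (LINT x|M2. g x)) = ennreal ((LINT x|M3. g x) + (LINT x|M4. g x))"
    using nn by (simp add: e g)
  then show ?thesis
    using nn by (metis add_nonneg_nonneg ennreal_inj)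
qed

lemma integral_measure_diff_eq:
  fixes g :: "complex \<Rightarrow> complex"
  assumes sets: "sets M1 = sets (borel::complex measure)" "sets M2 = sets (borel::complex measure)"
      "sets M3 = sets (borel::complex measure)" "sets M4 = sets (borel::complex measure)"
    and eq: "\<And>A. A \<in> sets borel \<Longrightarrow>
      emeasure M1 A + emeasure M2 A = emeasure M3 A + emeasure M4 A"
    and g: "g \<in> borel_measurable borel"
      "integrable M1 g" "integrable M2 g" "integrable M3 g" "integrable M4 g"
  shows "(LINT x|M1. g x) + (LINT x|M2. g x) = (LINT x|M3. g x) + (LINT x|M4. g x)"
proof -
  have re: "(LINT x|M1. h x) + (LINT x|M2. h x) = (LINT x|M3. h x) + (LINT x|M4. h x)"
    if h: "h \<in> borel_measurable borel"
      "integrable M1 h" "integrable M2 h" "integrable M3 h" "integrable M4 h" for h :: "complex \<Rightarrow> real"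
  proof -
    let ?p = "\<lambda>x. max 0 (h x)" and ?n = "\<lambda>x. max 0 (- h x)"
    have d: "(LINT x|M. h x) = (LINT x|M. ?p x) - (LINT x|M. ?n x)" if "integrable M h" for M
    proof -
      have "(LINT x|M. h x) = (LINT x|M. ?p x - ?n x)" by (rule Bochner_Integration.integral_cong) auto
      then show ?thesis using that by simp
    qed
    have "(LINT x|M1. ?p x) + (LINT x|M2. ?p x) = (LINT x|M3. ?p x) + (LINT x|M4. ?p x)"
      by (rule integral_measure_diff_eq_nonneg[OF sets eq]) (use h in auto)
    moreover have "(LINT x|M1. ?n x) + (LINT x|M2. ?n x) = (LINT x|M3. ?n x) + (LINT x|M4. ?n x)"
      by (rule integral_measure_diff_eq_nonneg[OF sets eq]) (use h in auto)
    ultimately show ?thesis by (simp add: d h)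
  qed
  show ?thesis
  proof (rule complex_eqI)
    show "Re ((LINT x|M1. g x) + (LINT x|M2. g x)) = Re ((LINT x|M3. g x) + (LINT x|M4. g x))"
      using re[of "\<lambda>x. Re (g x)"] g by (simp add: integral_Re)
    show "Im ((LINT x|M1. g x) + (LINT x|M2. g x)) = Im ((LINT x|M3. g x) + (LINT x|M4. g x))"
      using re[of "\<lambda>x. Im (g x)"] g by (simp add: integral_Im)
  qed
qed

section \<open>Cauchy transforms\<close>

definition carried_by :: "complex set \<Rightarrow> complex measure \<Rightarrow> bool" where
  "carried_by E M \<longleftrightarrow> finite_measure M \<and> sets M = sets borel \<and> emeasure M (- E) = 0"

lemma carried_byD:
  assumes "carried_by E M"
  shows "finite_measure M" "sets M = sets borel" "emeasure M (- E) = 0" "space M = UNIV"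
  using assms sets_eq_imp_space_eq[of M borel] by (auto simp: carried_by_def)

lemma carried_by_AE:
  assumes "carried_by E M" "E \<in> sets borel"
  shows "AE x in M. x \<in> E"
  by (rule AE_I[of _ _ "- E"]) (use assms in \<open>auto simp: carried_by_def\<close>)

lemma carried_by_null:
  assumes M: "carried_by E M" and E: "E \<in> sets borel" and A: "A \<inter> E = {}"
  shows "measure M A = 0"
proof -
  have "emeasure M A \<le> emeasure M (- E)"
    by (rule emeasure_mono) (use A E carried_byD(2)[OF M] in \<open>auto simp: borel_comp\<close>)
  then show ?thesis using carried_byD(3)[OF M] by (simp add: measure_def)
qed

lemma carried_by_integral_one:
  assumes M: "carried_by E M" and E: "E \<in> sets borel"
  shows "(LINT x|M. 1) = complex_of_real (measure M E)"
proof -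
  have "measure M UNIV = measure M E"
    using carried_by_AE[OF M E] carried_byD[OF M] E
    by (intro finite_measure.finite_measure_eq_AE) auto
  then show ?thesis using carried_byD(4)[OF M] by (simp add: scaleR_conv_of_real)
qed

lemma carried_by_measurable:
  assumes "carried_by E M"
  shows "borel_measurable M = borel_measurable borel"
  using carried_byD(2)[OF assms] by (rule measurable_cong_sets) simp

lemma carried_by_integrable:
  fixes g :: "complex \<Rightarrow> complex"
  assumes M: "carried_by E M" and E: "E \<in> sets borel" and g: "g \<in> borel_measurable borel"
    and B: "\<And>x. x \<in> E \<Longrightarrow> cmod (g x) \<le> B"
  shows "integrable M g"
proof (rule finite_measure.integrable_const_bound[OF carried_byD(1)[OF M]])
  show "AE x in M. cmod (g x) \<le> B"
    using carried_by_AE[OF M E] by eventually_elim (rule B)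
  show "g \<in> borel_measurable M"
    using g unfolding carried_by_measurable[OF M] .
qed

lemma carried_by_tendsto:
  fixes h :: "nat \<Rightarrow> complex \<Rightarrow> complex"
  assumes M: "carried_by E M" and E: "E \<in> sets borel"
    and h: "\<And>j. h j \<in> borel_measurable borel" "l \<in> borel_measurable borel"
    and B: "\<And>j x. x \<in> E \<Longrightarrow> cmod (h j x) \<le> B"
    and lim: "\<And>x. x \<in> E \<Longrightarrow> (\<lambda>j. h j x) \<longlonglongrightarrow> l x"
  shows "(\<lambda>j. LINT x|M. h j x) \<longlonglongrightarrow> (LINT x|M. l x)"
proof (rule integral_dominated_convergence)
  show "l \<in> borel_measurable M" "\<And>j. h j \<in> borel_measurable M"
    using h unfolding carried_by_measurable[OF M] by blast+
  show "integrable M (\<lambda>_. B)"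
    using carried_byD(1)[OF M] by (simp add: finite_measure.integrable_const)
  show "AE x in M. (\<lambda>j. h j x) \<longlonglongrightarrow> l x"
    using carried_by_AE[OF M E] by eventually_elim (rule lim)
  show "AE x in M. cmod (h j x) \<le> B" for j
    using carried_by_AE[OF M E] by eventually_elim (rule B)
qed

lemma carried_by_positive_part:
  assumes \<nu>: "signed_borel_measure \<nu>" and E: "E \<in> sets borel"
    and s: "\<And>A. A \<in> sets borel \<Longrightarrow> A \<inter> E = {} \<Longrightarrow> \<nu> A = 0"
  shows "carried_by E (positive_part_measure \<nu>)"
proof -
  have "emeasure (positive_part_measure \<nu>) (- E) = 0"
  proof (rule null_positive_part_measure[OF \<nu>])
    show "- E \<in> sets borel" using E by (simp add: borel_comp)
    show "\<nu> B = 0" if "B \<in> sets borel" "B \<subseteq> - E" for B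
      using that by (intro s) auto
  qed
  then show ?thesis
    by (simp add: carried_by_def \<nu> finite_measure_positive_part)
qed

text \<open>The arguments stand for positive and negative parts of the real and of the imaginary
  part of a complex measure; limits, sums and derivatives thereby reduce to positive
  measures.\<close>

definition four_integral ::
  "complex measure \<Rightarrow> complex measure \<Rightarrow> complex measure \<Rightarrow> complex measure \<Rightarrow> (complex \<Rightarrow> complex) \<Rightarrow> complex"
  where "four_integral P N P' N' g =
     (LINT x|P. g x) - (LINT x|N. g x) + \<i> * ((LINT x|P'. g x) - (LINT x|N'. g x))"

lemma complex_borel_measure_Re_Im:
  assumes "complex_borel_measure \<mu>"
  shows "signed_borel_measure (\<lambda>A. Re (\<mu> A))" "signed_borel_measure (\<lambda>A. Im (\<mu> A))"
  using assms unfolding complex_borel_measure_def signed_borel_measure_def sums_complex_iff by blast+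

lemma complex_measure_parts:
  assumes \<mu>: "complex_borel_measure \<mu>" and s: "supported_on \<mu> E" and E: "E \<in> sets borel"
  obtains P N P' N' where "carried_by E P" "carried_by E N" "carried_by E P'" "carried_by E N'"
    "complex_measure_integral \<mu> = four_integral P N P' N'"
    "\<mu> E = four_integral P N P' N' (\<lambda>_. 1)"
proof -
  note r = complex_borel_measure_Re_Im[OF \<mu>]
  note r' = signed_borel_measure_uminus[OF r(1)] signed_borel_measure_uminus[OF r(2)]
  have z: "\<mu> A = 0" if "A \<in> sets borel" "A \<inter> E = {}" for A
    using s that by (simp add: supported_on_def)
  let ?P = "positive_part_measure (\<lambda>A. Re (\<mu> A))" and ?N = "positive_part_measure (\<lambda>A. - Re (\<mu> A))"
  let ?P' = "positive_part_measure (\<lambda>A. Im (\<mu> A))" and ?N' = "positive_part_measure (\<lambda>A. - Im (\<mu> A))"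
  have c: "carried_by E ?P" "carried_by E ?N" "carried_by E ?P'" "carried_by E ?N'"
    by (rule carried_by_positive_part; use r r' E z in simp)+
  have i: "complex_measure_integral \<mu> = four_integral ?P ?N ?P' ?N'"
    by (auto simp: fun_eq_iff complex_measure_integral_def signed_integral_def four_integral_def)
  note one = carried_by_integral_one[OF _ E]
  have "\<mu> E = four_integral ?P ?N ?P' ?N' (\<lambda>_. 1)"
    unfolding four_integral_def one[OF c(1)] one[OF c(2)] one[OF c(3)] one[OF c(4)]
    using jordan_decomposition[OF r(1) E] jordan_decomposition[OF r(2) E]
    by (simp add: complex_eq_iff)
  with c i that show ?thesis by blast
qed

lemma four_integral_tendsto:
  assumes c: "carried_by E P" "carried_by E N" "carried_by E P'" "carried_by E N'"
    and E: "E \<in> sets borel"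
    and h: "\<And>j. h j \<in> borel_measurable borel" "l \<in> borel_measurable borel"
    and B: "\<And>j x. x \<in> E \<Longrightarrow> cmod (h j x) \<le> B"
    and lim: "\<And>x. x \<in> E \<Longrightarrow> (\<lambda>j. h j x) \<longlonglongrightarrow> l x"
  shows "(\<lambda>j. four_integral P N P' N' (h j)) \<longlonglongrightarrow> four_integral P N P' N' l"
proof -
  have t: "(\<lambda>j. LINT x|M. h j x) \<longlonglongrightarrow> (LINT x|M. l x)" if "carried_by E M" for M
    using that E h B lim by (rule carried_by_tendsto)
  show ?thesis
    unfolding four_integral_def
    by (rule tendsto_add[OF tendsto_diff[OF t[OF c(1)] t[OF c(2)]]
          tendsto_mult_left[OF tendsto_diff[OF t[OF c(3)] t[OF c(4)]]]])
qed

lemma four_integral_sum: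
  fixes g :: "'i \<Rightarrow> complex \<Rightarrow> complex"
  assumes c: "carried_by E P" "carried_by E N" "carried_by E P'" "carried_by E N'"
    and E: "E \<in> sets borel"
    and g: "\<And>k. k \<in> I \<Longrightarrow> g k \<in> borel_measurable borel"
    and B: "\<And>k x. k \<in> I \<Longrightarrow> x \<in> E \<Longrightarrow> cmod (g k x) \<le> B k"
  shows "four_integral P N P' N' (\<lambda>x. \<Sum>k\<in>I. a k * g k x) = (\<Sum>k\<in>I. a k * four_integral P N P' N' (g k))"
proof -
  have i: "(LINT x|M. (\<Sum>k\<in>I. a k * g k x)) = (\<Sum>k\<in>I. a k * (LINT x|M. g k x))" if "carried_by E M" for M
    using carried_by_integrable[OF that E g B] by simp
  show ?thesis
    unfolding four_integral_def i[OF c(1)] i[OF c(2)] i[OF c(3)] i[OF c(4)]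
    by (simp add: sum_distrib_left sum_subtractf sum.distrib algebra_simps)
qed

text \<open>\<open>signed_integral\<close> refers to the Jordan parts of \<nu>, which are not
  explicit for a measure built on a curve; this lemma allows any decomposition to take their
  place.\<close>

lemma signed_integral_measure_diff:
  assumes P: "carried_by E P" and N: "carried_by E N" and E: "E \<in> sets borel"
    and g: "g \<in> borel_measurable borel" and B: "\<And>x. x \<in> E \<Longrightarrow> cmod (g x) \<le> B"
    and \<nu>: "signed_borel_measure \<nu>" "\<And>A. A \<in> sets borel \<Longrightarrow> \<nu> A = measure P A - measure N A"
  shows "signed_integral \<nu> g = (LINT x|P. g x) - (LINT x|N. g x)"
proof -
  note \<nu>' = signed_borel_measure_uminus[OF \<nu>(1)]
  let ?P = "positive_part_measure \<nu>" and ?N = "positive_part_measure (\<lambda>A. - \<nu> A)"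
  have z: "\<nu> A = 0" if A: "A \<in> sets borel" "A \<inter> E = {}" for A
    using carried_by_null[OF P E A(2)] carried_by_null[OF N E A(2)] \<nu>(2)[OF A(1)] by simp
  have c: "carried_by E ?P" "carried_by E ?N"
    by (rule carried_by_positive_part; use \<nu>(1) \<nu>' E z in simp)+
  have e: "emeasure M A = ennreal (measure M A)" if "carried_by E M" for M A
    using carried_byD(1)[OF that] by (rule finite_measure.emeasure_eq_measure)
  have "(LINT x|?P. g x) + (LINT x|N. g x) = (LINT x|?N. g x) + (LINT x|P. g x)"
  proof (rule integral_measure_diff_eq)
    fix A :: "complex set" assume A: "A \<in> sets borel"
    have "measure ?P A + measure N A = measure ?N A + measure P A"
      using jordan_decomposition[OF \<nu>(1) A] \<nu>(2)[OF A] by simp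
    then show "emeasure ?P A + emeasure N A = emeasure ?N A + emeasure P A"
      by (simp add: e c P N flip: ennreal_plus)
  qed (use carried_byD(2) carried_by_integrable[OF _ E g B] c P N g in auto)
  then show ?thesis
    unfolding signed_integral_def by (simp add: algebra_simps)
qed

lemma complex_measure_of_parts:
  assumes c: "carried_by E P" "carried_by E N" "carried_by E P'" "carried_by E N'"
    and E: "E \<in> sets borel"
  defines "\<mu> \<equiv> \<lambda>A. Complex (measure P A - measure N A) (measure P' A - measure N' A)"
  shows "complex_borel_measure \<mu>" "supported_on \<mu> E"
    "\<And>g B. g \<in> borel_measurable borel \<Longrightarrow> (\<And>x. x \<in> E \<Longrightarrow> cmod (g x) \<le> B) \<Longrightarrow>
       complex_measure_integral \<mu> g = four_integral P N P' N' g"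
proof -
  have sums: "(\<lambda>n. measure M (A n)) sums measure M (\<Union>n. A n)"
    if "carried_by E M" "range A \<subseteq> sets borel" "disjoint_family A" for M and A :: "nat \<Rightarrow> complex set"
    using finite_measure.finite_measure_UNION[OF carried_byD(1)[OF that(1)], of A]
      carried_byD(2)[OF that(1)] that by auto
  show cbm: "complex_borel_measure \<mu>"
    unfolding complex_borel_measure_def \<mu>_def sums_complex_iff
    by (auto intro!: sums_diff sums c)
  show "supported_on \<mu> E"
    unfolding supported_on_def \<mu>_def using c by (simp add: complex_eq_iff carried_by_null[OF _ E])
  fix g :: "complex \<Rightarrow> complex" and B
  assume g: "g \<in> borel_measurable borel" and B: "\<And>x. x \<in> E \<Longrightarrow> cmod (g x) \<le> B"
  have 1: "signed_integral (\<lambda>A. Re (\<mu> A)) g = (LINT x|P. g x) - (LINT x|N. g x)"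
    by (rule signed_integral_measure_diff[OF c(1,2) E g B complex_borel_measure_Re_Im(1)[OF cbm]])
      (auto simp: \<mu>_def)
  have 2: "signed_integral (\<lambda>A. Im (\<mu> A)) g = (LINT x|P'. g x) - (LINT x|N'. g x)"
    by (rule signed_integral_measure_diff[OF c(3,4) E g B complex_borel_measure_Re_Im(2)[OF cbm]])
      (auto simp: \<mu>_def)
  show "complex_measure_integral \<mu> g = four_integral P N P' N' g"
    by (simp add: complex_measure_integral_def four_integral_def 1 2)
qed

text \<open>Differentiation under the integral sign. With the quotient \<open>Q\<close> in closed
  form, the difference quotients along a sequence are integrals of functions bounded by
  \<open>B\<close> on \<open>E\<close>, and dominated convergence applies.\<close>

lemma carried_by_has_field_derivative:
  fixes F Q :: "complex \<Rightarrow> complex \<Rightarrow> complex"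
  assumes M: "carried_by E M" and E: "E \<in> sets borel" and W: "open W" "w0 \<in> W"
    and F: "\<And>w. F w \<in> borel_measurable borel" and Q: "\<And>w. Q w \<in> borel_measurable borel"
    and FB: "\<And>w. w \<in> W \<Longrightarrow> \<exists>B. \<forall>x\<in>E. cmod (F w x) \<le> B"
    and FQ: "\<And>w x. w \<in> W \<Longrightarrow> x \<in> E \<Longrightarrow> F w x - F w0 x = (w - w0) * Q w x"
    and QB: "\<And>w x. w \<in> W \<Longrightarrow> x \<in> E \<Longrightarrow> cmod (Q w x) \<le> B"
    and Qc: "\<And>x. x \<in> E \<Longrightarrow> isCont (\<lambda>w. Q w x) w0"
  shows "((\<lambda>w. LINT x|M. F w x) has_field_derivative (LINT x|M. Q w0 x)) (at w0)"
proof -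
  have Fi: "integrable M (F w)" if "w \<in> W" for w
    using FB[OF that] carried_by_integrable[OF M E F] by blast
  have "((\<lambda>w. ((LINT x|M. F w x) - (LINT x|M. F w0 x)) / (w - w0)) \<longlongrightarrow> (LINT x|M. Q w0 x)) (at w0 within W)"
    unfolding tendsto_at_iff_sequentially
  proof (intro allI impI)
    fix X :: "nat \<Rightarrow> complex" assume X: "\<forall>i. X i \<in> W - {w0}" "X \<longlonglongrightarrow> w0"
    have "(\<lambda>i. LINT x|M. Q (X i) x) \<longlonglongrightarrow> (LINT x|M. Q w0 x)"
    proof (rule carried_by_tendsto[OF M E Q Q])
      show "cmod (Q (X i) x) \<le> B" if "x \<in> E" for i x
        using QB X(1) that by auto
      show "(\<lambda>i. Q (X i) x) \<longlonglongrightarrow> Q w0 x" if "x \<in> E" for x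
        using isCont_tendsto_compose[OF Qc[OF that] X(2)] .
    qed
    moreover have "((LINT x|M. F (X i) x) - (LINT x|M. F w0 x)) / (X i - w0) = (LINT x|M. Q (X i) x)" for i
    proof -
      have Xi: "X i \<in> W" "X i \<noteq> w0" using X(1) by auto
      have Qi: "integrable M (Q (X i))"
        using carried_by_integrable[OF M E Q QB[OF Xi(1)]] .
      have "(LINT x|M. F (X i) x) - (LINT x|M. F w0 x) = (LINT x|M. F (X i) x - F w0 x)"
        using Fi[OF Xi(1)] Fi[OF W(2)] by simp
      also have "\<dots> = (LINT x|M. (X i - w0) * Q (X i) x)"
        by (rule integral_cong_AE)
          (use carried_by_AE[OF M E] FQ[OF Xi(1)] F Q in
            \<open>auto simp: carried_by_measurable[OF M] elim!: eventually_mono\<close>)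
      also have "\<dots> = (X i - w0) * (LINT x|M. Q (X i) x)"
        using Qi by simp
      finally show ?thesis using Xi by simp
    qed
    ultimately show "((\<lambda>w. ((LINT x|M. F w x) - (LINT x|M. F w0 x)) / (w - w0)) \<circ> X) \<longlonglongrightarrow> (LINT x|M. Q w0 x)"
      by (simp add: o_def)
  qed
  then show ?thesis
    unfolding has_field_derivative_iff at_within_open[OF W(2) W(1)] .
qed

lemma compact_bounded_away:
  fixes f :: "complex \<Rightarrow> complex"
  assumes "compact E" "continuous_on E f" "\<And>x. x \<in> E \<Longrightarrow> f x \<noteq> 0"
  shows "\<exists>c>0. \<forall>x\<in>E. c \<le> cmod (f x)"
proof (cases "E = {}")
  case True
  then show ?thesis by (auto intro: exI[of _ 1])
next
  case False
  have "continuous_on E (\<lambda>x. cmod (f x))"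
    using assms by (intro continuous_intros)
  then obtain x0 where "x0 \<in> E" "\<And>x. x \<in> E \<Longrightarrow> cmod (f x0) \<le> cmod (f x)"
    using continuous_attains_inf[OF assms(1) False] by metis
  then show ?thesis using assms(3) by (intro exI[of _ "cmod (f x0)"]) auto
qed

lemma carried_by_cauchy_has_derivative:
  assumes M: "carried_by E M" and E: "compact E" and z0: "z0 \<notin> E"
  shows "\<exists>D. ((\<lambda>z. LINT \<xi>|M. 1 / (\<xi> - z)) has_field_derivative D) (at z0)"
proof -
  have Eb: "E \<in> sets borel" using E by (simp add: borel_compact)
  obtain d where d: "d > 0" "\<And>x. x \<in> E \<Longrightarrow> cmod (x - z0) \<ge> d"
  proof -
    have "\<exists>d>0. \<forall>x\<in>E. d \<le> cmod (x - z0)"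
      by (rule compact_bounded_away[OF E]) (use z0 in \<open>auto intro!: continuous_intros\<close>)
    then show ?thesis using that by blast
  qed
  have far: "cmod (x - z) \<ge> d / 2" if "z \<in> ball z0 (d / 2)" "x \<in> E" for z x
  proof -
    have "cmod (x - z0) \<le> cmod (x - z) + cmod (z - z0)"
      using norm_triangle_ineq[of "x - z" "z - z0"] by simp
    moreover have "cmod (z - z0) < d / 2" using that(1) by (simp add: dist_norm norm_minus_commute)
    ultimately show ?thesis using d(2)[OF that(2)] by linarith
  qed
  have z0b: "z0 \<in> ball z0 (d / 2)" using d by simp
  have ne: "x - z \<noteq> 0" if "z \<in> ball z0 (d / 2)" "x \<in> E" for z x
    using far[OF that] d by auto
  have "((\<lambda>z. LINT \<xi>|M. 1 / (\<xi> - z)) has_field_derivative (LINT x|M. 1 / ((x - z0) * (x - z0)))) (at z0)"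
  proof (rule carried_by_has_field_derivative[OF M Eb open_ball z0b, where B = "1 / ((d / 2) * (d / 2))"
        and Q = "\<lambda>w x. 1 / ((x - w) * (x - z0))"])
    show "\<exists>B. \<forall>x\<in>E. cmod (1 / (x - w)) \<le> B" if "w \<in> ball z0 (d / 2)" for w
    proof (intro exI ballI)
      show "cmod (1 / (x - w)) \<le> 1 / (d / 2)" if "x \<in> E" for x
        unfolding norm_divide norm_one
        using far[OF \<open>w \<in> ball z0 (d / 2)\<close> that] d by (intro frac_le) auto
    qed
    show "1 / (x - w) - 1 / (x - z0) = (w - z0) * (1 / ((x - w) * (x - z0)))"
      if "w \<in> ball z0 (d / 2)" "x \<in> E" for w x
      using ne[OF that] ne[OF z0b that(2)] by (simp add: field_simps)
    show "cmod (1 / ((x - w) * (x - z0))) \<le> 1 / ((d / 2) * (d / 2))"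
      if "w \<in> ball z0 (d / 2)" "x \<in> E" for w x
      unfolding norm_divide norm_mult norm_one
      using far[OF that] far[OF z0b that(2)] d by (intro frac_le mult_mono) auto
    show "isCont (\<lambda>w. 1 / ((x - w) * (x - z0))) z0" if "x \<in> E" for x
      using ne[OF z0b that] by (intro continuous_intros) auto
  qed measurable
  then show ?thesis by blast
qed

text \<open>The kernel is \<open>1 / (\<xi> - 1 / w)\<close>, rewritten so that it makes sense at
  \<open>w = 0\<close>, the point at infinity. There the derivative is minus the total mass.\<close>

lemma carried_by_cauchy_infinity_derivative:
  assumes M: "carried_by E M" and E: "compact E" and w0: "\<And>x. x \<in> E \<Longrightarrow> w0 * x \<noteq> 1"
  shows "((\<lambda>w. LINT \<xi>|M. w / (w * \<xi> - 1)) has_field_derivative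
           (LINT \<xi>|M. - 1 / ((w0 * \<xi> - 1) * (w0 * \<xi> - 1)))) (at w0)"
proof -
  have Eb: "E \<in> sets borel" using E by (simp add: borel_compact)
  obtain d where d: "d > 0" "\<And>x. x \<in> E \<Longrightarrow> cmod (w0 * x - 1) \<ge> d"
  proof -
    have "\<exists>d>0. \<forall>x\<in>E. d \<le> cmod (w0 * x - 1)"
      by (rule compact_bounded_away[OF E]) (use w0 in \<open>auto intro!: continuous_intros\<close>)
    then show ?thesis using that by blast
  qed
  obtain R where R: "R > 0" "\<And>x. x \<in> E \<Longrightarrow> cmod x \<le> R"
    using compact_imp_bounded[OF E] unfolding bounded_pos by blast
  \<comment> \<open>With this radius \<open>w * x - 1\<close> changes by at most
    \<open>r * R = d / 2\<close> over the ball, uniformly in \<open>x \<in> E\<close>.\<close>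
  define r where "r = d / (2 * R)"
  have r: "r > 0" using d R by (simp add: r_def)
  have far: "cmod (w * x - 1) \<ge> d / 2" if "w \<in> ball w0 r" "x \<in> E" for w x
  proof -
    have "cmod (w0 * x - 1) \<le> cmod (w * x - 1) + cmod ((w0 - w) * x)"
      using norm_triangle_ineq[of "w * x - 1" "(w0 - w) * x"] by (simp add: algebra_simps)
    moreover have "cmod ((w0 - w) * x) \<le> r * R"
      unfolding norm_mult using that R r by (intro mult_mono) (auto simp: dist_norm)
    moreover have "r * R = d / 2" using R by (simp add: r_def)
    ultimately show ?thesis using d(2)[OF that(2)] by linarith
  qed
  have w0b: "w0 \<in> ball w0 r" using r by simp
  have ne: "w * x - 1 \<noteq> 0" if "w \<in> ball w0 r" "x \<in> E" for w x
    using far[OF that] d by auto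
  show ?thesis
  proof (rule carried_by_has_field_derivative[OF M Eb open_ball w0b, where B = "1 / ((d / 2) * (d / 2))"
        and Q = "\<lambda>w x. - 1 / ((w * x - 1) * (w0 * x - 1))"])
    show "\<exists>B. \<forall>x\<in>E. cmod (w / (w * x - 1)) \<le> B" if "w \<in> ball w0 r" for w
    proof (intro exI ballI)
      show "cmod (w / (w * x - 1)) \<le> cmod w / (d / 2)" if "x \<in> E" for x
        unfolding norm_divide
        using far[OF \<open>w \<in> ball w0 r\<close> that] d by (intro frac_le) auto
    qed
    show "w / (w * x - 1) - w0 / (w0 * x - 1) = (w - w0) * (- 1 / ((w * x - 1) * (w0 * x - 1)))"
      if "w \<in> ball w0 r" "x \<in> E" for w x
      using ne[OF that] ne[OF w0b that(2)] by (simp add: divide_simps) (simp add: algebra_simps)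
    show "cmod (- 1 / ((w * x - 1) * (w0 * x - 1))) \<le> 1 / ((d / 2) * (d / 2))"
      if "w \<in> ball w0 r" "x \<in> E" for w x
      unfolding norm_divide norm_mult norm_one norm_minus_cancel
      using far[OF that] far[OF w0b that(2)] d by (intro frac_le mult_mono) auto
    show "isCont (\<lambda>w. - 1 / ((w * x - 1) * (w0 * x - 1))) w0" if "x \<in> E" for x
      using ne[OF w0b that] by (intro continuous_intros) auto
  qed measurable
qed

text \<open>The derivative \<open>- \<mu> E\<close> links the two capacities: the mass of a
  competitor for \<gamma>_c is, up to sign, the derivative at infinity of its Cauchy
  transform.\<close>

lemma
  assumes E: "compact E" and \<mu>: "complex_borel_measure \<mu>" "supported_on \<mu> E"
  shows cauchy_transform_holomorphic: "(cauchy_transform \<mu> \<circ> Some) holomorphic_on - E"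
    and cauchy_transform_holomorphic_infinity:
      "(cauchy_transform \<mu> \<circ> chart_at_infinity) holomorphic_on {w. \<forall>x\<in>E. w * x \<noteq> 1}"
    and cauchy_transform_deriv_infinity:
      "((cauchy_transform \<mu> \<circ> chart_at_infinity) has_field_derivative - \<mu> E) (at 0)"
proof -
  have Eb: "E \<in> sets borel" using E by (simp add: borel_compact)
  obtain P N P' N' where c: "carried_by E P" "carried_by E N" "carried_by E P'" "carried_by E N'"
    and i: "complex_measure_integral \<mu> = four_integral P N P' N'"
    and one: "\<mu> E = four_integral P N P' N' (\<lambda>_. 1)"
    by (rule complex_measure_parts[OF \<mu> Eb])
  have Some: "cauchy_transform \<mu> \<circ> Some = (\<lambda>z. four_integral P N P' N' (\<lambda>\<xi>. 1 / (\<xi> - z)))"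
    by (auto simp: cauchy_transform_def i)
  have "1 / (\<xi> - 1 / w) = w / (w * \<xi> - 1)" if "w \<noteq> 0" for w \<xi> :: complex
    using that by (simp add: field_simps)
  then have chart: "cauchy_transform \<mu> \<circ> chart_at_infinity = (\<lambda>w. four_integral P N P' N' (\<lambda>\<xi>. w / (w * \<xi> - 1)))"
    by (auto simp: fun_eq_iff cauchy_transform_def i chart_at_infinity_def four_integral_def)
  show "(cauchy_transform \<mu> \<circ> Some) holomorphic_on - E"
  proof (rule holomorphic_onI)
    fix z assume "z \<in> - E"
    then have z: "z \<notin> E" by simp
    have f: "(\<lambda>z. LINT \<xi>|M. 1 / (\<xi> - z)) field_differentiable at z within - E" if "carried_by E M" for M
      using carried_by_cauchy_has_derivative[OF that E z]
      by (auto simp: field_differentiable_def intro: has_field_derivative_at_within)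
    show "(cauchy_transform \<mu> \<circ> Some) field_differentiable at z within - E"
      unfolding Some four_integral_def
      by (intro derivative_intros f c)
  qed
  have D: "((cauchy_transform \<mu> \<circ> chart_at_infinity) has_field_derivative
      four_integral P N P' N' (\<lambda>\<xi>. - 1 / ((w * \<xi> - 1) * (w * \<xi> - 1)))) (at w)"
    if "\<And>x. x \<in> E \<Longrightarrow> w * x \<noteq> 1" for w
  proof -
    note d = carried_by_cauchy_infinity_derivative[OF _ E that]
    show ?thesis
      unfolding chart four_integral_def
      using DERIV_add[OF DERIV_diff[OF d[OF c(1)] d[OF c(2)]]
          DERIV_cmult[OF DERIV_diff[OF d[OF c(3)] d[OF c(4)]], of \<i>]] by simp
  qed
  show "(cauchy_transform \<mu> \<circ> chart_at_infinity) holomorphic_on {w. \<forall>x\<in>E. w * x \<noteq> 1}"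
    by (rule holomorphic_onI) (auto simp: field_differentiable_def intro!: exI has_field_derivative_at_within[OF D])
  have "((cauchy_transform \<mu> \<circ> chart_at_infinity) has_field_derivative
      four_integral P N P' N' (\<lambda>\<xi>. - 1)) (at 0)"
    using D[of 0] by simp
  moreover have "four_integral P N P' N' (\<lambda>\<xi>. - 1) = - \<mu> E"
    unfolding one four_integral_def by (simp add: algebra_simps)
  ultimately show "((cauchy_transform \<mu> \<circ> chart_at_infinity) has_field_derivative - \<mu> E) (at 0)"
    by simp
qed

section \<open>Complex measures on parametrized curves\<close>

lemma carried_by_curve:
  fixes \<gamma> :: "real \<Rightarrow> complex" and v :: "real \<Rightarrow> real"
  assumes \<gamma>: "continuous_on UNIV \<gamma>" and v: "continuous_on UNIV v" "\<And>t. 0 \<le> v t"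
    and E: "E \<in> sets borel" "\<gamma> ` {0..1} \<subseteq> E"
  defines "M \<equiv> distr (density lborel (\<lambda>t. ennreal (indicator {0..1} t * v t))) borel \<gamma>"
  shows "carried_by E M"
    and "g \<in> borel_measurable borel \<Longrightarrow>
      (LINT x|M. g x) = (LINT t|lborel. (indicator {0..1} t * v t) *\<^sub>R (g (\<gamma> t) :: complex))"
proof -
  have m: "\<gamma> \<in> borel_measurable borel" "v \<in> borel_measurable borel"
    by (rule borel_measurable_continuous_onI[OF \<gamma>], rule borel_measurable_continuous_onI[OF v(1)])
  note [measurable] = m E(1)
  let ?w = "\<lambda>t. indicator {0..1} t * v t"
  have w: "\<And>t. 0 \<le> ?w t" using v(2) by simp
  have "integrable lborel (\<lambda>t. indicator {0..1} t *\<^sub>R v t)"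
    by (rule borel_integrable_compact) (use v in \<open>auto intro: continuous_on_subset\<close>)
  then have i: "integrable lborel ?w" by simp
  have e: "emeasure M A = (\<integral>\<^sup>+t. ennreal (?w t) * indicator A (\<gamma> t) \<partial>lborel)" if [measurable]: "A \<in> sets borel" for A
  proof -
    have "emeasure M A = emeasure (density lborel (\<lambda>t. ennreal (?w t))) (\<gamma> -` A)"
      unfolding M_def by (subst emeasure_distr) auto
    also have "\<dots> = (\<integral>\<^sup>+t. ennreal (?w t) * indicator (\<gamma> -` A) t \<partial>lborel)"
      by (rule emeasure_density) (use measurable_sets_borel[OF m(1) that] in auto)
    finally show ?thesis by (simp add: indicator_def)
  qed
  have "emeasure M UNIV = ennreal (LINT t|lborel. ?w t)"
    by (subst e) (use nn_integral_eq_integral[OF i] w in auto)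
  then have "finite_measure M"
    by (intro finite_measureI) (simp add: M_def)
  moreover have "emeasure M (- E) = 0"
  proof -
    have "ennreal (?w t) * indicator (- E) (\<gamma> t) = 0" for t
      using E(2) by (cases "t \<in> {0..1}") (auto simp: indicator_def image_subset_iff)
    then show ?thesis
      unfolding e[OF borel_comp[OF E(1)]] by (simp only: nn_integral_const mult_zero_left)
  qed
  ultimately show "carried_by E M"
    by (simp add: carried_by_def M_def)
  assume [measurable]: "g \<in> borel_measurable borel"
  have "(LINT x|M. g x) = (LINT t|density lborel (\<lambda>t. ennreal (?w t)). g (\<gamma> t))"
    unfolding M_def by (rule integral_distr) auto
  also have "\<dots> = (LINT t|lborel. ?w t *\<^sub>R g (\<gamma> t))"
    by (rule integral_density) (use w in auto)
  finally show "(LINT x|M. g x) = (LINT t|lborel. ?w t *\<^sub>R g (\<gamma> t))" .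
qed

text \<open>The positive and negative parts of \<open>Re (u t)\<close> and \<open>Im (u t)\<close>
  serve as densities on the unit interval; their images under \<gamma> are the four positive
  measures of the decomposition.\<close>

lemma complex_borel_measure_of_curve:
  fixes \<gamma> u :: "real \<Rightarrow> complex"
  assumes \<gamma>: "continuous_on UNIV \<gamma>" and u: "continuous_on UNIV u"
    and E: "E \<in> sets borel" "\<gamma> ` {0..1} \<subseteq> E"
  obtains \<mu> where "complex_borel_measure \<mu>" "supported_on \<mu> E"
    "\<mu> E = integral {0..1} u"
    "\<And>g. g \<in> borel_measurable borel \<Longrightarrow> bounded (g ` E) \<Longrightarrow> continuous_on (\<gamma> ` {0..1}) g \<Longrightarrow>
       complex_measure_integral \<mu> g = integral {0..1} (\<lambda>t. g (\<gamma> t) * u t)"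
proof -
  define M where "M v = distr (density lborel (\<lambda>t. ennreal (indicator {0..1} t * v t))) borel \<gamma>" for v
  define p where "p = (\<lambda>s (h :: complex \<Rightarrow> real) t. max 0 (s * h (u t)))"
  have p: "continuous_on UNIV (p s h)" "\<And>t. 0 \<le> p s h t" if "h = Re \<or> h = Im" for s h
  proof -
    have "continuous_on UNIV (\<lambda>t. Re (u t))" "continuous_on UNIV (\<lambda>t. Im (u t))"
      by (intro continuous_intros u)+
    then have "continuous_on UNIV (\<lambda>t. h (u t))" using that by blast
    then show "continuous_on UNIV (p s h)"
      unfolding p_def by (intro continuous_intros)
    show "0 \<le> p s h t" for t by (simp add: p_def)
  qed
  have cM: "carried_by E (M (p s h))" if "h = Re \<or> h = Im" for s h
    unfolding M_def by (rule carried_by_curve(1)[OF \<gamma> p[OF that] E])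
  have iM: "(LINT x|M (p s h). g x) = (LINT t|lborel. (indicator {0..1} t * p s h t) *\<^sub>R g (\<gamma> t))"
    if "h = Re \<or> h = Im" "g \<in> borel_measurable borel" for s h and g :: "complex \<Rightarrow> complex"
    unfolding M_def by (rule carried_by_curve(2)[OF \<gamma> p[OF that(1)] E that(2)])
  let ?P = "M (p 1 Re)" and ?N = "M (p (-1) Re)" and ?P' = "M (p 1 Im)" and ?N' = "M (p (-1) Im)"
  have c: "carried_by E ?P" "carried_by E ?N" "carried_by E ?P'" "carried_by E ?N'"
    using cM by simp_all
  have four: "four_integral ?P ?N ?P' ?N' g = integral {0..1} (\<lambda>t. g (\<gamma> t) * u t)"
    if g: "g \<in> borel_measurable borel" "continuous_on (\<gamma> ` {0..1}) g" for g
  proof -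
    have cg: "continuous_on {0..1} (\<lambda>t. g (\<gamma> t))"
      by (rule continuous_on_compose2[OF g(2)]) (use \<gamma> in \<open>auto intro: continuous_on_subset\<close>)
    have i: "integrable lborel (\<lambda>t. indicator {0..1} t *\<^sub>R (p s h t *\<^sub>R g (\<gamma> t)))"
      if "h = Re \<or> h = Im" for s h
      by (rule borel_integrable_compact)
        (use cg p[OF that] in \<open>auto intro!: continuous_intros intro: continuous_on_subset\<close>)
    have i': "integrable lborel (\<lambda>t. (indicator {0..1} t * p s h t) *\<^sub>R g (\<gamma> t))"
      if "h = Re \<or> h = Im" for s h
      using i[OF that] by simp
    have d: "p 1 h t - p (-1) h t = h (u t)" for h t
      by (simp add: p_def max_def)
    have cu: "continuous_on {0..1} u" using u by (rule continuous_on_subset) simp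
    have su: "set_integrable lborel {0..1} (\<lambda>t. g (\<gamma> t) * u t)"
      by (intro borel_integrable_atLeastAtMost' continuous_intros cg cu)
    have "four_integral ?P ?N ?P' ?N' g = (LINT t|lborel.
        ((indicator {0..1} t * p 1 Re t) *\<^sub>R g (\<gamma> t) - (indicator {0..1} t * p (-1) Re t) *\<^sub>R g (\<gamma> t))
        + \<i> * ((indicator {0..1} t * p 1 Im t) *\<^sub>R g (\<gamma> t) - (indicator {0..1} t * p (-1) Im t) *\<^sub>R g (\<gamma> t)))"
      unfolding four_integral_def using i' by (simp add: iM g(1))
    also have "\<dots> = (LINT t|lborel. indicator {0..1} t *\<^sub>R (g (\<gamma> t) * u t))"
    proof (rule Bochner_Integration.integral_cong[OF refl])
      fix t :: real
      have eq: "u t = of_real (p 1 Re t) - of_real (p (-1) Re t) + \<i> * (of_real (p 1 Im t) - of_real (p (-1) Im t))"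
        unfolding of_real_diff[symmetric] d by (rule complex_eq)
      show "((indicator {0..1} t * p 1 Re t) *\<^sub>R g (\<gamma> t) - (indicator {0..1} t * p (-1) Re t) *\<^sub>R g (\<gamma> t))
        + \<i> * ((indicator {0..1} t * p 1 Im t) *\<^sub>R g (\<gamma> t) - (indicator {0..1} t * p (-1) Im t) *\<^sub>R g (\<gamma> t))
        = indicator {0..1} t *\<^sub>R (g (\<gamma> t) * u t)"
        by (subst eq) (simp add: scaleR_conv_of_real algebra_simps)
    qed
    also have "\<dots> = integral {0..1} (\<lambda>t. g (\<gamma> t) * u t)"
      using set_borel_integral_eq_integral(2)[OF su] by (simp add: set_lebesgue_integral_def)
    finally show ?thesis .
  qed
  define \<mu> where "\<mu> = (\<lambda>A. Complex (measure ?P A - measure ?N A) (measure ?P' A - measure ?N' A))"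
  note \<mu> = complex_measure_of_parts[OF c E(1), folded \<mu>_def]
  note one = carried_by_integral_one[OF _ E(1)]
  have "\<mu> E = four_integral ?P ?N ?P' ?N' (\<lambda>_. 1)"
    unfolding four_integral_def one[OF c(1)] one[OF c(2)] one[OF c(3)] one[OF c(4)] \<mu>_def
    by (simp add: complex_eq_iff)
  also have "\<dots> = integral {0..1} u"
    by (subst four) auto
  finally have "\<mu> E = integral {0..1} u" .
  moreover have "complex_measure_integral \<mu> g = integral {0..1} (\<lambda>t. g (\<gamma> t) * u t)"
    if "g \<in> borel_measurable borel" "bounded (g ` E)" "continuous_on (\<gamma> ` {0..1}) g" for g
  proof -
    obtain B where B: "\<And>x. x \<in> E \<Longrightarrow> cmod (g x) \<le> B"
      using \<open>bounded (g ` E)\<close> by (auto simp: bounded_iff)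
    show ?thesis using \<mu>(3)[OF that(1) B] four[OF that(1,3)] by simp
  qed
  ultimately show ?thesis using that \<mu>(1,2) by blast
qed

section \<open>The outer domain and its Riemann map\<close>

text \<open>Adding infinity keeps \<open>outside E\<close> connected, as infinity is in the closure
  of this unbounded set. The result is open and closed in the complement of \<open>E\<close>, the
  rest of which is the open set \<open>inside E\<close>.\<close>

lemma outer_domain_eq:
  assumes E: "compact E"
  shows "outer_domain E = insert None (Some ` outside E)"
proof -
  let ?X = "subtopology riemann_sphere (sphere_compl E)"
  let ?T = "insert None (Some ` outside E)"
  have bE: "bounded E" and cE: "closed E"
    using E by (auto simp: compact_eq_bounded_closed)
  have top: "topspace riemann_sphere = UNIV"
    by (auto simp: UNIV_option_conv)
  have sub: "?T \<subseteq> sphere_compl E"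
    using outside_no_overlap[of E] unfolding sphere_compl_def by blast
  have openT: "openin riemann_sphere ?T"
  proof -
    have "compact (- outside E)"
      using cobounded_outside[OF bE] open_outside[OF cE] by (simp add: compact_eq_bounded_closed closed_Compl)
    then show ?thesis
      unfolding openin_Alexandroff_compactification
      by (intro disjI2 exI[of _ "- outside E"]) (auto simp: compact_imp_closed)
  qed
  have "connectedin riemann_sphere ?T"
  proof (rule connectedin_intermediate_closure_of)
    have "connectedin euclidean (outside E)"
      using connected_outside[OF bE] by simp
    then show "connectedin riemann_sphere (Some ` outside E)"
      by (rule connectedin_continuous_map_image[OF continuous_map_Some])
    have "\<exists>y. y \<in> Some ` outside E \<and> y \<in> U" if "None \<in> U" "openin riemann_sphere U" for U
    proof -
      from that obtain C where C: "compact C" "U = insert None (Some ` (- C))"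
        unfolding openin_Alexandroff_compactification by (auto simp: Compl_eq_Diff_UNIV)
      have "\<not> outside E \<subseteq> C"
        using unbounded_outside[OF bE] C(1) bounded_subset compact_imp_bounded by blast
      then show ?thesis using C(2) by blast
    qed
    then have "None \<in> riemann_sphere closure_of Some ` outside E"
      unfolding in_closure_of using top by auto
    moreover have "Some ` outside E \<subseteq> riemann_sphere closure_of Some ` outside E"
      by (rule closure_of_subset) (unfold top, rule subset_UNIV)
    ultimately show "?T \<subseteq> riemann_sphere closure_of Some ` outside E" by simp
  qed auto
  then have "connectedin ?X ?T"
    using sub by (simp add: connectedin_subtopology)
  then have "?T \<subseteq> outer_domain E"
    unfolding outer_domain_def by (rule connected_component_of_maximal) simp
  moreover have "outer_domain E \<subseteq> ?T \<or> disjnt (outer_domain E) ?T"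
  proof (rule connectedin_clopen_cases)
    show "connectedin ?X (outer_domain E)"
      unfolding outer_domain_def by (rule connectedin_connected_component_of)
    show "openin ?X ?T"
      by (rule subset_openin_subtopology[OF openT sub])
    have "openin riemann_sphere (Some ` inside E)"
      using open_inside[OF cE] by simp
    moreover have "Some ` inside E \<subseteq> sphere_compl E"
      by (auto simp: sphere_compl_def inside_def)
    ultimately have "openin ?X (Some ` inside E)"
      by (rule subset_openin_subtopology)
    moreover have tX: "topspace ?X = sphere_compl E"
      unfolding topspace_subtopology top by simp
    moreover have "topspace ?X - ?T = Some ` inside E"
      unfolding tX
    proof (rule set_eqI)
      fix p :: "complex option"
      show "p \<in> sphere_compl E - ?T \<longleftrightarrow> p \<in> Some ` inside E"
        by (cases p) (auto simp: sphere_compl_def image_iff inside_outside)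
    qed
    ultimately show "closedin ?X ?T"
      unfolding closedin_def using sub by simp
  qed
  ultimately show ?thesis by (auto simp: disjnt_def)
qed

text \<open>The outer domain in the chart at infinity, with infinity at \<open>0\<close>.\<close>

definition inv_domain :: "complex set \<Rightarrow> complex set" where
  "inv_domain E = {w. w = 0 \<or> 1 / w \<in> outside E}"

lemma zero_in_inv_domain [simp]: "0 \<in> inv_domain E"
  by (simp add: inv_domain_def)

lemma chart_vimage_outer_domain:
  assumes "compact E"
  shows "chart_at_infinity -` outer_domain E = inv_domain E"
    and "Some -` outer_domain E = outside E"
  by (auto simp: outer_domain_eq[OF assms] chart_at_infinity_def inv_domain_def split: if_splits)

lemma open_inverse_vimage:
  assumes "open A"
  shows "open {w :: complex. w \<noteq> 0 \<and> 1 / w \<in> A}"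
proof -
  have "open ((- {0}) \<inter> (\<lambda>w :: complex. 1 / w) -` A)"
    by (rule continuous_open_preimage) (use assms in \<open>auto intro!: continuous_intros\<close>)
  moreover have "(- {0}) \<inter> (\<lambda>w :: complex. 1 / w) -` A = {w. w \<noteq> 0 \<and> 1 / w \<in> A}"
    by auto
  ultimately show ?thesis by simp
qed

lemma inv_domain_contains_ball:
  assumes "compact E" "R > 0" "E \<subseteq> cball 0 R"
  shows "ball 0 (1 / R) \<subseteq> inv_domain E"
proof
  fix w :: complex assume w: "w \<in> ball 0 (1 / R)"
  show "w \<in> inv_domain E"
  proof (cases "w = 0")
    case False
    then have "cmod (1 / w) > R"
      using w assms(2) by (simp add: norm_divide field_simps)
    then have "1 / w \<in> - cball 0 R" by simp
    then show ?thesis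
      using outside_subset_convex[OF convex_cball assms(3)] by (auto simp: inv_domain_def)
  qed simp
qed

lemma open_inv_domain:
  assumes "compact E"
  shows "open (inv_domain E)"
proof -
  obtain R where R: "R > 0" "E \<subseteq> cball 0 R"
    using compact_imp_bounded[OF assms] by (auto simp: bounded_pos subset_iff)
  have "inv_domain E = ball 0 (1 / R) \<union> {w. w \<noteq> 0 \<and> 1 / w \<in> outside E}"
    using inv_domain_contains_ball[OF assms R] R(1) by (auto simp: inv_domain_def)
  moreover have "open {w. w \<noteq> 0 \<and> 1 / w \<in> outside E}"
    by (intro open_inverse_vimage open_outside compact_imp_closed assms)
  ultimately show ?thesis by (metis open_Un open_ball)
qed

text \<open>The image of \<open>outside E\<close> under \<open>1 / z\<close> lacks only
  \<open>0\<close>. A small disc around \<open>0\<close> is glued to it; the two overlap because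
  \<open>outside E\<close> is unbounded.\<close>

lemma connected_inv_domain:
  assumes "compact E" "0 \<notin> outside E"
  shows "connected (inv_domain E)"
proof -
  obtain R where R: "R > 0" "E \<subseteq> cball 0 R"
    using compact_imp_bounded[OF assms(1)] by (auto simp: bounded_pos subset_iff)
  have eq: "inv_domain E = ball 0 (1 / R) \<union> (\<lambda>z. 1 / z) ` outside E"
    using inv_domain_contains_ball[OF assms(1) R] R(1)
    by (auto simp: inv_domain_def image_iff) (metis div_by_1 divide_divide_eq_right mult_1)
  have "connected ((\<lambda>z. 1 / z) ` outside E)"
  proof (rule connected_continuous_image)
    show "continuous_on (outside E) (\<lambda>z. 1 / z)"
      using assms(2) by (auto intro!: continuous_intros)
    show "connected (outside E)"
      using compact_imp_bounded[OF assms(1)] by (intro connected_outside) auto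
  qed
  moreover have "ball 0 (1 / R) \<inter> (\<lambda>z. 1 / z) ` outside E \<noteq> {}"
  proof -
    obtain z where z: "z \<in> outside E" "z \<notin> cball 0 R"
      using unbounded_outside[OF compact_imp_bounded[OF assms(1)]] bounded_cball bounded_subset by blast
    then have "1 / z \<in> ball 0 (1 / R)"
      using R by (auto simp: norm_divide intro!: divide_strict_left_mono mult_pos_pos)
    then show ?thesis using z(1) by blast
  qed
  ultimately show ?thesis
    unfolding eq by (intro connected_Un) auto
qed

lemma inv_domain_subset_ball:
  assumes "\<rho> > 0" "cball 0 \<rho> \<inter> outside E = {}"
  shows "inv_domain E \<subseteq> ball 0 (1 / \<rho>)"
proof
  fix w assume w: "w \<in> inv_domain E"
  show "w \<in> ball 0 (1 / \<rho>)"
  proof (cases "w = 0")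
    case False
    then have "1 / w \<notin> cball 0 \<rho>" using w assms(2) by (auto simp: inv_domain_def)
    then show ?thesis using False assms(1) by (simp add: norm_divide field_simps)
  qed (use assms in simp)
qed

text \<open>The set is the union of the sets \<open>S - ball 0 d\<close>, which are connected by
  \<open>connected_diff_ball\<close> and share the point \<open>r\<close>.\<close>

lemma connected_delete_interior_point:
  fixes S :: "complex set"
  assumes S: "connected S" and r: "r > 0" "cball 0 r \<subseteq> S"
  shows "connected (S - {0})"
proof -
  have "S - {0} = (\<Union>d\<in>{0<..r}. S - ball 0 d)"
  proof (rule set_eqI, rule iffI)
    fix x assume x: "x \<in> S - {0}"
    then have "min r (cmod x) \<in> {0<..r}" "x \<in> S - ball 0 (min r (cmod x))"
      using r by auto
    then show "x \<in> (\<Union>d\<in>{0<..r}. S - ball 0 d)" by blast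
  qed auto
  moreover have "connected (\<Union>d\<in>{0<..r}. S - ball 0 d)"
  proof (rule connected_Union)
    show "connected T" if "T \<in> (\<lambda>d. S - ball 0 d) ` {0<..r}" for T
      using that r by (auto intro!: connected_diff_ball[OF S])
    have "complex_of_real r \<in> S - ball 0 d" if "d \<in> {0<..r}" for d
      using that r by auto
    then show "\<Inter> ((\<lambda>d. S - ball 0 d) ` {0<..r}) \<noteq> {}" by blast
  qed
  ultimately show ?thesis by simp
qed

text \<open>For a bounded open set it suffices that the set and its complement are connected. Here
  the complement is the image under \<open>1 / z\<close> of \<open>- outside E\<close> without its
  interior point \<open>0\<close>.\<close>

lemma simply_connected_inv_domain:
  assumes E: "compact E" and c: "connected (- outside E)" and \<rho>: "\<rho> > 0" "cball 0 \<rho> \<inter> outside E = {}"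
  shows "simply_connected (inv_domain E)"
proof -
  have z: "0 \<notin> outside E" using \<rho> by (force simp: disjoint_iff)
  have "- inv_domain E = (\<lambda>z. 1 / z) ` (- outside E - {0})"
  proof (rule set_eqI, rule iffI)
    fix w assume "w \<in> - inv_domain E"
    then show "w \<in> (\<lambda>z. 1 / z) ` (- outside E - {0})"
      by (intro image_eqI[of _ _ "1 / w"]) (auto simp: inv_domain_def)
  qed (auto simp: inv_domain_def)
  moreover have "connected ((\<lambda>z. 1 / z) ` (- outside E - {0}))"
  proof (rule connected_continuous_image)
    show "connected (- outside E - {0})"
      by (rule connected_delete_interior_point[OF c \<rho>(1)]) (use \<rho> in auto)
  qed (auto intro!: continuous_intros)
  moreover have "bounded (inv_domain E)"
    using inv_domain_subset_ball[OF \<rho>] bounded_ball bounded_subset by blast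
  ultimately show ?thesis
    using connected_inv_domain[OF E z] by (simp add: simply_connected_iff_simple[OF open_inv_domain[OF E]])
qed

section \<open>Riemann maps fixing 0 and consequences of the Schwarz lemma\<close>

lemma normalized_riemann_map:
  assumes V: "open V" "simply_connected V" "V \<noteq> UNIV" "0 \<in> V"
  obtains F G where "F holomorphic_on V" "G holomorphic_on ball 0 1"
    "\<And>v. v \<in> V \<Longrightarrow> F v \<in> ball 0 1 \<and> G (F v) = v"
    "\<And>w. w \<in> ball 0 1 \<Longrightarrow> G w \<in> V \<and> F (G w) = w" "F 0 = 0" "G 0 = (0 :: complex)"
proof -
  obtain F G where FG: "F holomorphic_on V" "G holomorphic_on ball 0 1"
    "\<And>v. v \<in> V \<Longrightarrow> F v \<in> ball 0 1 \<and> G (F v) = v"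
    "\<And>w. w \<in> ball 0 1 \<Longrightarrow> G w \<in> V \<and> F (G w) = w"
    using Riemann_mapping_theorem[of V] V by blast
  have a: "F 0 \<in> ball 0 1" using FG(3) V(4) by blast
  obtain f g where fg: "f (F 0) = 0" "f holomorphic_on ball 0 1" "f ` ball 0 1 \<subseteq> ball 0 1"
      "g holomorphic_on ball 0 1" "g ` ball 0 1 \<subseteq> ball 0 1"
      "\<And>z. z \<in> ball 0 1 \<Longrightarrow> f (g z) = z" "\<And>z. z \<in> ball 0 1 \<Longrightarrow> g (f z) = z"
    by (rule ball_biholomorphism_exists[OF a]) (rule that; assumption)
  have fb: "f z \<in> ball 0 1" and gb: "g z \<in> ball 0 1" if "z \<in> ball 0 1" for z
    using fg(3,5) that by blast+
  show ?thesis
  proof (rule that[of "\<lambda>v. f (F v)" "\<lambda>w. G (g w)"])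
    show "(\<lambda>v. f (F v)) holomorphic_on V"
      using holomorphic_on_compose_gen[OF FG(1) fg(2)] FG(3) by (simp add: o_def image_subset_iff)
    show "(\<lambda>w. G (g w)) holomorphic_on ball 0 1"
      using holomorphic_on_compose_gen[OF fg(4) FG(2) fg(5)] by (simp add: o_def)
    show "f (F v) \<in> ball 0 1 \<and> G (g (f (F v))) = v" if "v \<in> V" for v
      using FG(3)[OF that] fb[of "F v"] fg(7)[of "F v"] by simp
    show w: "G (g w) \<in> V \<and> f (F (G (g w))) = w" if "w \<in> ball 0 1" for w
      using FG(4)[OF gb[OF that]] fg(6)[OF that] by simp
    show "f (F 0) = 0" by (rule fg(1))
    have "g 0 = F 0" using fg(7)[OF a] fg(1) by simp
    then show "G (g 0) = 0" using FG(3)[OF V(4)] by simp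
  qed
qed

lemma exterior_riemann_map:
  assumes E: "compact E" and c: "connected (- outside E)" and \<rho>: "\<rho> > 0" "cball 0 \<rho> \<inter> outside E = {}"
  obtains F G where "F holomorphic_on inv_domain E" "G holomorphic_on ball 0 1"
    "\<And>v. v \<in> inv_domain E \<Longrightarrow> F v \<in> ball 0 1 \<and> G (F v) = v"
    "\<And>w. w \<in> ball 0 1 \<Longrightarrow> G w \<in> inv_domain E \<and> F (G w) = w" "F 0 = 0" "G 0 = 0"
proof (rule normalized_riemann_map[of "inv_domain E"])
  show "open (inv_domain E)" by (rule open_inv_domain[OF E])
  show "simply_connected (inv_domain E)" by (rule simply_connected_inv_domain[OF assms])
  show "inv_domain E \<noteq> UNIV"
    using inv_domain_subset_ball[OF \<rho>] by (metis bounded_ball bounded_subset not_bounded_UNIV)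
qed (use that in auto)

text \<open>Cauchy's estimate on circles of radius \<open>r < 1\<close>, with \<open>r\<close>
  tending to \<open>1\<close>. The value \<open>H 0\<close> is left free, since a competitor for
  \<gamma> may take any value at infinity.\<close>

lemma norm_deriv_le_1:
  assumes H: "H holomorphic_on ball 0 1" "\<And>w. w \<in> ball 0 1 \<Longrightarrow> cmod (H w) \<le> 1"
  shows "cmod (deriv H 0) \<le> 1"
proof (rule field_le_mult_one_interval)
  fix r :: real assume r: "0 < r" "r < 1"
  have "cball (0::complex) r \<subseteq> ball 0 1" using r by auto
  then have "norm ((deriv ^^ 1) H 0) \<le> fact 1 * 1 / r ^ 1"
    using r H by (intro Cauchy_inequality holomorphic_on_imp_continuous_on)
      (auto intro: holomorphic_on_subset)
  then show "r * cmod (deriv H 0) \<le> 1"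
    using r by (simp add: field_simps)
qed

text \<open>By the Schwarz-Pick inequality
  \<open>cmod (deriv H 0) \<le> 1 - (cmod (H 0))\<^sup>2\<close>, a derivative of modulus
  \<open>1\<close> forces \<open>H 0 = 0\<close>; then the Schwarz lemma makes \<open>H\<close> a
  rotation.\<close>

lemma schwarz_pick_equality:
  assumes H: "H holomorphic_on ball 0 1" "\<And>w. w \<in> ball 0 1 \<Longrightarrow> cmod (H w) \<le> 1"
    and d: "cmod (deriv H 0) = 1"
  obtains \<alpha> where "cmod \<alpha> = 1" "\<And>w. w \<in> ball 0 1 \<Longrightarrow> H w = \<alpha> * w"
proof -
  \<comment> \<open>By the maximum principle, modulus \<open>1\<close> at an interior point would
    make \<open>H\<close> constant, with derivative \<open>0\<close>.\<close>
  have lt: "cmod (H w) < 1" if w: "w \<in> ball 0 1" for w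
  proof (rule ccontr)
    assume "\<not> ?thesis"
    then have "cmod (H w) = 1" using H(2)[OF w] by simp
    then have "H constant_on ball 0 1"
      by (intro maximum_modulus_principle[OF H(1) open_ball connected_ball open_ball order_refl w])
        (use H(2) in auto)
    then obtain k where "\<And>x. x \<in> ball 0 1 \<Longrightarrow> H x = k" by (auto simp: constant_on_def)
    then have "deriv H 0 = deriv (\<lambda>_. k) 0"
      by (intro deriv_cong_ev) (auto intro!: eventually_nhds_in_open[of "ball 0 1", THEN eventually_mono])
    then show False using d by simp
  qed
  define a where "a = H 0"
  have a: "cmod a < 1" using lt[of 0] by (simp add: a_def)
  let ?M = "Moebius_function 0 a" and ?N = "Moebius_function 0 (- a)"
  have K: "(\<lambda>w. ?M (H w)) holomorphic_on ball 0 1"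
    using holomorphic_on_compose_gen[OF H(1) Moebius_function_holomorphic[OF a], of 0] lt
    by (simp add: o_def image_subset_iff)
  have Kd: "cmod (deriv (\<lambda>w. ?M (H w)) 0) \<le> 1"
  proof (rule Schwarz_Lemma(2)[OF K, of 0])
    show "?M (H 0) = 0" unfolding a_def by (rule Moebius_function_eq_zero)
    show "cmod (?M (H z)) < 1" if "cmod z < 1" for z
      using that by (intro Moebius_function_norm_lt_1[OF a] lt) simp
  qed simp
  \<comment> \<open>\<open>H\<close> is a disc automorphism after a map fixing \<open>0\<close>, so
    the chain rule splits off the factor \<open>1 - a * cnj a\<close> from its derivative.\<close>
  have HN: "H w = ?N (?M (H w))" if "w \<in> ball 0 1" for w
    using Moebius_function_compose[of "- a" a "H w"] a lt[OF that] by simp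
  have N': "(?N has_field_derivative (1 - a * cnj a)) (at (?M (H 0)))"
    unfolding a_def[symmetric] Moebius_function_eq_zero Moebius_function_simple
    by (rule derivative_eq_intros refl | simp)+
  have K': "((\<lambda>w. ?M (H w)) has_field_derivative deriv (\<lambda>w. ?M (H w)) 0) (at 0)"
    by (rule holomorphic_derivI[OF K]) auto
  have "((\<lambda>w. ?N (?M (H w))) has_field_derivative (1 - a * cnj a) * deriv (\<lambda>w. ?M (H w)) 0) (at 0)"
    by (rule DERIV_chain2[OF N' K'])
  then have "(H has_field_derivative (1 - a * cnj a) * deriv (\<lambda>w. ?M (H w)) 0) (at 0)"
    by (rule has_field_derivative_transform_within_open[of _ _ _ "ball 0 1"]) (use HN in auto)
  then have "cmod ((1 - a * cnj a) * deriv (\<lambda>w. ?M (H w)) 0) = 1"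
    using d DERIV_imp_deriv by metis
  then have "1 \<le> cmod (1 - a * cnj a)"
    unfolding norm_mult using Kd by (metis mult_left_le norm_ge_zero)
  moreover have "1 - a * cnj a = complex_of_real (1 - (cmod a)\<^sup>2)"
    unfolding of_real_diff complex_norm_square by simp
  moreover have "(cmod a)\<^sup>2 \<le> 1" using a by (simp add: power_le_one)
  ultimately have "1 \<le> \<bar>1 - (cmod a)\<^sup>2\<bar>" by (simp only: norm_of_real)
  then have "(cmod a)\<^sup>2 \<le> 0" using \<open>(cmod a)\<^sup>2 \<le> 1\<close> by linarith
  then have "H 0 = 0" by (simp add: a_def)
  then obtain \<alpha> where "\<forall>z. norm z < 1 \<longrightarrow> H z = \<alpha> * z" "norm \<alpha> = 1"
    using Schwarz_Lemma(3)[OF H(1), of 0] lt d by auto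
  then show ?thesis using that by auto
qed

section \<open>Competitors for the analytic capacity\<close>

definition admissible :: "complex set \<Rightarrow> (complex option \<Rightarrow> complex) \<Rightarrow> bool" where
  "admissible E g \<longleftrightarrow> g \<in> H_infty (outer_domain E) \<and> (\<forall>p\<in>outer_domain E. cmod (g p) \<le> 1)"

lemma analytic_capacity_eq:
  "analytic_capacity E = Sup {cmod (deriv_at_infinity g) | g. admissible E g}"
  unfolding analytic_capacity_def admissible_def ..

lemma admissible_iff:
  assumes E: "compact E"
  shows "admissible E g \<longleftrightarrow>
    (g \<circ> Some) holomorphic_on outside E \<and> (g \<circ> chart_at_infinity) holomorphic_on inv_domain E \<and>
    (\<forall>z\<in>outside E. cmod (g (Some z)) \<le> 1) \<and> cmod (g None) \<le> 1"
proof -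
  have "bounded (g ` outer_domain E)" if "\<forall>p\<in>outer_domain E. cmod (g p) \<le> 1"
    using that by (intro boundedI[of _ 1]) blast
  moreover have "(\<forall>p\<in>outer_domain E. cmod (g p) \<le> 1) \<longleftrightarrow>
      (\<forall>z\<in>outside E. cmod (g (Some z)) \<le> 1) \<and> cmod (g None) \<le> 1"
    by (simp add: outer_domain_eq[OF E] conj_commute)
  ultimately show ?thesis
    unfolding admissible_def H_infty_def sphere_holomorphic_on_def chart_vimage_outer_domain[OF E]
    by blast
qed

lemma admissible_chart_le:
  assumes "compact E" "admissible E g" "w \<in> inv_domain E"
  shows "cmod ((g \<circ> chart_at_infinity) w) \<le> 1"
  using assms by (auto simp: admissible_iff chart_at_infinity_def inv_domain_def)

text \<open>With \<open>z = 1 / w\<close> the expression under the limit is the difference quotient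
  at \<open>0\<close> in the chart.\<close>

lemma deriv_at_infinity_eq:
  assumes "((g \<circ> chart_at_infinity) has_field_derivative D) (at 0)"
  shows "deriv_at_infinity g = D"
proof -
  have "((\<lambda>w. ((g \<circ> chart_at_infinity) w - (g \<circ> chart_at_infinity) 0) / (w - 0)) \<longlongrightarrow> D) (at 0)"
    using assms by (simp add: has_field_derivative_iff)
  moreover have "\<forall>\<^sub>F w in at 0. ((g \<circ> chart_at_infinity) w - (g \<circ> chart_at_infinity) 0) / (w - 0)
      = ((\<lambda>z. z * (g (Some z) - g None)) \<circ> inverse) w"
    unfolding eventually_at_filter
    by (rule always_eventually) (auto simp: chart_at_infinity_def field_simps inverse_eq_divide)
  ultimately have "(((\<lambda>z. z * (g (Some z) - g None)) \<circ> inverse) \<longlongrightarrow> D) (at 0)"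
    by (rule Lim_transform_eventually)
  then have "((\<lambda>z. z * (g (Some z) - g None)) \<longlongrightarrow> D) at_infinity"
    by (simp add: lim_at_infinity_0)
  then show ?thesis
    unfolding deriv_at_infinity_def by (rule tendsto_Lim[OF trivial_limit_at_infinity])
qed

text \<open>\<psi> pulls a competitor back to the disc, where derivatives at \<open>0\<close> are at
  most \<open>1\<close>. It may be any holomorphic map of the disc into the domain, in particular a
  limit of Riemann maps of other domains.\<close>

lemma
  assumes E: "compact E" and g: "admissible E g"
    and \<psi>: "\<psi> holomorphic_on ball 0 1" "\<psi> ` ball 0 1 \<subseteq> inv_domain E" "\<psi> 0 = 0"
  shows admissible_compose_holomorphic: "(\<lambda>w. (g \<circ> chart_at_infinity) (\<psi> w)) holomorphic_on ball 0 1"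
    and admissible_compose_deriv:
      "deriv (\<lambda>w. (g \<circ> chart_at_infinity) (\<psi> w)) 0 = deriv_at_infinity g * deriv \<psi> 0"
    and admissible_deriv_le: "cmod (deriv_at_infinity g) * cmod (deriv \<psi> 0) \<le> 1"
proof -
  let ?g = "g \<circ> chart_at_infinity"
  have hg: "?g holomorphic_on inv_domain E"
    using g by (simp add: admissible_iff[OF E])
  show H: "(\<lambda>w. ?g (\<psi> w)) holomorphic_on ball 0 1"
    using holomorphic_on_compose_gen[OF \<psi>(1) hg \<psi>(2)] by (simp add: o_def)
  have d: "(?g has_field_derivative deriv ?g 0) (at 0)"
    by (rule holomorphic_derivI[OF hg open_inv_domain[OF E]]) simp
  have "(\<psi> has_field_derivative deriv \<psi> 0) (at 0)"
    by (rule holomorphic_derivI[OF \<psi>(1)]) auto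
  then have "((\<lambda>w. ?g (\<psi> w)) has_field_derivative deriv ?g 0 * deriv \<psi> 0) (at 0)"
    by (intro DERIV_chain2[of ?g]) (simp_all add: d \<psi>(3))
  then show eq: "deriv (\<lambda>w. ?g (\<psi> w)) 0 = deriv_at_infinity g * deriv \<psi> 0"
    using deriv_at_infinity_eq[OF d] DERIV_imp_deriv by metis
  have "cmod (deriv (\<lambda>w. ?g (\<psi> w)) 0) \<le> 1"
    using \<psi>(2) by (intro norm_deriv_le_1[OF H] admissible_chart_le[OF E g]) auto
  then show "cmod (deriv_at_infinity g) * cmod (deriv \<psi> 0) \<le> 1"
    unfolding eq norm_mult .
qed

lemma admissible_zero:
  assumes "compact E"
  shows "admissible E (\<lambda>_. 0)"
  by (simp add: admissible_iff[OF assms] o_def)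

text \<open>\<open>Sup\<close> has its intended meaning only on a bounded set; a single \<psi> with
  nonzero derivative provides the bound.\<close>

lemma
  assumes E: "compact E"
    and \<psi>: "\<psi> holomorphic_on ball 0 1" "\<psi> ` ball 0 1 \<subseteq> inv_domain E" "\<psi> 0 = 0" "deriv \<psi> 0 \<noteq> 0"
  shows bdd_above_analytic_capacity: "bdd_above {cmod (deriv_at_infinity g) | g. admissible E g}"
    and analytic_capacity_le: "analytic_capacity E \<le> 1 / cmod (deriv \<psi> 0)"
proof -
  have le: "cmod (deriv_at_infinity g) \<le> 1 / cmod (deriv \<psi> 0)" if "admissible E g" for g
    using admissible_deriv_le[OF E that \<psi>(1-3)] \<psi>(4) by (simp add: field_simps)
  then show "bdd_above {cmod (deriv_at_infinity g) | g. admissible E g}"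
    by (intro bdd_aboveI[of _ "1 / cmod (deriv \<psi> 0)"]) blast
  show "analytic_capacity E \<le> 1 / cmod (deriv \<psi> 0)"
    unfolding analytic_capacity_eq
    by (rule cSup_least) (use admissible_zero[OF E] le in blast)+
qed

text \<open>The Cauchy transform of a competitor for \<gamma>_c is a competitor for \<gamma>, with
  derivative \<open>- \<mu> E\<close> at infinity. The map \<psi> guarantees that both suprema are
  over bounded sets.\<close>

lemma
  assumes E: "compact E"
    and \<psi>: "\<psi> holomorphic_on ball 0 1" "\<psi> ` ball 0 1 \<subseteq> inv_domain E" "\<psi> 0 = 0" "deriv \<psi> 0 \<noteq> 0"
  shows cauchy_capacity_le: "cauchy_capacity E \<le> analytic_capacity E"
    and cauchy_capacity_upper: "\<lbrakk>complex_borel_measure \<mu>; supported_on \<mu> E;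
       \<And>p. p \<in> sphere_compl E \<Longrightarrow> cmod (cauchy_transform \<mu> p) \<le> 1\<rbrakk> \<Longrightarrow> cmod (\<mu> E) \<le> cauchy_capacity E"
proof -
  let ?A = "{cmod (\<mu> E) | \<mu>. complex_borel_measure \<mu> \<and> supported_on \<mu> E \<and>
            (\<forall>p\<in>sphere_compl E. cmod (cauchy_transform \<mu> p) \<le> 1)}"
  have le: "cmod (\<mu> E) \<le> analytic_capacity E"
    if \<mu>: "complex_borel_measure \<mu>" "supported_on \<mu> E"
      "\<And>p. p \<in> sphere_compl E \<Longrightarrow> cmod (cauchy_transform \<mu> p) \<le> 1" for \<mu>
  proof -
    have sub: "outside E \<subseteq> - E" "inv_domain E \<subseteq> {w. \<forall>x\<in>E. w * x \<noteq> 1}"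
    proof -
      show o: "outside E \<subseteq> - E" using outside_no_overlap[of E] by blast
      have "w * x \<noteq> 1" if "w \<in> inv_domain E" "x \<in> E" for w x
      proof
        assume "w * x = 1"
        then have w: "w \<noteq> 0" by auto
        with \<open>w * x = 1\<close> have "1 / w = x" by (simp add: divide_eq_eq mult.commute)
        then show False using that o w by (auto simp: inv_domain_def)
      qed
      then show "inv_domain E \<subseteq> {w. \<forall>x\<in>E. w * x \<noteq> 1}" by blast
    qed
    have "admissible E (cauchy_transform \<mu>)"
      unfolding admissible_iff[OF E]
    proof (intro conjI ballI)
      show "(cauchy_transform \<mu> \<circ> Some) holomorphic_on outside E"
        by (rule holomorphic_on_subset[OF cauchy_transform_holomorphic[OF E \<mu>(1,2)] sub(1)])
      show "(cauchy_transform \<mu> \<circ> chart_at_infinity) holomorphic_on inv_domain E"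
        by (rule holomorphic_on_subset[OF cauchy_transform_holomorphic_infinity[OF E \<mu>(1,2)] sub(2)])
      show "cmod (cauchy_transform \<mu> (Some z)) \<le> 1" if "z \<in> outside E" for z
        using sub(1) that by (intro \<mu>(3)) (auto simp: sphere_compl_def)
      show "cmod (cauchy_transform \<mu> None) \<le> 1"
        by (simp add: cauchy_transform_def)
    qed
    moreover have "deriv_at_infinity (cauchy_transform \<mu>) = - \<mu> E"
      by (rule deriv_at_infinity_eq[OF cauchy_transform_deriv_infinity[OF E \<mu>(1,2)]])
    ultimately have "cmod (\<mu> E) \<in> {cmod (deriv_at_infinity g) | g. admissible E g}"
      by (metis (mono_tags, lifting) mem_Collect_eq norm_minus_cancel)
    then show ?thesis
      unfolding analytic_capacity_eq by (rule cSup_upper[OF _ bdd_above_analytic_capacity[OF E \<psi>]])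
  qed
  show "cauchy_capacity E \<le> analytic_capacity E"
    unfolding cauchy_capacity_def
  proof (rule cSup_least)
    have "complex_borel_measure (\<lambda>_. 0)" "supported_on (\<lambda>_. 0) E"
      by (auto simp: complex_borel_measure_def supported_on_def)
    moreover have "cauchy_transform (\<lambda>_. 0) p = 0" for p
      by (simp add: cauchy_transform_def complex_measure_integral_def signed_integral_def split: option.split)
    ultimately show "?A \<noteq> {}" by force
  qed (use le in blast)
  assume \<mu>: "complex_borel_measure \<mu>" "supported_on \<mu> E"
       "\<And>p. p \<in> sphere_compl E \<Longrightarrow> cmod (cauchy_transform \<mu> p) \<le> 1"
  show "cmod (\<mu> E) \<le> cauchy_capacity E"
    unfolding cauchy_capacity_def
  proof (rule cSup_upper)
    show "bdd_above ?A"
      using le by (intro bdd_aboveI[of _ "analytic_capacity E"]) blast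
  qed (use \<mu> in blast)
qed

text \<open>A Riemann map of the outer domain in the chart at infinity, given together with its
  inverse; \<open>0 \<notin> outside E\<close> keeps \<open>1 / z\<close> holomorphic on
  \<open>outside E\<close>.\<close>

locale exterior_map =
  fixes E :: "complex set" and F G :: "complex \<Rightarrow> complex"
  assumes E: "compact E" and zero: "0 \<notin> outside E"
    and F: "F holomorphic_on inv_domain E" and G: "G holomorphic_on ball 0 1"
    and FG: "\<And>v. v \<in> inv_domain E \<Longrightarrow> F v \<in> ball 0 1 \<and> G (F v) = v"
    and GF: "\<And>w. w \<in> ball 0 1 \<Longrightarrow> G w \<in> inv_domain E \<and> F (G w) = w"
    and F0 [simp]: "F 0 = 0" and G0 [simp]: "G 0 = 0"
begin

lemma deriv_inverse: "deriv F 0 * deriv G 0 = 1"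
proof -
  have "(F has_field_derivative deriv F 0) (at (G 0))"
    using holomorphic_derivI[OF F open_inv_domain[OF E], of 0] by simp
  moreover have "(G has_field_derivative deriv G 0) (at 0)"
    by (rule holomorphic_derivI[OF G]) auto
  ultimately have "((\<lambda>w. F (G w)) has_field_derivative deriv F 0 * deriv G 0) (at 0)"
    by (rule DERIV_chain2)
  then have "((\<lambda>w. w) has_field_derivative deriv F 0 * deriv G 0) (at 0)"
    by (rule has_field_derivative_transform_within_open[of _ _ _ "ball 0 1"]) (use GF in auto)
  then show ?thesis
    using DERIV_ident DERIV_unique by blast
qed

lemma G_into: "G ` ball 0 1 \<subseteq> inv_domain E"
  using GF by blast

lemma deriv_G_nonzero: "deriv G 0 \<noteq> 0"
  using deriv_inverse by auto

text \<open>The extremal function for \<gamma> up to the rotation \<open>c\<close>, with the default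
  value \<open>0\<close> off the outer domain that \<open>ahlfors_function\<close>
  prescribes.\<close>

definition riemann_exterior :: "complex \<Rightarrow> complex option \<Rightarrow> complex" where
  "riemann_exterior c p = (case p of None \<Rightarrow> 0 | Some z \<Rightarrow> if z \<in> outside E then c * F (1 / z) else 0)"

lemma
  assumes c: "cmod c = 1"
  shows admissible_riemann_exterior: "admissible E (riemann_exterior c)"
    and deriv_riemann_exterior: "deriv_at_infinity (riemann_exterior c) = c * deriv F 0"
proof -
  have inv: "1 / z \<in> inv_domain E" if "z \<in> outside E" for z
    using that zero by (auto simp: inv_domain_def)
  have chart: "(riemann_exterior c \<circ> chart_at_infinity) w = c * F w" if "w \<in> inv_domain E" for w
    using that by (auto simp: riemann_exterior_def chart_at_infinity_def inv_domain_def)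
  have hc: "(\<lambda>w. c * F w) holomorphic_on inv_domain E"
    by (intro holomorphic_intros F)
  show "admissible E (riemann_exterior c)"
    unfolding admissible_iff[OF E]
  proof (intro conjI ballI)
    have i: "(\<lambda>z. 1 / z) holomorphic_on outside E"
      using zero by (auto intro!: holomorphic_intros)
    have "(\<lambda>z. c * F (1 / z)) holomorphic_on outside E"
      using holomorphic_on_compose_gen[OF i hc] inv by (simp add: o_def image_subset_iff)
    then show "(riemann_exterior c \<circ> Some) holomorphic_on outside E"
      by (rule holomorphic_transform) (simp add: riemann_exterior_def)
    show "(riemann_exterior c \<circ> chart_at_infinity) holomorphic_on inv_domain E"
      using hc by (rule holomorphic_transform) (rule chart[symmetric])
    show "cmod (riemann_exterior c (Some z)) \<le> 1" if "z \<in> outside E" for z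
      using that FG[OF inv[OF that]] c by (simp add: riemann_exterior_def norm_mult)
    show "cmod (riemann_exterior c None) \<le> 1"
      by (simp add: riemann_exterior_def)
  qed
  have "((\<lambda>w. c * F w) has_field_derivative c * deriv F 0) (at 0)"
    by (intro DERIV_cmult holomorphic_derivI[OF F open_inv_domain[OF E]]) simp
  then have "((riemann_exterior c \<circ> chart_at_infinity) has_field_derivative c * deriv F 0) (at 0)"
    by (rule has_field_derivative_transform_within_open[OF _ open_inv_domain[OF E]]) (simp_all only: chart zero_in_inv_domain)
  then show "deriv_at_infinity (riemann_exterior c) = c * deriv F 0"
    by (rule deriv_at_infinity_eq)
qed

text \<open>The upper bound comes from composing competitors with \<open>G\<close>; the Riemann map
  attains it.\<close>

lemma analytic_capacity_riemann: "analytic_capacity E = cmod (deriv F 0)"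
proof (rule antisym)
  have "analytic_capacity E \<le> 1 / cmod (deriv G 0)"
    by (rule analytic_capacity_le[OF E G G_into G0 deriv_G_nonzero])
  also have "\<dots> = cmod (deriv F 0)"
    using deriv_inverse by (metis deriv_G_nonzero nonzero_eq_divide_eq norm_divide norm_one)
  finally show "analytic_capacity E \<le> cmod (deriv F 0)" .
  have "cmod (deriv F 0) \<in> {cmod (deriv_at_infinity g) | g. admissible E g}"
    using admissible_riemann_exterior[of 1] deriv_riemann_exterior[of 1] by (intro CollectI exI[of _ "riemann_exterior 1"]) simp
  then show "cmod (deriv F 0) \<le> analytic_capacity E"
    unfolding analytic_capacity_eq
    by (rule cSup_upper[OF _ bdd_above_analytic_capacity[OF E G G_into G0 deriv_G_nonzero]])
qed

text \<open>Any extremal function, composed with \<open>G\<close>, maps the disc into the closed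
  disc with derivative of modulus \<open>1\<close> at \<open>0\<close>, so it is a rotation. This is
  the uniqueness that \<open>THE\<close> asks for.\<close>

lemma ahlfors_function_eq:
  obtains c where "cmod c = 1" "ahlfors_function E = riemann_exterior c"
proof -
  have F'0: "deriv F 0 \<noteq> 0" using deriv_inverse by auto
  \<comment> \<open>Rotates the derivative to the positive real axis, as the Ahlfors function is
    normalized by \<open>f'(\<infinity>) = \<gamma>\<close> without absolute value.\<close>
  define c where "c = complex_of_real (cmod (deriv F 0)) / deriv F 0"
  have c: "cmod c = 1" using F'0 by (simp add: c_def norm_divide)
  have cF: "c * deriv F 0 = complex_of_real (analytic_capacity E)"
    using F'0 by (simp add: c_def analytic_capacity_riemann)
  have out: "p \<notin> outer_domain E \<Longrightarrow> riemann_exterior c p = 0" for p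
    by (auto simp: outer_domain_eq[OF E] riemann_exterior_def split: option.split)
  have "ahlfors_function E = (THE f. admissible E f \<and>
             deriv_at_infinity f = complex_of_real (analytic_capacity E) \<and>
             (\<forall>p. p \<notin> outer_domain E \<longrightarrow> f p = 0))"
    by (simp add: ahlfors_function_def admissible_def conj_assoc)
  also have "\<dots> = riemann_exterior c"
  proof (rule the_equality)
    show "admissible E (riemann_exterior c) \<and>
        deriv_at_infinity (riemann_exterior c) = complex_of_real (analytic_capacity E) \<and>
        (\<forall>p. p \<notin> outer_domain E \<longrightarrow> riemann_exterior c p = 0)"
      using admissible_riemann_exterior[OF c] deriv_riemann_exterior[OF c] cF out by simp
  next
    fix f assume "admissible E f \<and> deriv_at_infinity f = complex_of_real (analytic_capacity E) \<and>
        (\<forall>p. p \<notin> outer_domain E \<longrightarrow> f p = 0)"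
    then have f: "admissible E f" "deriv_at_infinity f = c * deriv F 0" "\<And>p. p \<notin> outer_domain E \<Longrightarrow> f p = 0"
      using cF by auto
    let ?H = "\<lambda>w. (f \<circ> chart_at_infinity) (G w)"
    have d: "deriv ?H 0 = c"
      using admissible_compose_deriv[OF E f(1) G G_into G0] deriv_inverse by (simp add: f(2) mult.assoc)
    have "cmod (deriv ?H 0) = 1" using d c by simp
    then obtain \<alpha> where \<alpha>: "\<And>w. w \<in> ball 0 1 \<Longrightarrow> ?H w = \<alpha> * w"
      using schwarz_pick_equality[OF admissible_compose_holomorphic[OF E f(1) G G_into G0]]
        admissible_chart_le[OF E f(1)] GF by (metis (no_types, lifting))
    have "(?H has_field_derivative \<alpha>) (at 0)"
    proof (rule has_field_derivative_transform_within_open[of "\<lambda>w. \<alpha> * w" _ _ "ball 0 1"])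
      show "((\<lambda>w. \<alpha> * w) has_field_derivative \<alpha>) (at 0)"
        using DERIV_cmult[OF DERIV_ident, of 0 \<alpha>] by simp
    qed (use \<alpha> in auto)
    then have "\<alpha> = c" using d DERIV_imp_deriv by metis
    then have eq: "(f \<circ> chart_at_infinity) v = c * F v" if "v \<in> inv_domain E" for v
      using \<alpha>[of "F v"] FG[OF that] by simp
    show "f = riemann_exterior c"
    proof
      fix p
      show "f p = riemann_exterior c p"
      proof (cases p)
        case None
        then show ?thesis using eq[of 0] by (simp add: chart_at_infinity_def riemann_exterior_def)
      next
        case (Some z)
        show ?thesis
        proof (cases "z \<in> outside E")
          case True
          then have "1 / z \<in> inv_domain E" "z \<noteq> 0" using zero by (auto simp: inv_domain_def)
          then show ?thesis
            using eq[of "1 / z"] True Some by (simp add: chart_at_infinity_def riemann_exterior_def)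
        next
          case False
          then have "p \<notin> outer_domain E" using Some by (auto simp: outer_domain_eq[OF E])
          then show ?thesis using f(3) out by simp
        qed
      qed
    qed
  qed
  finally show ?thesis using that c by blast
qed

lemma ahlfors_function_inside: "z \<notin> outside E \<Longrightarrow> ahlfors_function E (Some z) = 0"
  by (rule ahlfors_function_eq) (simp add: riemann_exterior_def)

text \<open>\<open>inv_domain E\<close> lies in the disc of radius \<open>1 / \<rho>\<close>, so
  \<rho> times \<open>G\<close> maps the unit disc into itself and fixes \<open>0\<close>. The claim
  is the Schwarz lemma at \<open>F (1 / z)\<close>.\<close>

lemma ahlfors_function_lower:
  assumes \<rho>: "\<rho> > 0" "cball 0 \<rho> \<inter> outside E = {}" and z: "z \<in> outside E"
  shows "\<rho> / cmod z \<le> cmod (ahlfors_function E (Some z))"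
proof -
  obtain c where c: "cmod c = 1" "ahlfors_function E = riemann_exterior c"
    by (rule ahlfors_function_eq)
  have v: "1 / z \<in> inv_domain E" using z zero by (auto simp: inv_domain_def)
  have "cmod (of_real \<rho> * G (F (1 / z))) \<le> cmod (F (1 / z))"
  proof (rule Schwarz_Lemma(1)[of "\<lambda>w. of_real \<rho> * G w"])
    show "(\<lambda>w. of_real \<rho> * G w) holomorphic_on ball 0 1"
      by (intro holomorphic_intros G)
    show "cmod (of_real \<rho> * G w) < 1" if "cmod w < 1" for w
    proof -
      have "G w \<in> ball 0 (1 / \<rho>)"
        using inv_domain_subset_ball[OF \<rho>] GF[of w] that by auto
      then show ?thesis using \<rho>(1) by (simp add: norm_mult field_simps)
    qed
  qed (use FG[OF v] in auto)
  then show ?thesis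
    using FG[OF v] \<rho>(1) c z by (simp add: riemann_exterior_def norm_mult norm_divide)
qed

end

section \<open>Equality of the capacities for closures of domains\<close>

text \<open>Cauchy's integral formula with \<open>du = 2 \<pi> i u dt\<close> inserted;
  \<open>w0 = 0\<close> is the mean value property.\<close>

lemma circle_mean:
  assumes h: "h holomorphic_on cball 0 r" and w0: "cmod w0 < r"
  shows "integral {0..1} (\<lambda>t. h (circlepath 0 r t) * circlepath 0 r t / (circlepath 0 r t - w0)) = h w0"
proof -
  have "contour_integral (circlepath 0 r) (\<lambda>u. h u / (u - w0)) = 2 * of_real pi * \<i> * h w0"
    by (rule contour_integral_unique, rule Cauchy_integral_circlepath_simple) (use assms in auto)
  moreover have "contour_integral (circlepath 0 r) (\<lambda>u. h u / (u - w0)) =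
      integral {0..1} (\<lambda>t. (2 * of_real pi * \<i>) * (h (circlepath 0 r t) * circlepath 0 r t / (circlepath 0 r t - w0)))"
    unfolding contour_integral_integral vector_derivative_circlepath
    by (rule integral_cong) (simp add: circlepath mult_ac)
  ultimately have "(2 * of_real pi * \<i>) * integral {0..1} (\<lambda>t. h (circlepath 0 r t) * circlepath 0 r t / (circlepath 0 r t - w0))
      = (2 * of_real pi * \<i>) * h w0"
    by (simp only: integral_mult_right)
  then show ?thesis by (subst (asm) mult_cancel_left) simp
qed

text \<open>\<open>p\<close> has no zero off \<open>w0\<close> since \<psi> takes each value once,
  and none at \<open>w0\<close> since an injective holomorphic map has nonzero derivative.\<close>

lemma injective_factor:
  assumes \<psi>: "\<psi> holomorphic_on ball 0 1" "inj_on \<psi> (ball 0 1)" and w0: "w0 \<in> ball 0 1"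
  obtains p where "p holomorphic_on ball 0 1" "\<And>w. w \<in> ball 0 1 \<Longrightarrow> \<psi> w - \<psi> w0 = (w - w0) * p w"
    "\<And>w. w \<in> ball 0 1 \<Longrightarrow> p w \<noteq> 0" "p w0 = deriv \<psi> w0"
proof -
  define p where "p = (\<lambda>z. if z = w0 then deriv \<psi> w0 else (\<psi> z - \<psi> w0) / (z - w0))"
  have "p holomorphic_on ball 0 1"
    unfolding p_def by (rule pole_lemma[OF \<psi>(1)]) (use w0 in \<open>simp add: interior_open\<close>)
  moreover have "\<psi> w - \<psi> w0 = (w - w0) * p w" for w
    by (simp add: p_def)
  moreover have "p w \<noteq> 0" if "w \<in> ball 0 1" for w
    using holomorphic_injective_imp_regular[OF \<psi>(1) open_ball \<psi>(2) w0] inj_onD[OF \<psi>(2) _ that w0]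
    by (auto simp: p_def)
  moreover have "p w0 = deriv \<psi> w0" by (simp add: p_def)
  ultimately show ?thesis using that by blast
qed

text \<open>The Cauchy transform of \<open>w dz / (2 \<pi> i)\<close> along the curve \<open>z = 1 / \<psi> w\<close>, \<open>\<bar>w\<bar> = r\<close>, is the inverse of
  \<open>1 / \<psi>\<close> outside the curve and \<open>0\<close> inside, so it is bounded by \<open>1\<close>.\<close>

lemma level_curve_measure:
  assumes E: "compact E" and \<psi>: "\<psi> holomorphic_on ball 0 1" "inj_on \<psi> (ball 0 1)" "\<psi> 0 = 0"
    and r: "0 < r" "r < 1" and into: "\<And>w. cmod w = r \<Longrightarrow> 1 / \<psi> w \<in> E"
  obtains \<mu> where "complex_borel_measure \<mu>" "supported_on \<mu> E" "cmod (\<mu> E) = 1 / cmod (deriv \<psi> 0)"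
    "\<And>p. p \<in> sphere_compl E \<Longrightarrow> cmod (cauchy_transform \<mu> p) \<le> 1"
proof -
  let ?c = "circlepath 0 r"
  have c: "cmod (?c t) = r" for t
    using r by (simp add: circlepath norm_mult)
  then have cball: "?c t \<in> ball 0 1" and c0: "?c t \<noteq> 0" for t
    using r by (auto simp: mem_ball_0) (metis norm_zero less_irrefl c r(1))
  have cc: "continuous_on UNIV ?c"
    unfolding circlepath[abs_def] by (intro continuous_intros)
  have sub: "cball 0 r \<subseteq> ball (0::complex) 1" using r by auto
  have z: "(0::complex) \<in> ball 0 1" by simp
  obtain q where q: "q holomorphic_on ball 0 1" "\<And>w. w \<in> ball 0 1 \<Longrightarrow> \<psi> w = w * q w"
    "\<And>w. w \<in> ball 0 1 \<Longrightarrow> q w \<noteq> 0" "q 0 = deriv \<psi> 0"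
    using injective_factor[OF \<psi>(1,2) z] \<psi>(3) by auto
  have \<psi>0: "\<psi> w \<noteq> 0" if "w \<in> ball 0 1" "w \<noteq> 0" for w
    using q(2,3) that by simp
  \<comment> \<open>The density of \<open>w dz / (2 \<pi> i)\<close> with respect to
    \<open>t\<close>, from \<open>z = 1 / \<psi> w\<close>, \<open>dw = 2 \<pi> i w dt\<close> and
    \<open>\<psi> w = w * q w\<close>. Cancelling \<open>w\<close> makes it holomorphic at
    \<open>0\<close> as well.\<close>
  define h where "h = (\<lambda>w. - deriv \<psi> w / (q w * q w))"
  have h: "h holomorphic_on ball 0 1"
    unfolding h_def by (intro holomorphic_intros holomorphic_deriv \<psi> q(1)) (use q(3) in auto)
  define \<gamma> where "\<gamma> = (\<lambda>t. 1 / \<psi> (?c t))"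
  define u where "u = (\<lambda>t. h (?c t))"
  have comp: "continuous_on UNIV (\<lambda>t. f (?c t))" if "f holomorphic_on ball 0 1" for f
    by (rule continuous_on_compose2[OF holomorphic_on_imp_continuous_on[OF that] cc]) (use cball in blast)
  have "continuous_on UNIV \<gamma>"
    unfolding \<gamma>_def by (intro continuous_intros comp \<psi>) (use \<psi>0 cball c0 in blast)
  moreover have "continuous_on UNIV u"
    unfolding u_def by (rule comp[OF h])
  moreover have Eb: "E \<in> sets borel" using E by (simp add: borel_compact)
  moreover have \<gamma>E: "\<gamma> t \<in> E" for t unfolding \<gamma>_def by (rule into[OF c])
  then have "\<gamma> ` {0..1} \<subseteq> E" by blast
  ultimately obtain \<mu> where \<mu>: "complex_borel_measure \<mu>" "supported_on \<mu> E"
    "\<mu> E = integral {0..1} u"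
    "\<And>g. g \<in> borel_measurable borel \<Longrightarrow> bounded (g ` E) \<Longrightarrow> continuous_on (\<gamma> ` {0..1}) g \<Longrightarrow>
       complex_measure_integral \<mu> g = integral {0..1} (\<lambda>t. g (\<gamma> t) * u t)"
    by (rule complex_borel_measure_of_curve) (rule that; assumption)
  have mean: "integral {0..1} (\<lambda>t. k (?c t) * ?c t / (?c t - w0)) = k w0"
    if "k holomorphic_on cball 0 r" "cmod w0 < r" for k w0
    using circle_mean[OF that] .
  have mean0: "integral {0..1} (\<lambda>t. k (?c t)) = k 0" if "k holomorphic_on cball 0 r" for k
    using mean[OF that, of 0] r c0 by simp
  have "\<mu> E = h 0"
    unfolding \<mu>(3) u_def by (rule mean0[OF holomorphic_on_subset[OF h sub]])
  moreover have "h 0 = - 1 / deriv \<psi> 0"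
    using q(3)[OF z] by (simp add: h_def q(4))
  ultimately have "cmod (\<mu> E) = 1 / cmod (deriv \<psi> 0)"
    by (simp add: norm_divide)
  moreover have "cmod (cauchy_transform \<mu> p) \<le> 1" if p: "p \<in> sphere_compl E" for p
  proof (cases p)
    case None
    then show ?thesis by (simp add: cauchy_transform_def)
  next
    case (Some z)
    then have zE: "z \<notin> E" using p by (auto simp: sphere_compl_def)
    then have dz: "\<xi> - z \<noteq> 0" if "\<xi> \<in> E" for \<xi> using that by auto
    have cont: "continuous_on E (\<lambda>\<xi>. 1 / (\<xi> - z))"
      using dz by (auto intro!: continuous_intros)
    have "cauchy_transform \<mu> p = integral {0..1} (\<lambda>t. 1 / (\<gamma> t - z) * u t)"
      unfolding cauchy_transform_def Some option.case
    proof (rule \<mu>(4))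
      show "bounded ((\<lambda>\<xi>. 1 / (\<xi> - z)) ` E)"
        by (rule compact_imp_bounded[OF compact_continuous_image[OF cont E]])
      show "continuous_on (\<gamma> ` {0..1}) (\<lambda>\<xi>. 1 / (\<xi> - z))"
        by (rule continuous_on_subset[OF cont]) (use \<gamma>E in blast)
    qed measurable
    also have "\<dots> = integral {0..1} (\<lambda>t. h (?c t) * \<psi> (?c t) / (1 - z * \<psi> (?c t)))"
    proof (rule integral_cong)
      fix t :: real
      have "\<psi> (?c t) \<noteq> 0" by (rule \<psi>0[OF cball c0])
      then show "1 / (\<gamma> t - z) * u t = h (?c t) * \<psi> (?c t) / (1 - z * \<psi> (?c t))"
        by (simp add: \<gamma>_def u_def divide_simps mult_ac)
    qed
    finally have C: "cauchy_transform \<mu> p = integral {0..1} (\<lambda>t. h (?c t) * \<psi> (?c t) / (1 - z * \<psi> (?c t)))" .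
    have ncirc: "1 - z * \<psi> w \<noteq> 0" if "cmod w = r" for w
    proof
      assume "1 - z * \<psi> w = 0"
      then have "z * \<psi> w = 1" by simp
      moreover from this have "\<psi> w \<noteq> 0" by auto
      ultimately have "1 / \<psi> w = z" by (simp add: divide_eq_eq)
      then show False using into[OF that] zE by simp
    qed
    \<comment> \<open>If \<open>1 / \<psi>\<close> takes the value \<open>z\<close> at some
      \<open>w0\<close> with \<open>cmod w0 < r\<close>, then \<open>z\<close> is outside the curve
      and the integrand has a pole at \<open>w0\<close>. Otherwise the integrand is holomorphic, and
      its mean is its value at the centre, which is \<open>0\<close>.\<close>
    show ?thesis
    proof (cases "\<exists>w0. cmod w0 < r \<and> 1 - z * \<psi> w0 = 0")
      case False
      have "1 - z * \<psi> w \<noteq> 0" if "w \<in> cball 0 r" for w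
        using False ncirc that by (cases "cmod w = r") auto
      then have "(\<lambda>w. h w * \<psi> w / (1 - z * \<psi> w)) holomorphic_on cball 0 r"
        by (intro holomorphic_intros holomorphic_on_subset[OF h sub] holomorphic_on_subset[OF \<psi>(1) sub])
      from mean0[OF this] show ?thesis unfolding C by (simp add: \<psi>(3))
    next
      case True
      then obtain w0 where w0: "cmod w0 < r" "z * \<psi> w0 = 1" by auto
      have w0b: "w0 \<in> ball 0 1" using w0 r by simp
      have w00: "w0 \<noteq> 0" "z \<noteq> 0" using w0 \<psi>(3) by auto
      obtain p where p: "p holomorphic_on ball 0 1" "\<And>w. w \<in> ball 0 1 \<Longrightarrow> \<psi> w - \<psi> w0 = (w - w0) * p w"
        "\<And>w. w \<in> ball 0 1 \<Longrightarrow> p w \<noteq> 0" "p w0 = deriv \<psi> w0"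
        by (rule injective_factor[OF \<psi>(1,2) w0b]) (rule that; assumption)
      \<comment> \<open>What remains of the integrand once \<open>?c t / (?c t - w0)\<close> is
        split off, so that \<open>circle_mean\<close> evaluates it at \<open>w0\<close>.\<close>
      let ?H = "\<lambda>w. - (h w * q w) / (z * p w)"
      have CH: "cauchy_transform \<mu> (Some z) = integral {0..1} (\<lambda>t. ?H (?c t) * ?c t / (?c t - w0))"
        unfolding Some[symmetric] C
      proof (rule integral_cong)
        fix t :: real
        have "1 - z * \<psi> (?c t) = - z * (\<psi> (?c t) - \<psi> w0)"
          using w0(2) by (simp add: algebra_simps)
        also have "\<dots> = - z * ((?c t - w0) * p (?c t))"
          by (simp only: p(2)[OF cball])
        finally show "h (?c t) * \<psi> (?c t) / (1 - z * \<psi> (?c t)) = ?H (?c t) * ?c t / (?c t - w0)"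
          by (simp add: q(2)[OF cball] mult_ac)
      qed
      have hH: "?H holomorphic_on cball 0 r"
        by (rule holomorphic_on_subset[OF _ sub]) (use p(3) w00 in \<open>auto intro!: holomorphic_intros h q(1) p(1)\<close>)
      have "cauchy_transform \<mu> (Some z) = ?H w0"
        unfolding CH by (rule mean[OF hH w0(1)])
      \<comment> \<open>Here \<open>p w0 = deriv \<psi> w0\<close> cancels against the derivative in
        \<open>h\<close>, and \<open>z * \<psi> w0 = 1\<close> leaves \<open>w0\<close>.\<close>
      also have "?H w0 = w0"
      proof -
        have "deriv \<psi> w0 \<noteq> 0" "q w0 \<noteq> 0" using p(3)[OF w0b] p(4) q(3)[OF w0b] by auto
        moreover have "z * (w0 * q w0) = 1" using w0(2) q(2)[OF w0b] by simp
        ultimately show ?thesis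
          using w00 by (simp add: h_def p(4) field_simps)
      qed
      finally show ?thesis using w0(1) r Some by simp
    qed
  qed
  ultimately show ?thesis using that \<mu>(1,2) by blast
qed

section \<open>Level curves close to the set, and the exhaustion\<close>

context exterior_map
begin

lemma G_inj: "inj_on G (ball 0 1)"
  using GF by (metis inj_onI)

text \<open>The points of the chart to be avoided form a compact set, on which
  \<open>cmod (F v)\<close> has a maximum below \<open>1\<close>; a radius between this maximum and
  \<open>1\<close> will do.\<close>

lemma level_curve_in_neighbourhood:
  assumes U: "open U" "E \<subseteq> U" and \<rho>: "\<rho> > 0" "cball 0 \<rho> \<inter> outside E = {}"
  obtains r where "0 < r" "r < 1" "\<And>w. cmod w = r \<Longrightarrow> 1 / G w \<in> U"
proof -
  \<comment> \<open>Since \<open>E \<subseteq> U\<close>, adding \<open>inside E\<close> keeps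
    \<open>Q\<close> within \<open>inv_domain E\<close>, where \<open>F\<close> is defined. The
    point at infinity, \<open>0\<close>, belongs to \<open>Q\<close>.\<close>
  define Q where "Q = - {v. v \<noteq> 0 \<and> 1 / v \<in> U \<union> inside E}"
  have "closed Q"
    unfolding Q_def closed_Compl open_inverse_vimage
    using U(1) open_inside[OF compact_imp_closed[OF E]] by (intro closed_Compl open_inverse_vimage open_Un)
  have Qin: "Q \<subseteq> inv_domain E"
    using U(2) outside_inside[of E] by (auto simp: Q_def inv_domain_def)
  then have "compact Q"
    using \<open>closed Q\<close> inv_domain_subset_ball[OF \<rho>] bounded_ball bounded_subset
    by (metis compact_eq_bounded_closed)
  moreover have "0 \<in> Q" by (simp add: Q_def)
  moreover have "continuous_on Q (\<lambda>v. cmod (F v))"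
    by (intro continuous_intros holomorphic_on_imp_continuous_on holomorphic_on_subset[OF F Qin])
  ultimately obtain v0 where v0: "v0 \<in> Q" "\<And>v. v \<in> Q \<Longrightarrow> cmod (F v) \<le> cmod (F v0)"
    using continuous_attains_sup[of Q "\<lambda>v. cmod (F v)"] by blast
  define r where "r = (1 + cmod (F v0)) / 2"
  have lt: "cmod (F v0) < 1" using FG[of v0] v0(1) Qin by auto
  then have r: "0 < r" "r < 1" "cmod (F v0) < r"
    unfolding r_def using norm_ge_zero[of "F v0"] by (auto simp: field_simps add_pos_nonneg)
  show ?thesis
  proof (rule that[OF r(1,2)])
    fix w assume w: "cmod w = r"
    then have G: "G w \<in> inv_domain E" "F (G w) = w" using GF[of w] r by auto
    have "G w \<notin> Q" using v0(2)[of "G w"] G(2) w r(3) by auto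
    then have "G w \<noteq> 0" "1 / G w \<in> U \<union> inside E" by (auto simp: Q_def)
    moreover have "1 / G w \<in> outside E" using G(1) \<open>G w \<noteq> 0\<close> by (simp add: inv_domain_def)
    ultimately show "1 / G w \<in> U" using inside_Int_outside[of E] by blast
  qed
qed

end

text \<open>A disc with paths from its centre to the points of a dense sequence. The continua catch
  only these points for certain, which suffices because the image of the limit map will be
  open.\<close>

lemma exhausting_continua:
  fixes U :: "complex set"
  assumes U: "open U" "connected U" and \<rho>: "cball 0 \<rho> \<subseteq> U" "\<rho> > 0"
  obtains d :: "nat \<Rightarrow> complex" and K :: "nat \<Rightarrow> complex set"
  where "U \<subseteq> closure (range d)" "\<And>n. compact (K n)" "\<And>n. connected (K n)"
    "\<And>n. cball 0 \<rho> \<subseteq> K n" "\<And>n. K n \<subseteq> U" "\<And>i n. i \<le> n \<Longrightarrow> d i \<in> K n"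
proof -
  have 0: "0 \<in> U" using \<rho> by auto
  obtain T where T: "countable T" "T \<subseteq> U" "U \<subseteq> closure T"
    by (rule separable)
  then have "T \<noteq> {}" using 0 by auto
  then obtain d :: "nat \<Rightarrow> complex" where d: "T = range d"
    using range_from_nat_into[OF _ T(1)] by metis
  have "path_connected U"
    using U by (simp add: connected_open_path_connected)
  then have "\<forall>n. \<exists>g. path g \<and> path_image g \<subseteq> U \<and> pathstart g = 0 \<and> pathfinish g = d n"
    using 0 T(2) d unfolding path_connected_def by blast
  then obtain p where p: "\<And>n. path (p n)" "\<And>n. path_image (p n) \<subseteq> U" "\<And>n. pathstart (p n) = 0"
    "\<And>n. pathfinish (p n) = d n"
    by metis
  have p0: "0 \<in> path_image (p n)" and pd: "d n \<in> path_image (p n)" for n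
    using pathstart_in_path_image[of "p n"] pathfinish_in_path_image[of "p n"] p by simp_all
  define K where "K n = cball 0 \<rho> \<union> (\<Union>i\<le>n. path_image (p i))" for n
  have "connected (K n)" for n
  proof -
    have "connected (\<Union>i\<le>n. path_image (p i))"
    proof (rule connected_Union)
      have "0 \<in> (\<Inter>i\<le>n. path_image (p i))" using p0 by blast
      then show "(\<Inter>i\<le>n. path_image (p i)) \<noteq> {}" by blast
    qed (use p in \<open>auto intro: connected_path_image\<close>)
    moreover have "0 \<in> cball 0 \<rho> \<inter> (\<Union>i\<le>n. path_image (p i))" using p0 \<rho>(2) by auto
    then have "cball 0 \<rho> \<inter> (\<Union>i\<le>n. path_image (p i)) \<noteq> {}" by blast
    ultimately show ?thesis
      unfolding K_def by (intro connected_Un connected_cball)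
  qed
  moreover have "compact (K n)" for n
    unfolding K_def by (intro compact_Un compact_UN) (auto intro: compact_path_image p)
  moreover have "cball 0 \<rho> \<subseteq> K n" "K n \<subseteq> U" for n
    using \<rho> p(2) by (auto simp: K_def)
  moreover have "d i \<in> K n" if "i \<le> n" for i n
    using pd that by (auto simp: K_def)
  ultimately show ?thesis using that T(3) d by blast
qed

context exterior_map
begin

text \<open>The outer domain contains the exterior of the disc of radius \<open>R\<close>, so
  \<open>F (w / R)\<close> is defined on the unit disc. The bound depends on \<open>R\<close> alone
  and keeps limits of such maps \<open>G\<close> from being constant.\<close>

lemma deriv_G_lower:
  assumes R: "R > 0" "E \<subseteq> cball 0 R"
  shows "1 / R \<le> cmod (deriv G 0)"
proof -
  have sub: "ball 0 (1 / R) \<subseteq> inv_domain E"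
    by (rule inv_domain_contains_ball[OF E R])
  have in': "w / of_real R \<in> inv_domain E" if "w \<in> ball 0 1" for w
    using that R sub by (auto simp: norm_divide divide_strict_right_mono intro!: subsetD[OF sub])
  have "(\<lambda>w. w / of_real R) holomorphic_on ball 0 1"
    using R(1) by (intro holomorphic_intros) auto
  then have "(F \<circ> (\<lambda>w. w / of_real R)) holomorphic_on ball 0 1"
    by (rule holomorphic_on_compose_gen[OF _ F]) (use in' in blast)
  then have "(\<lambda>w. F (w / of_real R)) holomorphic_on ball 0 1"
    by (simp add: o_def)
  then have "cmod (deriv (\<lambda>w. F (w / of_real R)) 0) \<le> 1"
    by (rule norm_deriv_le_1) (use FG in' less_imp_le in \<open>auto simp: dist_norm\<close>)
  moreover have "((\<lambda>w. F (w / of_real R)) has_field_derivative deriv F 0 * (1 / of_real R)) (at 0)"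
  proof (rule DERIV_chain2[where f = F and g = "\<lambda>w. w / of_real R"])
    show "(F has_field_derivative deriv F 0) (at (0 / of_real R))"
      using holomorphic_derivI[OF F open_inv_domain[OF E], of 0] by simp
    show "((\<lambda>w. w / of_real R) has_field_derivative 1 / of_real R) (at 0)"
      by (intro DERIV_cdivide DERIV_ident)
  qed
  ultimately have "cmod (deriv F 0 * (1 / of_real R)) \<le> 1"
    using DERIV_imp_deriv by metis
  then have "cmod (deriv F 0) \<le> R"
    using R(1) by (simp add: norm_mult norm_divide field_simps)
  moreover have "cmod (deriv F 0) * cmod (deriv G 0) = 1"
    using deriv_inverse by (metis norm_mult norm_one)
  ultimately have "1 \<le> R * cmod (deriv G 0)"
    by (metis mult_right_mono norm_ge_zero)
  then show ?thesis using R(1) by (simp add: field_simps)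
qed

end

lemma not_constant_onI:
  assumes "deriv f z \<noteq> 0" "open S" "z \<in> S"
  shows "\<not> f constant_on S"
proof
  assume "f constant_on S"
  then obtain k where "\<And>x. x \<in> S \<Longrightarrow> f x = k" by (auto simp: constant_on_def)
  then have "((\<lambda>_. k) has_field_derivative 0) (at z)" "\<And>x. x \<in> S \<Longrightarrow> k = f x" by auto
  then have "(f has_field_derivative 0) (at z)"
    by (rule has_field_derivative_transform_within_open[OF _ assms(2,3)])
  then show False using assms(1) DERIV_imp_deriv by blast
qed

text \<open>\<open>W\<close> is connected and contains \<open>0\<close>, the point at infinity; as
  it avoids \<open>C\<close>, it cannot enter a bounded component of the complement.\<close>

lemma image_avoiding_subset_inv_domain:
  assumes C: "compact C" and W: "connected W" "0 \<in> W" "\<And>e. e \<in> C \<Longrightarrow> e \<noteq> 0 \<Longrightarrow> 1 / e \<notin> W"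
  shows "W \<subseteq> inv_domain C"
proof -
  let ?I = "{w. w \<noteq> 0 \<and> 1 / w \<in> inside C}"
  have "W \<subseteq> inv_domain C \<union> ?I"
  proof
    fix w assume w: "w \<in> W"
    show "w \<in> inv_domain C \<union> ?I"
    proof (cases "w = 0")
      case False
      then have "1 / w \<notin> C" using W(3)[of "1 / w"] w by auto
      then have "1 / w \<in> inside C \<or> 1 / w \<in> outside C" using inside_Un_outside[of C] by blast
      then show ?thesis using False by (auto simp: inv_domain_def)
    qed simp
  qed
  moreover have "inv_domain C \<inter> ?I \<inter> W = {}"
    by (auto simp: inv_domain_def inside_outside)
  moreover have "open ?I"
    by (intro open_inverse_vimage open_inside compact_imp_closed C)
  ultimately have "inv_domain C \<inter> W = {} \<or> ?I \<inter> W = {}"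
    using connectedD[OF W(1) open_inv_domain[OF C]] by blast
  then show ?thesis using W(2) \<open>W \<subseteq> inv_domain C \<union> ?I\<close> zero_in_inv_domain by blast
qed

text \<open>The Riemann maps of the exteriors of continua exhausting \<open>U\<close> converge to a map into the exterior of
  \<open>closure U\<close>, while their level curves near the boundary lie in \<open>U\<close> and carry admissible measures.\<close>

theorem analytic_capacity_eq_cauchy_capacity:
  assumes E: "compact E" and U: "open U" "connected U" "0 \<in> U" "U \<subseteq> E"
    and out: "outside E = outside (closure U)"
  shows "analytic_capacity E = cauchy_capacity E"
proof -
  obtain \<rho> where \<rho>: "\<rho> > 0" "cball 0 \<rho> \<subseteq> U"
    using U(1,3) by (auto simp: open_contains_cball)
  obtain R where R: "R > 0" "E \<subseteq> cball 0 R"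
    using compact_imp_bounded[OF E] by (auto simp: bounded_pos subset_iff)
  obtain d K where K: "U \<subseteq> closure (range d)" "\<And>n::nat. compact (K n)" "\<And>n. connected (K n)"
    "\<And>n. cball 0 \<rho> \<subseteq> K n" "\<And>n. K n \<subseteq> U" "\<And>i n. i \<le> n \<Longrightarrow> d i \<in> K n"
    by (rule exhausting_continua[OF U(1,2) \<rho>(2,1)]) (rule that; assumption)
  have K\<rho>: "cball 0 \<rho> \<inter> outside (K n) = {}" for n
    using K(4)[of n] outside_no_overlap[of "K n"] by blast
  have "\<exists>F G. exterior_map (K n) F G" for n
  proof -
    have con: "connected (- outside (K n))"
      using connected_with_inside[OF compact_imp_closed[OF K(2)] K(3), of n] by (simp add: union_with_inside)
    have z: "0 \<notin> outside (K n)" using K\<rho>[of n] \<rho>(1) by (force simp: disjoint_iff)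
    show ?thesis
      using exterior_riemann_map[OF K(2) con \<rho>(1) K\<rho>] K(2) z unfolding exterior_map_def by metis
  qed
  then obtain F G where em: "\<And>n. exterior_map (K n) (F n) (G n)" by metis
  note hG = exterior_map.G[OF em] and G0 = exterior_map.G0[OF em] and Gin = exterior_map.G_into[OF em]
  have Gb: "cmod (G n w) \<le> 1 / \<rho>" if "w \<in> ball 0 1" for n w
    using Gin[of n] inv_domain_subset_ball[OF \<rho>(1) K\<rho>, of n] that by fastforce
  obtain \<psi> r where \<psi>: "\<psi> holomorphic_on ball 0 1" and r: "strict_mono (r :: nat \<Rightarrow> nat)"
    and lim: "\<And>x. x \<in> ball 0 1 \<Longrightarrow> (\<lambda>n. G (r n) x) \<longlonglongrightarrow> \<psi> x"
    and ul: "\<And>K. compact K \<Longrightarrow> K \<subseteq> ball 0 1 \<Longrightarrow> uniform_limit K (G \<circ> r) \<psi> sequentially"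
  proof (rule Montel[of "ball 0 1" "range G" G])
    show "\<exists>B. \<forall>h\<in>range G. \<forall>z\<in>C. cmod (h z) \<le> B" if "C \<subseteq> ball 0 1" for C
      using Gb that by (intro exI[of _ "1 / \<rho>"]) blast
  qed (use hG in auto)
  have \<psi>0: "\<psi> 0 = 0"
  proof -
    have "(\<lambda>n. G (r n) 0) \<longlonglongrightarrow> \<psi> 0" by (rule lim) simp
    then show ?thesis by (simp add: G0 LIMSEQ_const_iff)
  qed
  have dlim: "(\<lambda>n. deriv (G (r n)) 0) \<longlonglongrightarrow> deriv \<psi> 0"
  proof (rule deriv_complex_uniform_limit[where A = "ball 0 (1/2)"])
    have "uniform_limit (cball 0 (1/2)) (G \<circ> r) \<psi> sequentially"
      by (rule ul) auto
    then show "uniform_limit (ball 0 (1/2)) (\<lambda>n. G (r n)) \<psi> sequentially"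
      unfolding o_def by (rule uniform_limit_on_subset) auto
    show "\<forall>\<^sub>F n in sequentially. G (r n) holomorphic_on ball 0 (1/2)"
      by (intro always_eventually allI holomorphic_on_subset[OF hG]) auto
  qed auto
  have dpos: "1 / R \<le> cmod (deriv (G n) 0)" for n
    using exterior_map.deriv_G_lower[OF em R(1)] K(5) U(4) R(2) by blast
  have "1 / R \<le> cmod (deriv \<psi> 0)"
    by (rule LIMSEQ_le_const[OF tendsto_norm[OF dlim]]) (use dpos in auto)
  then have d\<psi>: "deriv \<psi> 0 \<noteq> 0" using R(1) by auto
  have nc: "\<not> \<psi> constant_on ball 0 1"
    by (rule not_constant_onI[OF d\<psi>]) auto
  \<comment> \<open>Hurwitz: a nonconstant limit omits \<open>1 / d i\<close> if the approximants
    do. The shift by \<open>i\<close> gives \<open>r (n + i) \<ge> i\<close>, hence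
    \<open>d i \<in> K (r (n + i))\<close>.\<close>
  have omit: "\<psi> w \<noteq> 1 / d i" if w: "w \<in> ball 0 1" and di: "d i \<noteq> 0" for w i
  proof -
    have "\<psi> w - 1 / d i \<noteq> 0"
    proof (rule Hurwitz_no_zeros[of "ball 0 1" "\<lambda>n x. G (r (n + i)) x - 1 / d i" "\<lambda>x. \<psi> x - 1 / d i"])
      show "(\<lambda>x. G (r (n + i)) x - 1 / d i) holomorphic_on ball 0 1" for n
        by (intro holomorphic_intros hG)
      show "(\<lambda>x. \<psi> x - 1 / d i) holomorphic_on ball 0 1"
        by (intro holomorphic_intros \<psi>)
      show "uniform_limit C (\<lambda>n x. G (r (n + i)) x - 1 / d i) (\<lambda>x. \<psi> x - 1 / d i) sequentially"
        if "compact C" "C \<subseteq> ball 0 1" for C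
      proof -
        have "uniform_limit C (\<lambda>n. (G \<circ> r) (n + i)) \<psi> sequentially"
          using ul[OF that] unfolding uniform_limit_iff
          by (auto intro: sequentially_offset)
        then have "uniform_limit C (\<lambda>n x. (G \<circ> r) (n + i) x - 1 / d i) (\<lambda>x. \<psi> x - 1 / d i) sequentially"
          by (intro uniform_limit_intros)
        then show ?thesis by simp
      qed
      show "\<not> (\<lambda>x. \<psi> x - 1 / d i) constant_on ball 0 1"
        using nc unfolding constant_on_def by (metis diff_add_cancel)
      show "G (r (n + i)) z - 1 / d i \<noteq> 0" if "z \<in> ball 0 1" for n z
      proof
        assume "G (r (n + i)) z - 1 / d i = 0"
        then have eq: "G (r (n + i)) z = 1 / d i" by simp
        have "1 / d i \<in> inv_domain (K (r (n + i)))"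
          using Gin[of "r (n + i)"] that unfolding eq[symmetric] by blast
        then have "d i \<in> outside (K (r (n + i)))" using di by (simp add: inv_domain_def)
        moreover have "d i \<in> K (r (n + i))"
          using seq_suble[OF r, of "n + i"] by (intro K(6)) linarith
        ultimately show False using outside_no_overlap by blast
      qed
    qed (use w in auto)
    then show ?thesis by simp
  qed
  have opn: "open (\<psi> ` ball 0 1)"
    by (rule open_mapping_thm[OF \<psi> open_ball connected_ball open_ball order_refl nc])
  \<comment> \<open>An open image containing \<open>1 / e\<close> would contain some
    \<open>1 / d i\<close>, since the \<open>d i\<close> are dense in
    \<open>closure U\<close>.\<close>
  have avoid: "1 / e \<notin> \<psi> ` ball 0 1" if e: "e \<in> closure U" "e \<noteq> 0" for e
  proof
    assume "1 / e \<in> \<psi> ` ball 0 1"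
    then have "e \<in> {z. z \<noteq> 0 \<and> 1 / z \<in> \<psi> ` ball 0 1}" using e by simp
    moreover have "closure U \<subseteq> closure (range d)"
      using K(1) closure_minimal closed_closure by blast
    then have "e \<in> closure (range d)" using e by blast
    ultimately obtain i where "d i \<in> {z. z \<noteq> 0 \<and> 1 / z \<in> \<psi> ` ball 0 1}"
      using open_inverse_vimage[OF opn] unfolding closure_iff_nhds_not_empty by blast
    then obtain w where "d i \<noteq> 0" "1 / d i = \<psi> w" "w \<in> ball 0 1" by blast
    then show False using omit[of w i] by simp
  qed
  have compU: "compact (closure U)"
    using bounded_subset[OF compact_imp_bounded[OF E] U(4)] by (simp add: compact_closure)
  have "\<psi> ` ball 0 1 \<subseteq> inv_domain (closure U)"
  proof (rule image_avoiding_subset_inv_domain[OF compU])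
    show "connected (\<psi> ` ball 0 1)"
      by (intro connected_continuous_image holomorphic_on_imp_continuous_on \<psi> connected_ball)
    show "0 \<in> \<psi> ` ball 0 1" using \<psi>0 by (metis centre_in_ball image_eqI zero_less_one)
  qed (rule avoid)
  then have \<psi>in: "\<psi> ` ball 0 1 \<subseteq> inv_domain E"
    unfolding inv_domain_def out .
  note w = E \<psi> \<psi>in \<psi>0 d\<psi>
  have low: "1 / cmod (deriv (G n) 0) \<le> cauchy_capacity E" for n
  proof -
    obtain s where s: "0 < s" "s < 1" "\<And>w. cmod w = s \<Longrightarrow> 1 / G n w \<in> U"
      by (rule exterior_map.level_curve_in_neighbourhood[OF em U(1) K(5) \<rho>(1) K\<rho>]) (rule that; assumption)
    have "1 / G n w \<in> E" if "cmod w = s" for w using s(3)[OF that] U(4) by blast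
    then obtain \<mu> where "complex_borel_measure \<mu>" "supported_on \<mu> E"
      "cmod (\<mu> E) = 1 / cmod (deriv (G n) 0)"
      "\<And>p. p \<in> sphere_compl E \<Longrightarrow> cmod (cauchy_transform \<mu> p) \<le> 1"
      using level_curve_measure[OF E hG exterior_map.G_inj[OF em] G0 s(1,2), of n] by metis
    then show ?thesis using cauchy_capacity_upper[OF w, of \<mu>] by simp
  qed
  \<comment> \<open>The limit is an upper bound for \<gamma> through \<psi>, and the terms are lower
    bounds for \<gamma>_c, which closes the chain with \<gamma>_c at most \<gamma>.\<close>
  have "(\<lambda>n. 1 / cmod (deriv (G (r n)) 0)) \<longlonglongrightarrow> 1 / cmod (deriv \<psi> 0)"
    by (intro tendsto_intros dlim) (use d\<psi> in simp)
  then have "1 / cmod (deriv \<psi> 0) \<le> cauchy_capacity E"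
    by (rule LIMSEQ_le_const2) (use low in auto)
  then show ?thesis
    using analytic_capacity_le[OF w] cauchy_capacity_le[OF w] by simp
qed

section \<open>An obstruction to Cauchy representability\<close>

lemma four_integral_diff:
  assumes c: "carried_by E P" "carried_by E N" "carried_by E P'" "carried_by E N'"
    and E: "E \<in> sets borel"
    and g: "g \<in> borel_measurable borel" "\<And>x. x \<in> E \<Longrightarrow> cmod (g x) \<le> B"
    and h: "h \<in> borel_measurable borel" "\<And>x. x \<in> E \<Longrightarrow> cmod (h x) \<le> B'"
  shows "four_integral P N P' N' (\<lambda>x. g x - h x) = four_integral P N P' N' g - four_integral P N P' N' h"
proof -
  have i: "(LINT x|M. g x - h x) = (LINT x|M. g x) - (LINT x|M. h x)" if M: "carried_by E M" for M
    using carried_by_integrable[OF M E g] carried_by_integrable[OF M E h] by simp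
  show ?thesis
    unfolding four_integral_def i[OF c(1)] i[OF c(2)] i[OF c(3)] i[OF c(4)]
    by (simp add: algebra_simps)
qed

text \<open>Testing a representing measure against \<open>h j\<close> gives \<open>\<Sum>k. w j * \<bar>f (z j k)\<bar>\<close>, as the Ahlfors function \<open>f\<close> is
  \<open>0\<close> at the points \<open>q j k\<close>. This stays away from \<open>0\<close>, whereas \<open>h j\<close> tends to \<open>0\<close> boundedly on \<open>E\<close>.\<close>

lemma (in exterior_map) not_cauchy_transform:
  fixes z q :: "nat \<Rightarrow> nat \<Rightarrow> complex" and w :: "nat \<Rightarrow> real" and I :: "nat \<Rightarrow> nat set"
  assumes \<rho>: "\<rho> > 0" "cball 0 \<rho> \<inter> outside E = {}"
    and w: "\<And>j. 0 \<le> w j" "\<And>j. real (card (I j)) * w j = 1"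
    and z: "\<And>j k. k \<in> I j \<Longrightarrow> z j k \<in> outside E" "\<And>j k. k \<in> I j \<Longrightarrow> cmod (z j k) \<le> B"
    and q: "\<And>j k. k \<in> I j \<Longrightarrow> q j k \<notin> outside E" "\<And>j k. k \<in> I j \<Longrightarrow> q j k \<notin> E"
    and bound: "\<And>j \<xi>. \<xi> \<in> E \<Longrightarrow> (\<Sum>k\<in>I j. w j * cmod (1 / (\<xi> - z j k) - 1 / (\<xi> - q j k))) \<le> C"
    and lim: "\<And>\<xi>. \<xi> \<in> E \<Longrightarrow> (\<lambda>j. \<Sum>k\<in>I j. w j * cmod (1 / (\<xi> - z j k) - 1 / (\<xi> - q j k))) \<longlonglongrightarrow> 0"
    and \<mu>: "complex_borel_measure \<mu>" "supported_on \<mu> E"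
    and rep: "\<And>p. p \<in> sphere_compl E \<Longrightarrow> ahlfors_function E p = cauchy_transform \<mu> p"
  shows False
proof -
  have Eb: "E \<in> sets borel" using E by (simp add: borel_compact)
  obtain P N P' N' where c: "carried_by E P" "carried_by E N" "carried_by E P'" "carried_by E N'"
    and i: "complex_measure_integral \<mu> = four_integral P N P' N'"
    by (rule complex_measure_parts[OF \<mu> Eb])
  let ?f = "\<lambda>\<zeta>. ahlfors_function E (Some \<zeta>)"
  have f: "four_integral P N P' N' (\<lambda>\<xi>. 1 / (\<xi> - \<zeta>)) = ?f \<zeta>" if "\<zeta> \<notin> E" for \<zeta>
    using rep[of "Some \<zeta>"] that by (simp add: sphere_compl_def cauchy_transform_def i image_iff)
  have zE: "z j k \<notin> E" if "k \<in> I j" for j k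
    using z(1)[OF that] outside_no_overlap[of E] by blast
  have kb: "\<exists>b. \<forall>\<xi>\<in>E. cmod (1 / (\<xi> - \<zeta>)) \<le> b" if "\<zeta> \<notin> E" for \<zeta>
  proof -
    have "continuous_on E (\<lambda>\<xi>. 1 / (\<xi> - \<zeta>))"
      using that by (intro continuous_intros) auto
    from compact_imp_bounded[OF compact_continuous_image[OF this E]]
    show ?thesis by (auto simp: bounded_iff)
  qed
  define g where "g j k \<xi> = 1 / (\<xi> - z j k) - 1 / (\<xi> - q j k)" for j k \<xi>
  have gm: "g j k \<in> borel_measurable borel" for j k
    unfolding g_def[abs_def] by measurable
  have gi: "four_integral P N P' N' (g j k) = ?f (z j k)" if k: "k \<in> I j" for j k
  proof -
    obtain b b' where b: "\<And>\<xi>. \<xi> \<in> E \<Longrightarrow> cmod (1 / (\<xi> - z j k)) \<le> b"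
        and b': "\<And>\<xi>. \<xi> \<in> E \<Longrightarrow> cmod (1 / (\<xi> - q j k)) \<le> b'"
      using kb[OF zE[OF k]] kb[OF q(2)[OF k]] by blast
    have "four_integral P N P' N' (g j k) =
        four_integral P N P' N' (\<lambda>\<xi>. 1 / (\<xi> - z j k)) - four_integral P N P' N' (\<lambda>\<xi>. 1 / (\<xi> - q j k))"
      unfolding g_def[abs_def] by (rule four_integral_diff[OF c Eb _ b _ b']) measurable
    then show ?thesis
      by (simp add: f zE[OF k] q(2)[OF k] ahlfors_function_inside[OF q(1)[OF k]])
  qed
  have gb: "\<exists>b. \<forall>\<xi>\<in>E. cmod (g j k \<xi>) \<le> b" if k: "k \<in> I j" for j k
  proof -
    obtain b b' where b: "\<And>\<xi>. \<xi> \<in> E \<Longrightarrow> cmod (1 / (\<xi> - z j k)) \<le> b"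
        and b': "\<And>\<xi>. \<xi> \<in> E \<Longrightarrow> cmod (1 / (\<xi> - q j k)) \<le> b'"
      using kb[OF zE[OF k]] kb[OF q(2)[OF k]] by blast
    have "cmod (g j k \<xi>) \<le> b + b'" if "\<xi> \<in> E" for \<xi>
      unfolding g_def using norm_triangle_ineq4[of "1 / (\<xi> - z j k)" "1 / (\<xi> - q j k)"] b[OF that] b'[OF that]
      by linarith
    then show ?thesis by blast
  qed
  then have "\<forall>j k. \<exists>b. k \<in> I j \<longrightarrow> (\<forall>\<xi>\<in>E. cmod (g j k \<xi>) \<le> b)" by blast
  then obtain b where b: "\<And>j k \<xi>. k \<in> I j \<Longrightarrow> \<xi> \<in> E \<Longrightarrow> cmod (g j k \<xi>) \<le> b j k"
    unfolding choice_iff by blast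
  \<comment> \<open>The conjugate sign turns each value of \<open>f\<close> into its modulus, so
    that the contributions of different pairs cannot cancel.\<close>
  define a where "a j k = of_real (w j) * cnj (sgn (?f (z j k)))" for j k
  have a: "cmod (a j k) \<le> w j" for j k
    using w(1)[of j] by (simp add: a_def norm_mult norm_sgn)
  define h where "h j \<xi> = (\<Sum>k\<in>I j. a j k * g j k \<xi>)" for j \<xi>
  have hm: "h j \<in> borel_measurable borel" for j
    unfolding h_def[abs_def] using gm by measurable
  have hle: "cmod (h j \<xi>) \<le> (\<Sum>k\<in>I j. w j * cmod (g j k \<xi>))" for j \<xi>
    unfolding h_def by (rule order_trans[OF norm_sum sum_mono]) (simp add: norm_mult a mult_right_mono)
  have "(\<lambda>j. four_integral P N P' N' (h j)) \<longlonglongrightarrow> four_integral P N P' N' (\<lambda>_. 0)"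
  proof (rule four_integral_tendsto[OF c Eb hm])
    show "cmod (h j \<xi>) \<le> C" if "\<xi> \<in> E" for j \<xi>
      using hle[of j \<xi>] bound[OF that, of j] unfolding g_def by linarith
    show "(\<lambda>j. h j \<xi>) \<longlonglongrightarrow> 0" if "\<xi> \<in> E" for \<xi>
      by (rule Lim_null_comparison[OF _ lim[OF that]]) (use hle in \<open>simp add: g_def\<close>)
  qed simp
  then have to0: "(\<lambda>j. four_integral P N P' N' (h j)) \<longlonglongrightarrow> 0"
    by (simp add: four_integral_def)
  have B: "B > 0"
  proof -
    have "I 0 \<noteq> {}" using w(2)[of 0] by auto
    then obtain k where k: "k \<in> I 0" by blast
    then have "z 0 k \<noteq> 0" using z(1) zero by metis
    then show ?thesis using z(2)[OF k] by (meson less_le_trans zero_less_norm_iff)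
  qed
  have fl: "\<rho> / B \<le> cmod (?f (z j k))" if k: "k \<in> I j" for j k
  proof -
    have "z j k \<noteq> 0" using z(1)[OF k] zero by metis
    then have "\<rho> / B \<le> \<rho> / cmod (z j k)"
      using z(2)[OF k] \<rho>(1) B by (intro divide_left_mono mult_pos_pos) auto
    then show ?thesis using ahlfors_function_lower[OF \<rho> z(1)[OF k]] by linarith
  qed
  have val: "four_integral P N P' N' (h j) = of_real (\<Sum>k\<in>I j. w j * cmod (?f (z j k)))" for j
  proof -
    have "four_integral P N P' N' (h j) = (\<Sum>k\<in>I j. a j k * four_integral P N P' N' (g j k))"
      unfolding h_def[abs_def] by (rule four_integral_sum[OF c Eb gm b])
    also have "\<dots> = (\<Sum>k\<in>I j. of_real (w j * cmod (?f (z j k))))"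
    proof (rule sum.cong[OF refl])
      fix k assume k: "k \<in> I j"
      have "cnj (sgn x) * x = of_real (cmod x)" for x :: complex
      proof (cases "x = 0")
        case False
        have "cnj (sgn x) * x = (x * cnj x) / of_real (cmod x)"
          by (simp add: sgn_eq)
        also have "x * cnj x = of_real (cmod x) * of_real (cmod x)"
          using complex_norm_square[of x] by (simp add: power2_eq_square)
        finally show ?thesis using False by simp
      qed simp
      then show "a j k * four_integral P N P' N' (g j k) = of_real (w j * cmod (?f (z j k)))"
        by (simp add: a_def gi[OF k] mult.assoc)
    qed
    finally show ?thesis by simp
  qed
  have "\<rho> / B \<le> cmod (four_integral P N P' N' (h j))" for j
  proof -
    have "\<rho> / B = (\<Sum>k\<in>I j. w j * (\<rho> / B))"
      using w(2)[of j] by (simp add: mult.assoc[symmetric])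
    also have "\<dots> \<le> (\<Sum>k\<in>I j. w j * cmod (?f (z j k)))"
      by (intro sum_mono mult_left_mono fl w)
    also have "\<dots> \<le> cmod (four_integral P N P' N' (h j))"
      unfolding val norm_of_real by simp
    finally show ?thesis .
  qed
  then have "\<rho> / B \<le> cmod 0"
    by (intro LIMSEQ_le_const[OF tendsto_norm[OF to0]]) auto
  then show False using \<rho>(1) B by (simp add: divide_le_0_iff)
qed

text \<open>A connected set that meets the ball and leaves it must cross the sphere, which
  \<open>S\<close> contains.\<close>

lemma inside_of_sphere:
  fixes S :: "complex set"
  assumes "sphere p r \<subseteq> S" "y \<in> ball p r" "y \<notin> S"
  shows "y \<in> inside S"
proof -
  let ?D = "connected_component_set (- S) y"
  have "?D \<subseteq> ball p r"
  proof (rule ccontr)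
    assume "\<not> ?D \<subseteq> ball p r"
    then have "?D - ball p r \<noteq> {}" by blast
    moreover have "y \<in> ?D" using assms(3) by simp
    then have "?D \<inter> ball p r \<noteq> {}" using assms(2) by blast
    ultimately have "?D \<inter> frontier (ball p r) \<noteq> {}"
      by (intro connected_Int_frontier) auto
    moreover have "0 < r" using assms(2) by (metis ball_eq_empty empty_iff not_le)
    ultimately show False
      using assms(1) connected_component_subset[of "- S" y] by auto
  qed
  then show ?thesis
    using assms(3) bounded_subset[OF bounded_ball] by (auto simp: inside_def)
qed

text \<open>A member and the finite union of the others are disjoint closed sets, so a connected set
  that contains one member cannot reach the rest.\<close>

lemma components_Union_closed:
  fixes \<A> :: "complex set set"
  assumes fin: "finite \<A>" and A: "\<And>A. A \<in> \<A> \<Longrightarrow> closed A \<and> connected A \<and> A \<noteq> {}"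
    and dis: "\<And>A B. A \<in> \<A> \<Longrightarrow> B \<in> \<A> \<Longrightarrow> A \<noteq> B \<Longrightarrow> A \<inter> B = {}"
  shows "components (\<Union>\<A>) = \<A>"
proof -
  have comp: "X \<in> components (\<Union>\<A>)" if X: "X \<in> \<A>" for X
    unfolding in_components_maximal
  proof (intro conjI allI impI)
    fix D assume D: "D \<noteq> {} \<and> X \<subseteq> D \<and> D \<subseteq> \<Union>\<A> \<and> connected D"
    let ?Y = "\<Union>(\<A> - {X})"
    have "closed ?Y" using fin A by (intro closed_Union) auto
    moreover have "X \<inter> ?Y = {}" using dis X by blast
    ultimately have "X \<inter> D = {} \<or> ?Y \<inter> D = {}"
      using connected_closedD[of D X ?Y] D A[OF X] by blast
    then show "D = X" using D A[OF X] by blast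
  qed (use A[OF X] X in auto)
  show ?thesis
  proof (intro set_eqI iffI)
    fix D assume D: "D \<in> components (\<Union>\<A>)"
    then obtain x where "x \<in> D" "x \<in> \<Union>\<A>"
      using in_components_nonempty in_components_subset by (metis all_not_in_conv subsetD)
    then obtain X where "X \<in> \<A>" "x \<in> X" by blast
    then have "D = X"
      using components_nonoverlap[OF D comp[of X]] \<open>x \<in> D\<close> by blast
    then show "D \<in> \<A>" using \<open>X \<in> \<A>\<close> by simp
  qed (rule comp)
qed

text \<open>The terms at \<open>-1\<close>, \<open>0\<close> and \<open>1\<close> add up to
  \<open>3\<close>; on either side \<open>1 / n^2 \<le> 1 / (n - 1) - 1 / n\<close> telescopes to at
  most \<open>1\<close>.\<close>

lemma sum_inverse_squares_int:
  fixes S :: "int set"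
  assumes "finite S"
  shows "(\<Sum>d\<in>S. 1 / (max 1 \<bar>real_of_int d\<bar>)\<^sup>2) \<le> 5"
proof -
  let ?b = "\<lambda>d::int. 1 / (max 1 \<bar>real_of_int d\<bar>)\<^sup>2"
  \<comment> \<open>The subtracted term is the telescoping tail, without which the induction does
    not close.\<close>
  have sym: "sum ?b {- int (Suc n)..int (Suc n)} \<le> 5 - 2 / real (Suc n)" for n
  proof (induction n)
    case 0
    have "{- int (Suc 0)..int (Suc 0)} = {-1, 0, 1}" by auto
    then show ?case by simp
  next
    case (Suc n)
    let ?N = "int (Suc (Suc n))"
    have "{- ?N..?N} = insert (- ?N) (insert ?N {- int (Suc n)..int (Suc n)})" by auto
    then have "sum ?b {- ?N..?N} = ?b (- ?N) + (?b ?N + sum ?b {- int (Suc n)..int (Suc n)})" by simp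
    moreover have "?b (- ?N) = 1 / (real n + 2)\<^sup>2" "?b ?N = 1 / (real n + 2)\<^sup>2" by simp_all
    ultimately have "sum ?b {- ?N..?N} \<le> 5 - 2 / (real n + 1) + 2 / (real n + 2)\<^sup>2"
    proof -
      have "real (Suc n) = real n + 1" by simp
      then have "sum ?b {- int (Suc n)..int (Suc n)} \<le> 5 - 2 / (real n + 1)" using Suc.IH by metis
      moreover have "2 / (real n + 2)\<^sup>2 = 1 / (real n + 2)\<^sup>2 + 1 / (real n + 2)\<^sup>2" by simp
      ultimately show ?thesis
        using \<open>sum ?b {- ?N..?N} = _\<close> \<open>?b (- ?N) = _\<close> \<open>?b ?N = _\<close> by linarith
    qed
    also have "\<dots> \<le> 5 - 2 / (real n + 2)"
      by (simp add: divide_simps power2_eq_square) (simp add: algebra_simps)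
    finally show ?case by (simp add: add.commute)
  qed
  obtain n where n: "\<And>d. d \<in> S \<Longrightarrow> \<bar>d\<bar> \<le> int n"
  proof -
    have "\<exists>k. \<forall>d\<in>S. \<bar>d\<bar> \<le> k"
      using assms finite_imageI[of S abs] by (metis Max_ge imageI)
    then obtain k where "\<And>d. d \<in> S \<Longrightarrow> \<bar>d\<bar> \<le> k" by blast
    then show ?thesis using that[of "nat k"] by (meson dual_order.trans nat_le_iff order_refl)
  qed
  have "S \<subseteq> {- int (Suc n)..int (Suc n)}"
    using n by (fastforce simp: abs_le_iff)
  then have "sum ?b S \<le> sum ?b {- int (Suc n)..int (Suc n)}"
    by (intro sum_mono2) auto
  also have "\<dots> \<le> 5 - 2 / real (Suc n)" by (rule sym)
  also have "\<dots> \<le> 5" by simp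
  finally show ?thesis .
qed

text \<open>With \<open>m\<close> the integer part of \<open>t / 3\<close>, the distance from
  \<open>t\<close> to \<open>3 k\<close> is at least \<open>\<bar>k - m\<bar>\<close> except perhaps
  for \<open>k = m + 1\<close>, where the \<open>1\<close> in the maximum takes over.\<close>

lemma sum_inverse_squares_spaced:
  fixes t :: real
  assumes I: "finite I"
  shows "(\<Sum>k\<in>I. 1 / (max 1 \<bar>t - 3 * real k\<bar>)\<^sup>2) \<le> 5"
proof -
  define m where "m = \<lfloor>t / 3\<rfloor>"
  define \<theta> where "\<theta> = t / 3 - real_of_int m"
  have \<theta>: "0 \<le> \<theta>" "\<theta> < 1" unfolding \<theta>_def m_def by linarith+
  have t: "t = 3 * real_of_int m + 3 * \<theta>" by (simp add: \<theta>_def)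
  have "(\<Sum>k\<in>I. 1 / (max 1 \<bar>t - 3 * real k\<bar>)\<^sup>2) \<le> (\<Sum>k\<in>I. 1 / (max 1 \<bar>real_of_int (int k - m)\<bar>)\<^sup>2)"
  proof (rule sum_mono)
    fix k
    have "max 1 \<bar>real_of_int (int k - m)\<bar> \<le> max 1 \<bar>t - 3 * real k\<bar>"
    proof (cases "int k \<le> m + 1")
      case True
      then have "real_of_int (int k) \<le> real_of_int (m + 1)" by (simp only: of_int_le_iff)
      then have "real k \<le> real_of_int m + 1" by simp
      then show ?thesis using \<theta> unfolding t by (auto simp: max_def abs_if)
    next
      case False
      then have "real_of_int (m + 2) \<le> real_of_int (int k)" by (simp only: of_int_le_iff)
      then have "real_of_int m + 2 \<le> real k" by simp
      then show ?thesis using \<theta> unfolding t by (auto simp: max_def abs_if)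
    qed
    then show "1 / (max 1 \<bar>t - 3 * real k\<bar>)\<^sup>2 \<le> 1 / (max 1 \<bar>real_of_int (int k - m)\<bar>)\<^sup>2"
      by (intro divide_left_mono power_mono mult_pos_pos zero_less_power) auto
  qed
  also have "\<dots> = (\<Sum>d\<in>(\<lambda>k. int k - m) ` I. 1 / (max 1 \<bar>real_of_int d\<bar>)\<^sup>2)"
    by (subst sum.reindex) (auto simp: inj_on_def)
  also have "\<dots> \<le> 5"
    using I by (intro sum_inverse_squares_int) simp
  finally show ?thesis .
qed

section \<open>The towers\<close>

text \<open>The towers accumulate at the imaginary axis. Every fixed point is eventually at
  horizontal distance at least \<open>abscissa j\<close> from the axis of tower \<open>j\<close>,
  also if it lies on the imaginary axis itself.\<close>

definition abscissa :: "nat \<Rightarrow> real" where "abscissa j = (1 / 2) ^ (j + 2)"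

definition width :: "nat \<Rightarrow> real" where "width j = abscissa j ^ 3"

definition ring_count :: "nat \<Rightarrow> nat" where "ring_count j = 8 ^ (j + 2)"

text \<open>The spacing is less than twice the outer radius of a ring, so consecutive rings overlap,
  and equals outer plus inner radius, so no ring enters another's hole. Ring \<open>0\<close> is
  centred at the height of the upper edge of the square and ties the tower to it.\<close>

definition hole :: "nat \<Rightarrow> nat \<Rightarrow> complex" where
  "hole j k = Complex (abscissa j) (1 + 3 * width j * real k)"

definition tower_ring :: "nat \<Rightarrow> nat \<Rightarrow> complex set" where
  "tower_ring j k = {u. width j < cmod (u - hole j k) \<and> cmod (u - hole j k) < 2 * width j}"

definition square :: "complex set" where
  "square = box (Complex (-1) (-1)) (Complex 1 1)"

text \<open>The \<open>j\<close>-th tower of overlapping rings on top of the square has width \<open>O(width j)\<close> but height \<open>3\<close>, so the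
  part of the boundary between the holes and the exterior has infinite length.\<close>

definition tower_domain :: "complex set" where
  "tower_domain = square \<union> (\<Union>j. \<Union>k\<le>ring_count j. tower_ring j k)"

lemma abscissa_pos [simp]: "0 < abscissa j" and abscissa_le: "abscissa j \<le> 1 / 4"
proof -
  show "0 < abscissa j" by (simp add: abscissa_def)
  have "(1 / 2 :: real) ^ (j + 2) \<le> (1 / 2) ^ 2" by (rule power_decreasing) auto
  then show "abscissa j \<le> 1 / 4" by (simp add: abscissa_def power2_eq_square)
qed

lemma width_pos [simp]: "0 < width j"
  by (simp add: width_def)

lemma width_le: "width j \<le> abscissa j / 16"
proof -
  have "abscissa j ^ 2 \<le> (1 / 4) ^ 2"
    by (rule power_mono[OF abscissa_le]) (simp add: less_imp_le)
  then have "abscissa j * abscissa j ^ 2 \<le> abscissa j * (1 / 16)"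
    by (intro mult_left_mono) (simp_all add: less_imp_le power2_eq_square)
  then show ?thesis by (simp add: width_def power3_eq_cube power2_eq_square)
qed

lemma ring_count_width: "real (ring_count j) * width j = 1"
proof -
  have "width j = (1 / 8) ^ (j + 2)"
  proof -
    have "width j = ((1 / 2) ^ 3) ^ (j + 2)"
      unfolding width_def abscissa_def by (subst (1 2) power_mult[symmetric], subst mult.commute) (rule refl)
    then show ?thesis by (simp add: power3_eq_cube)
  qed
  then have "real (ring_count j) * width j = (8 * (1 / 8)) ^ (j + 2)"
    unfolding ring_count_def power_mult_distrib by simp
  then show ?thesis by simp
qed

lemma abscissa_halves:
  assumes "i < j"
  shows "abscissa j \<le> abscissa i / 2"
proof -
  have "(1 / 2 :: real) ^ (j + 2) \<le> (1 / 2) ^ (i + 3)"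
    using assms by (intro power_decreasing) auto
  then show ?thesis by (simp add: abscissa_def power_add power3_eq_cube power2_eq_square)
qed

text \<open>The terms are the half-width \<open>2 * width i\<close> of one tower and, for the other,
  the offset \<open>3 * width j\<close> of its exit points plus a clearance
  \<open>width j\<close>.\<close>

lemma abscissa_gap:
  assumes "i \<noteq> j"
  shows "2 * width i + 4 * width j \<le> \<bar>abscissa i - abscissa j\<bar>"
proof (cases "i < j")
  case True
  then show ?thesis
    using abscissa_halves[OF True] width_le[of i] width_le[of j] abscissa_pos[of i] by linarith
next
  case False
  then have "j < i" using assms by simp
  then show ?thesis
    using abscissa_halves[of j i] width_le[of i] width_le[of j] abscissa_pos[of j] by linarith
qed

lemma abscissa_tendsto: "abscissa \<longlonglongrightarrow> 0"
  unfolding abscissa_def by (rule LIMSEQ_ignore_initial_segment) (simp add: LIMSEQ_power_zero)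

text \<open>A closed condition, so that it passes to closures. It gives the lower bounds for the
  kernels, puts the holes off the set, and leads every exit point to infinity along a vertical ray.
  Hole \<open>0\<close> is left out because it meets the square.\<close>

definition clear_of_tower :: "nat \<Rightarrow> complex \<Rightarrow> bool" where
  "clear_of_tower j u \<longleftrightarrow> (\<forall>k\<ge>1. width j \<le> cmod (u - hole j k)) \<and>
     (\<forall>t\<ge>1 + 3 * width j. width j \<le> cmod (u - Complex (abscissa j + 3 * width j) t))"

lemma closed_clear: "closed {u. clear_of_tower j u}"
proof -
  have "closed {u. width j \<le> cmod (u - c)}" for c
    by (intro closed_Collect_le continuous_intros)
  then show ?thesis
    unfolding clear_of_tower_def by (intro closed_Collect_conj closed_Collect_all closed_Collect_imp) auto
qed

lemma clear_below:
  assumes "Im u \<le> 1"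
  shows "clear_of_tower j u"
proof -
  have "width j \<le> cmod (u - Complex a t)" if "t \<ge> 1 + 3 * width j" for a t
  proof -
    have "t - Im u \<le> cmod (u - Complex a t)"
      using abs_Im_le_cmod[of "u - Complex a t"] by simp
    then show ?thesis using assms that width_pos[of j] by linarith
  qed
  moreover have "1 + 3 * width j * real k \<ge> 1 + 3 * width j" if "k \<ge> 1" for k
    using that width_pos[of j] by simp
  ultimately show ?thesis by (simp add: clear_of_tower_def hole_def)
qed

lemma clear_near_other:
  assumes "i \<noteq> j" "\<bar>Re u - abscissa i\<bar> \<le> 2 * width i"
  shows "clear_of_tower j u"
proof -
  have r: "\<bar>Re u - abscissa j\<bar> \<ge> 4 * width j"
    using abscissa_gap[OF assms(1)] assms(2) by linarith
  have "width j \<le> cmod (u - hole j k)" for k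
    using abs_Re_le_cmod[of "u - hole j k"] r width_pos[of j] by (simp add: hole_def)
  moreover have "width j \<le> cmod (u - Complex (abscissa j + 3 * width j) t)" for t
    using abs_Re_le_cmod[of "u - Complex (abscissa j + 3 * width j) t"] r width_pos[of j] by simp
  ultimately show ?thesis by (simp add: clear_of_tower_def)
qed

lemma ring_Re: "u \<in> tower_ring j k \<Longrightarrow> \<bar>Re u - abscissa j\<bar> \<le> 2 * width j"
  using abs_Re_le_cmod[of "u - hole j k"] by (simp add: tower_ring_def hole_def)

text \<open>A point less than \<open>2 * width j\<close> from one centre is more than
  \<open>width j\<close> from the others, which are at least \<open>3 * width j\<close> away from
  that centre.\<close>

lemma clear_ring_same:
  assumes u: "u \<in> tower_ring j l"
  shows "clear_of_tower j u"
proof -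
  have "width j \<le> cmod (u - hole j k)" for k
  proof (cases "k = l")
    case False
    then have "1 \<le> \<bar>real l - real k\<bar>" by (cases "k < l") auto
    then have "3 * width j * 1 \<le> 3 * width j * \<bar>real l - real k\<bar>"
      by (intro mult_left_mono) (simp_all add: less_imp_le)
    also have "\<dots> = \<bar>Im (hole j l - hole j k)\<bar>"
      by (simp add: hole_def abs_mult less_imp_le flip: right_diff_distrib)
    also have "\<dots> \<le> cmod (hole j l - hole j k)" by (rule abs_Im_le_cmod)
    also have "\<dots> \<le> cmod (u - hole j l) + cmod (u - hole j k)"
      using norm_triangle_ineq4[of "u - hole j k" "u - hole j l"] by simp
    finally show ?thesis using u by (simp add: tower_ring_def)
  qed (use u in \<open>simp add: tower_ring_def\<close>)
  moreover have "width j \<le> cmod (u - Complex (abscissa j + 3 * width j) t)" for t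
    using abs_Re_le_cmod[of "u - Complex (abscissa j + 3 * width j) t"] ring_Re[OF u] by simp
  ultimately show ?thesis by (simp add: clear_of_tower_def)
qed

lemma clear_closure_tower_domain:
  assumes "u \<in> closure tower_domain"
  shows "clear_of_tower j u"
proof -
  have "tower_domain \<subseteq> {u. clear_of_tower j u}"
  proof
    fix u assume "u \<in> tower_domain"
    then consider "u \<in> square" | i k where "u \<in> tower_ring i k" by (auto simp: tower_domain_def)
    then show "u \<in> {u. clear_of_tower j u}"
    proof cases
      case 1
      then show ?thesis using clear_below[of u j] by (simp add: square_def in_box_complex_iff)
    next
      case 2
      then show ?thesis using clear_ring_same clear_near_other[OF _ ring_Re] by (cases "i = j") auto
    qed
  qed
  then show ?thesis using assms closure_minimal[OF _ closed_clear] by blast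
qed

section \<open>Topology of the tower domain\<close>

lemma open_ring: "open (tower_ring j k)"
  unfolding tower_ring_def by (intro open_Collect_conj open_Collect_less continuous_intros)

lemma open_tower_domain: "open tower_domain"
  unfolding tower_domain_def square_def by (intro open_Un open_UN ballI open_box open_ring)

lemma connected_ring: "connected (tower_ring j k)"
proof -
  have "tower_ring j k = {u. width j < norm (hole j k - u) \<and> norm (hole j k - u) < 2 * width j}"
    by (auto simp: tower_ring_def norm_minus_commute)
  then show ?thesis
    using connected_annulus(1)[of "width j" "hole j k" "2 * width j"] by (simp add: norm_minus_commute)
qed

lemma connected_tower: "connected (square \<union> (\<Union>k\<le>n. tower_ring j k))"
proof (induction n)
  case 0
  \<comment> \<open>The lowest point of the middle circle of ring \<open>0\<close> lies in the
    square.\<close>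
  have "hole j 0 - \<i> * of_real (3 / 2 * width j) \<in> square \<inter> tower_ring j 0"
    using abscissa_le[of j] width_le[of j] width_pos[of j] abscissa_pos[of j]
    by (auto simp: square_def in_box_complex_iff hole_def tower_ring_def norm_mult simp del: abscissa_pos width_pos)
  then have "square \<inter> tower_ring j 0 \<noteq> {}" by blast
  then have "connected (square \<union> tower_ring j 0)"
    by (intro connected_Un connected_ring) (auto simp: square_def convex_box convex_connected)
  then show ?case by simp
next
  case (Suc n)
  have d: "hole j (Suc n) - hole j n = \<i> * of_real (3 * width j)"
    by (simp add: hole_def complex_eq_iff algebra_simps)
  \<comment> \<open>The midpoint of two consecutive centres, at distance
    \<open>3 / 2 * width j\<close> from both.\<close>
  define u where "u = hole j n + \<i> * of_real (3 / 2 * width j)"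
  have u1: "u - hole j n = \<i> * of_real (3 / 2 * width j)" by (simp add: u_def)
  have "u - hole j (Suc n) = (u - hole j n) - (hole j (Suc n) - hole j n)" by simp
  then have u2: "u - hole j (Suc n) = - (\<i> * of_real (3 / 2 * width j))"
    unfolding d u_def by (simp add: algebra_simps)
  have "cmod (\<i> * of_real (3 / 2 * width j)) = 3 / 2 * width j"
    unfolding norm_mult norm_of_real by (simp add: less_imp_le)
  then have "u \<in> tower_ring j n \<inter> tower_ring j (Suc n)"
    unfolding tower_ring_def u1 u2 Int_iff mem_Collect_eq norm_minus_cancel using width_pos[of j] by linarith
  then have "(square \<union> (\<Union>k\<le>n. tower_ring j k)) \<inter> tower_ring j (Suc n) \<noteq> {}" by auto
  then have "connected ((square \<union> (\<Union>k\<le>n. tower_ring j k)) \<union> tower_ring j (Suc n))"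
    by (intro connected_Un Suc connected_ring)
  moreover have "(square \<union> (\<Union>k\<le>n. tower_ring j k)) \<union> tower_ring j (Suc n) = square \<union> (\<Union>k\<le>Suc n. tower_ring j k)"
    by (auto simp: atMost_Suc)
  ultimately show ?case by simp
qed

lemma zero_in_square: "0 \<in> square"
  by (simp add: square_def in_box_complex_iff)

lemma zero_in_tower_domain: "0 \<in> tower_domain"
  using zero_in_square by (simp add: tower_domain_def)

lemma connected_tower_domain: "connected tower_domain"
proof -
  have "tower_domain = (\<Union>j. square \<union> (\<Union>k\<le>ring_count j. tower_ring j k))"
    by (auto simp: tower_domain_def)
  moreover have "connected (\<Union>j. square \<union> (\<Union>k\<le>ring_count j. tower_ring j k))"
  proof (rule connected_Union)
    show "connected S" if "S \<in> range (\<lambda>j. square \<union> (\<Union>k\<le>ring_count j. tower_ring j k))" for S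
      using that connected_tower by blast
    have "0 \<in> \<Inter> (range (\<lambda>j. square \<union> (\<Union>k\<le>ring_count j. tower_ring j k)))"
      using zero_in_square by blast
    then show "\<Inter> (range (\<lambda>j. square \<union> (\<Union>k\<le>ring_count j. tower_ring j k))) \<noteq> {}" by blast
  qed
  ultimately show ?thesis by simp
qed

lemma cmod_Complex_le:
  assumes "k \<le> ring_count j" "\<bar>a\<bar> \<le> 1"
  shows "cmod (Complex a (1 + 3 * width j * real k)) \<le> 5"
proof -
  have "width j * real k \<le> 1"
    using ring_count_width[of j] assms(1) width_pos[of j]
    by (metis mult.commute mult_left_mono of_nat_le_iff less_imp_le)
  moreover have "0 \<le> width j * real k" by (simp add: less_imp_le)
  ultimately show ?thesis
    using cmod_le[of "Complex a (1 + 3 * width j * real k)"] assms(2) by simp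
qed

lemma bounded_tower_domain: "bounded tower_domain"
proof -
  have "cmod u \<le> 6" if "u \<in> tower_domain" for u
  proof -
    from that consider "u \<in> square" | j k where "k \<le> ring_count j" "u \<in> tower_ring j k"
      by (auto simp: tower_domain_def)
    then show ?thesis
    proof cases
      case 1
      then have "\<bar>Re u\<bar> \<le> 1" "\<bar>Im u\<bar> \<le> 1" by (auto simp: square_def in_box_complex_iff)
      then show ?thesis using cmod_le[of u] by linarith
    next
      case 2
      have "cmod (hole j k) \<le> 5"
        unfolding hole_def using abscissa_le[of j] abscissa_pos[of j] by (intro cmod_Complex_le 2) linarith
      moreover have "cmod u \<le> cmod (u - hole j k) + cmod (hole j k)"
        using norm_triangle_ineq[of "u - hole j k" "hole j k"] by simp
      moreover have "cmod (u - hole j k) \<le> 1"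
        using 2 width_le[of j] abscissa_le[of j] by (simp add: tower_ring_def)
      ultimately show ?thesis by linarith
    qed
  qed
  then show ?thesis by (auto simp: bounded_iff)
qed

text \<open>The circle of radius \<open>3 / 2 * width j\<close> runs within the ring around the
  hole, and by clearance the closure of the domain does not enter the hole.\<close>

lemma ball_hole_subset_inside:
  assumes "1 \<le> k" "k \<le> ring_count j"
  shows "ball (hole j k) (width j) \<subseteq> inside (closure tower_domain)"
proof
  fix y assume y: "y \<in> ball (hole j k) (width j)"
  show "y \<in> inside (closure tower_domain)"
  proof (rule inside_of_sphere)
    have "sphere (hole j k) (3 / 2 * width j) \<subseteq> tower_ring j k"
    proof
      fix u assume "u \<in> sphere (hole j k) (3 / 2 * width j)"
      then have "cmod (u - hole j k) = 3 / 2 * width j" by (simp add: dist_norm norm_minus_commute)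
      then show "u \<in> tower_ring j k" unfolding tower_ring_def mem_Collect_eq using width_pos[of j] by linarith
    qed
    then have "sphere (hole j k) (3 / 2 * width j) \<subseteq> tower_domain"
      using assms(2) by (auto simp: tower_domain_def)
    then show "sphere (hole j k) (3 / 2 * width j) \<subseteq> closure tower_domain"
      using closure_subset by blast
    show "y \<in> ball (hole j k) (3 / 2 * width j)" using y width_pos[of j] unfolding mem_ball by linarith
    show "y \<notin> closure tower_domain"
    proof
      assume "y \<in> closure tower_domain"
      then have "width j \<le> cmod (y - hole j k)"
        using clear_closure_tower_domain[of y j] assms(1) by (simp add: clear_of_tower_def)
      then show False using y by (simp add: dist_norm norm_minus_commute)
    qed
  qed
qed

lemma outside_Un_inside:
  fixes S T :: "complex set"
  assumes "T \<subseteq> inside S"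
  shows "outside (S \<union> T) = outside S"
proof
  show "outside (S \<union> T) \<subseteq> outside S" by (rule outside_mono) blast
  have "outside (S \<union> {}) \<subseteq> outside (S \<union> T)"
    by (rule outside_Un_outside_Un) (use assms in \<open>auto simp: inside_outside\<close>)
  then show "outside S \<subseteq> outside (S \<union> T)" by simp
qed

lemma ray_outside:
  assumes "\<And>t. t \<ge> a \<Longrightarrow> Complex x t \<notin> S"
  shows "Complex x a \<in> outside S"
proof -
  let ?L = "(\<lambda>t. Complex x t) ` {a..}"
  have "continuous_on {a..} (\<lambda>t. Complex x t)"
    unfolding Complex_eq by (intro continuous_intros)
  then have "connected ?L"
    by (intro connected_continuous_image) auto
  moreover have "?L \<subseteq> - S" using assms by auto
  ultimately have "?L \<subseteq> connected_component_set (- S) (Complex x a)"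
    by (intro connected_component_maximal) auto
  moreover have "\<not> bounded ?L"
  proof
    assume "bounded ?L"
    then obtain b where b: "\<And>t. t \<ge> a \<Longrightarrow> cmod (Complex x t) \<le> b" by (auto simp: bounded_iff)
    have "\<bar>max a (b + 1)\<bar> \<le> b"
      using b[of "max a (b + 1)"] abs_Im_le_cmod[of "Complex x (max a (b + 1))"] by simp
    then show False by linarith
  qed
  ultimately show ?thesis
    using bounded_subset by (auto simp: outside)
qed

section \<open>Estimates of the weighted kernel sums of a tower\<close>

lemma kernel_difference_le:
  fixes \<xi> z q :: complex
  assumes "0 < D" "D \<le> cmod (\<xi> - z)" "D \<le> cmod (\<xi> - q)"
  shows "cmod (1 / (\<xi> - z) - 1 / (\<xi> - q)) \<le> cmod (z - q) / D\<^sup>2"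
proof -
  have "\<xi> - z \<noteq> 0" "\<xi> - q \<noteq> 0" using assms by auto
  then have "1 / (\<xi> - z) - 1 / (\<xi> - q) = (z - q) / ((\<xi> - z) * (\<xi> - q))"
    by (simp add: divide_simps)
  then have "cmod (1 / (\<xi> - z) - 1 / (\<xi> - q)) = cmod (z - q) / (cmod (\<xi> - z) * cmod (\<xi> - q))"
    by (simp add: norm_divide norm_mult)
  also have "\<dots> \<le> cmod (z - q) / (D * D)"
    using assms by (intro divide_left_mono mult_mono mult_pos_pos) auto
  finally show ?thesis by (simp add: power2_eq_square)
qed

text \<open>To the right of the hole, beyond the outer radius \<open>2 * width j\<close> of the ring
  by a clearance of \<open>width j\<close>.\<close>

definition exit_point :: "nat \<Rightarrow> nat \<Rightarrow> complex" where
  "exit_point j k = Complex (abscissa j + 3 * width j) (1 + 3 * width j * real k)"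

lemma exit_minus_hole: "cmod (exit_point j k - hole j k) = 3 * width j"
proof -
  have "exit_point j k - hole j k = of_real (3 * width j)"
    by (simp add: exit_point_def hole_def complex_eq_iff)
  then show ?thesis by (simp add: less_imp_le)
qed

lemma clear_dist:
  assumes \<xi>: "clear_of_tower j \<xi>" and k: "1 \<le> k"
  shows "width j \<le> cmod (\<xi> - exit_point j k)" "width j \<le> cmod (\<xi> - hole j k)"
proof -
  have "1 + 3 * width j \<le> 1 + 3 * width j * real k" using k by simp
  then show "width j \<le> cmod (\<xi> - exit_point j k)" "width j \<le> cmod (\<xi> - hole j k)"
    using \<xi> k by (simp_all add: clear_of_tower_def exit_point_def)
qed

text \<open>In units of \<open>width j\<close> the pairs have vertical spacing \<open>3\<close>, and
  each weighted term is at most \<open>3\<close> over the squared distance; for pairs near \<xi> the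
  clearance replaces the distance.\<close>

lemma tower_sum_bound:
  assumes \<xi>: "clear_of_tower j \<xi>"
  shows "(\<Sum>k=1..ring_count j. width j * cmod (1 / (\<xi> - exit_point j k) - 1 / (\<xi> - hole j k))) \<le> 15"
proof -
  define t where "t = (Im \<xi> - 1) / width j"
  have "width j * cmod (1 / (\<xi> - exit_point j k) - 1 / (\<xi> - hole j k)) \<le> 3 * (1 / (max 1 \<bar>t - 3 * real k\<bar>)\<^sup>2)"
    if k: "k \<in> {1..ring_count j}" for k
  proof -
    let ?D = "width j * max 1 \<bar>t - 3 * real k\<bar>"
    have im: "width j * \<bar>t - 3 * real k\<bar> = \<bar>Im \<xi> - (1 + 3 * width j * real k)\<bar>"
    proof -
      have "width j * \<bar>t - 3 * real k\<bar> = \<bar>width j * (t - 3 * real k)\<bar>"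
        by (simp add: abs_mult less_imp_le)
      also have "width j * (t - 3 * real k) = Im \<xi> - (1 + 3 * width j * real k)"
        unfolding t_def right_diff_distrib using less_imp_neq[OF width_pos[of j]] by simp
      finally show ?thesis .
    qed
    have "?D \<le> cmod (\<xi> - exit_point j k)"
      using clear_dist(1)[OF \<xi>, of k] k im abs_Im_le_cmod[of "\<xi> - exit_point j k"] by (auto simp: max_def exit_point_def)
    moreover have "?D \<le> cmod (\<xi> - hole j k)"
      using clear_dist(2)[OF \<xi>, of k] k im abs_Im_le_cmod[of "\<xi> - hole j k"] by (auto simp: max_def hole_def)
    moreover have "0 < ?D" by simp
    ultimately have "cmod (1 / (\<xi> - exit_point j k) - 1 / (\<xi> - hole j k)) \<le> 3 * width j / ?D\<^sup>2"
      using kernel_difference_le[of ?D \<xi> "exit_point j k" "hole j k"] exit_minus_hole by simp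
    then have "width j * cmod (1 / (\<xi> - exit_point j k) - 1 / (\<xi> - hole j k)) \<le> width j * (3 * width j / ?D\<^sup>2)"
      by (intro mult_left_mono) (auto simp: less_imp_le)
    also have "\<dots> = 3 * (1 / (max 1 \<bar>t - 3 * real k\<bar>)\<^sup>2)"
      using less_imp_neq[OF width_pos[of j]] by (simp add: power_mult_distrib power2_eq_square)
    finally show ?thesis .
  qed
  then have "(\<Sum>k=1..ring_count j. width j * cmod (1 / (\<xi> - exit_point j k) - 1 / (\<xi> - hole j k)))
      \<le> (\<Sum>k=1..ring_count j. 3 * (1 / (max 1 \<bar>t - 3 * real k\<bar>)\<^sup>2))"
    by (rule sum_mono)
  also have "\<dots> \<le> 3 * 5"
    unfolding sum_distrib_left[symmetric] by (intro mult_left_mono sum_inverse_squares_spaced) auto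
  finally show ?thesis by simp
qed

text \<open>Eventually all points of the pairs are at distance at least \<open>abscissa j\<close>
  from \<xi>. As the total weight is \<open>1\<close>, the sum is at most
  \<open>3 * width j / (abscissa j)^2 = 3 * abscissa j\<close>.\<close>

lemma tower_sum_tendsto:
  "(\<lambda>j. \<Sum>k=1..ring_count j. width j * cmod (1 / (\<xi> - exit_point j k) - 1 / (\<xi> - hole j k))) \<longlonglongrightarrow> 0"
proof (rule Lim_null_comparison)
  have w0: "(\<lambda>j. 3 * width j) \<longlonglongrightarrow> 0"
  proof -
    have "(\<lambda>j. 3 * abscissa j ^ 3) \<longlonglongrightarrow> 3 * 0 ^ 3"
      by (intro tendsto_intros abscissa_tendsto)
    then show ?thesis by (simp add: width_def)
  qed
  \<comment> \<open>If \<open>Re \<xi> = 0\<close>, the distance to the axis of the tower is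
    \<open>abscissa j\<close> itself; otherwise the towers move away from \<xi> towards the
    imaginary axis.\<close>
  have far: "\<forall>\<^sub>F j in sequentially. abscissa j \<le> \<bar>Re \<xi> - abscissa j\<bar> \<and> abscissa j \<le> \<bar>Re \<xi> - (abscissa j + 3 * width j)\<bar>"
  proof (cases "Re \<xi> = 0")
    case True
    have "abscissa j \<le> \<bar>0 - abscissa j\<bar> \<and> abscissa j \<le> \<bar>0 - (abscissa j + 3 * width j)\<bar>" for j
      using abscissa_pos[of j] width_pos[of j] by linarith
    then show ?thesis unfolding True by (rule always_eventually[OF allI])
  next
    case False
    have "(\<lambda>j. 2 * abscissa j + 3 * width j) \<longlonglongrightarrow> 2 * 0 + 0"
      by (intro tendsto_add tendsto_mult_left abscissa_tendsto w0)
    then have "\<forall>\<^sub>F j in sequentially. 2 * abscissa j + 3 * width j < \<bar>Re \<xi>\<bar>"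
      by (rule order_tendstoD(2)) (use False in simp)
    then show ?thesis
    proof eventually_elim
      case (elim j)
      then show ?case using abscissa_pos[of j] width_pos[of j] by linarith
    qed
  qed
  then show "\<forall>\<^sub>F j in sequentially. norm (\<Sum>k=1..ring_count j. width j * cmod (1 / (\<xi> - exit_point j k) - 1 / (\<xi> - hole j k)))
      \<le> 3 * abscissa j"
  proof eventually_elim
    case (elim j)
    have "cmod (1 / (\<xi> - exit_point j k) - 1 / (\<xi> - hole j k)) \<le> 3 * abscissa j" for k
    proof -
      have "abscissa j \<le> cmod (\<xi> - exit_point j k)" "abscissa j \<le> cmod (\<xi> - hole j k)"
        using elim abs_Re_le_cmod[of "\<xi> - exit_point j k"] abs_Re_le_cmod[of "\<xi> - hole j k"]
        by (simp_all add: exit_point_def hole_def)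
      then have "cmod (1 / (\<xi> - exit_point j k) - 1 / (\<xi> - hole j k)) \<le> 3 * width j / (abscissa j)\<^sup>2"
        using kernel_difference_le[of "abscissa j" \<xi> "exit_point j k" "hole j k"] exit_minus_hole by simp
      also have "\<dots> = 3 * abscissa j"
        using abscissa_pos[of j] by (simp add: width_def power3_eq_cube power2_eq_square)
      finally show ?thesis .
    qed
    then have "(\<Sum>k=1..ring_count j. width j * cmod (1 / (\<xi> - exit_point j k) - 1 / (\<xi> - hole j k)))
        \<le> (\<Sum>k=1..ring_count j. width j * (3 * abscissa j))"
      by (intro sum_mono mult_left_mono) (simp_all add: less_imp_le)
    also have "\<dots> = (real (ring_count j) * width j) * (3 * abscissa j)" by simp
    also have "\<dots> = 3 * abscissa j" by (simp only: ring_count_width mult_1)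
    finally have "(\<Sum>k=1..ring_count j. width j * cmod (1 / (\<xi> - exit_point j k) - 1 / (\<xi> - hole j k))) \<le> 3 * abscissa j" .
    moreover have "0 \<le> (\<Sum>k=1..ring_count j. width j * cmod (1 / (\<xi> - exit_point j k) - 1 / (\<xi> - hole j k)))"
      by (intro sum_nonneg) (simp add: less_imp_le)
    ultimately show ?case by simp
  qed
  show "(\<lambda>j. 3 * abscissa j) \<longlonglongrightarrow> 0"
    using tendsto_mult_right_zero[OF abscissa_tendsto] by simp
qed

text \<open>Half the inner radius keeps each disc off the closure of the domain. Only the first
  \<open>m - 1\<close> towers receive a disc, so the holes of all later towers stay free of the
  set.\<close>

definition tower_set :: "nat \<Rightarrow> complex set" where
  "tower_set m = closure tower_domain \<union> (\<Union>j<m - 1. cball (hole j 1) (width j / 2))"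

lemma ring_count_ge: "1 \<le> ring_count j"
  by (simp add: ring_count_def)

lemma disc_subset_inside: "cball (hole j 1) (width j / 2) \<subseteq> inside (closure tower_domain)"
proof -
  have "cball (hole j 1) (width j / 2) \<subseteq> ball (hole j 1) (width j)"
  proof
    fix x assume "x \<in> cball (hole j 1) (width j / 2)"
    then have "dist (hole j 1) x \<le> width j / 2" by simp
    then show "x \<in> ball (hole j 1) (width j)"
      unfolding mem_ball using width_pos[of j] by linarith
  qed
  then show ?thesis using ball_hole_subset_inside[of 1 j] ring_count_ge by blast
qed

lemma outside_tower_set: "outside (tower_set m) = outside (closure tower_domain)"
  unfolding tower_set_def by (rule outside_Un_inside) (use disc_subset_inside in blast)

lemma compact_tower_set: "compact (tower_set m)"
  unfolding tower_set_def using bounded_tower_domain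
  by (intro compact_Un compact_UN) (auto simp: compact_closure)

lemma clear_tower_set:
  assumes u: "u \<in> tower_set m" and j: "m \<le> j"
  shows "clear_of_tower j u"
proof (cases "u \<in> closure tower_domain")
  case False
  then obtain i where i: "i < m - 1" "u \<in> cball (hole i 1) (width i / 2)"
    using u by (auto simp: tower_set_def)
  have "\<bar>Re u - abscissa i\<bar> \<le> cmod (u - hole i 1)"
    using abs_Re_le_cmod[of "u - hole i 1"] by (simp add: hole_def)
  also have "\<dots> \<le> width i / 2" using i by (simp add: dist_norm norm_minus_commute)
  finally have "\<bar>Re u - abscissa i\<bar> \<le> 2 * width i" using width_pos[of i] by linarith
  then show ?thesis using i(1) j by (intro clear_near_other[of i j]) auto
qed (rule clear_closure_tower_domain)

lemma components_tower_set:
  "components (tower_set m) = insert (closure tower_domain) ((\<lambda>j. cball (hole j 1) (width j / 2)) ` {..<m - 1})"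
    (is "_ = ?A")
proof -
  \<comment> \<open>Disc \<open>i\<close> is clear of tower \<open>j\<close>, whereas disc
    \<open>j\<close>, sitting in a hole of that tower, is not.\<close>
  have dis: "cball (hole i 1) (width i / 2) \<inter> cball (hole j 1) (width j / 2) = {}" if "i \<noteq> j" for i j
  proof -
    have "clear_of_tower j u" if u: "u \<in> cball (hole i 1) (width i / 2)" for u
    proof -
      have "\<bar>Re u - abscissa i\<bar> \<le> width i / 2"
        using abs_Re_le_cmod[of "u - hole i 1"] u by (simp add: hole_def dist_norm norm_minus_commute)
      then have "\<bar>Re u - abscissa i\<bar> \<le> 2 * width i" using width_pos[of i] by linarith
      then show ?thesis by (rule clear_near_other[OF \<open>i \<noteq> j\<close>])
    qed
    moreover have "\<not> clear_of_tower j u" if "u \<in> cball (hole j 1) (width j / 2)" for u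
    proof -
      have "cmod (u - hole j 1) < width j"
      proof -
        have "cmod (u - hole j 1) \<le> width j / 2"
          using that by (simp add: dist_norm norm_minus_commute)
        then show ?thesis using width_pos[of j] by linarith
      qed
      then show ?thesis unfolding clear_of_tower_def by (metis le_refl not_less)
    qed
    ultimately show ?thesis by blast
  qed
  have dis': "closure tower_domain \<inter> cball (hole j 1) (width j / 2) = {}" for j
    using disc_subset_inside[of j] inside_no_overlap[of "closure tower_domain"] by blast
  have "tower_set m = \<Union>?A" by (simp add: tower_set_def)
  moreover have "components (\<Union>?A) = ?A"
  proof (rule components_Union_closed)
    have "tower_domain \<noteq> {}" using zero_in_tower_domain by blast
    then have c1: "closed (closure tower_domain) \<and> connected (closure tower_domain) \<and> closure tower_domain \<noteq> {}"
      by (simp add: connected_imp_connected_closure connected_tower_domain)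
    have c2: "closed (cball (hole j 1) (width j / 2)) \<and> connected (cball (hole j 1) (width j / 2))
        \<and> cball (hole j 1) (width j / 2) \<noteq> {}" for j
      using width_pos[of j] by (simp add: not_less less_imp_le)
    show "closed A \<and> connected A \<and> A \<noteq> {}" if "A \<in> ?A" for A
      using that
    proof (elim insertE imageE)
      show ?thesis if "A = closure tower_domain" unfolding that by (rule c1)
      show ?thesis if "A = cball (hole j 1) (width j / 2)" for j unfolding that by (rule c2)
    qed
    show "A \<inter> B = {}" if "A \<in> ?A" "B \<in> ?A" "A \<noteq> B" for A B
    proof -
      consider "A = closure tower_domain" "B \<in> (\<lambda>j. cball (hole j 1) (width j / 2)) ` {..<m - 1}"
        | "B = closure tower_domain" "A \<in> (\<lambda>j. cball (hole j 1) (width j / 2)) ` {..<m - 1}"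
        | i j where "A = cball (hole i 1) (width i / 2)" "B = cball (hole j 1) (width j / 2)"
        using \<open>A \<in> ?A\<close> \<open>B \<in> ?A\<close> \<open>A \<noteq> B\<close> by blast
      then show ?thesis
      proof cases
        case 1
        then show ?thesis using dis' by blast
      next
        case 2
        then show ?thesis using dis' by blast
      next
        case 3
        then show ?thesis using dis[of i j] \<open>A \<noteq> B\<close> by blast
      qed
    qed
  qed simp
  ultimately show ?thesis by simp
qed

lemma tower_set_not_cauchy_transform:
  assumes \<mu>: "complex_borel_measure \<mu>" "supported_on \<mu> (tower_set m)"
    and rep: "\<And>p. p \<in> sphere_compl (tower_set m) \<Longrightarrow> ahlfors_function (tower_set m) p = cauchy_transform \<mu> p"
  shows False
proof -
  let ?E = "tower_set m"
  obtain \<rho> where \<rho>: "\<rho> > 0" "cball 0 \<rho> \<subseteq> tower_domain"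
    using open_tower_domain zero_in_tower_domain unfolding open_contains_cball by blast
  have "cball 0 \<rho> \<subseteq> ?E" using \<rho>(2) closure_subset[of tower_domain] unfolding tower_set_def by blast
  then have \<rho>o: "cball 0 \<rho> \<inter> outside ?E = {}" using outside_no_overlap[of ?E] by blast
  have zo: "0 \<notin> outside ?E" using \<rho>o \<rho>(1) by (force simp: disjoint_iff)
  \<comment> \<open>The complement of the outside is the connected closure with its bounded
    complementary components filled in; these absorb the discs.\<close>
  have con: "connected (- outside ?E)"
    using connected_with_inside[OF closed_closure connected_imp_connected_closure[OF connected_tower_domain]]
    by (simp add: outside_tower_set union_with_inside)
  obtain F G where "exterior_map ?E F G"
    using exterior_riemann_map[OF compact_tower_set con \<rho>(1) \<rho>o] compact_tower_set zo
    unfolding exterior_map_def by metis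
  then interpret exterior_map ?E F G .
  have clear_of_tower: "clear_of_tower (j + m) u" if "u \<in> ?E" for j u
    by (rule clear_tower_set[OF that]) simp
  have notE: "\<not> u \<in> ?E" if "\<not> clear_of_tower (j + m) u" for j u using clear_of_tower that by blast
  show False
  \<comment> \<open>The shift by \<open>m\<close> skips the towers with discs. \<open>B = 5\<close>
    is \<open>1\<close> for the real part plus the maximal height \<open>4\<close>;
    \<open>C = 15\<close> comes from \<open>tower_sum_bound\<close>.\<close>
  proof (rule not_cauchy_transform[where w = "\<lambda>j. width (j + m)" and I = "\<lambda>j. {1..ring_count (j + m)}"
        and z = "\<lambda>j. exit_point (j + m)" and q = "\<lambda>j. hole (j + m)" and B = 5 and C = 15, OF \<rho>(1) \<rho>o _ _ _ _ _ _ _ _ \<mu> rep])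
    show "0 \<le> width (j + m)" for j by (simp add: less_imp_le)
    show "real (card {1..ring_count (j + m)}) * width (j + m) = 1" for j
      by (simp add: ring_count_width)
    show "exit_point (j + m) k \<in> outside ?E" if k: "k \<in> {1..ring_count (j + m)}" for j k
      unfolding exit_point_def
    proof (rule ray_outside)
      fix t assume t: "1 + 3 * width (j + m) * real k \<le> t"
      have "1 + 3 * width (j + m) \<le> 1 + 3 * width (j + m) * real k" using k by simp
      then have "1 + 3 * width (j + m) \<le> t" using t by linarith
      then have "\<not> clear_of_tower (j + m) (Complex (abscissa (j + m) + 3 * width (j + m)) t)"
        unfolding clear_of_tower_def using width_pos[of "j + m"] by (metis diff_self norm_zero not_le)
      then show "Complex (abscissa (j + m) + 3 * width (j + m)) t \<notin> ?E" by (rule notE)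
    qed
    show "cmod (exit_point (j + m) k) \<le> 5" if k: "k \<in> {1..ring_count (j + m)}" for j k
      unfolding exit_point_def
      using k abscissa_le[of "j + m"] width_le[of "j + m"] abscissa_pos[of "j + m"] width_pos[of "j + m"]
      by (intro cmod_Complex_le) (simp, linarith)
    show "hole (j + m) k \<notin> outside ?E" if k: "k \<in> {1..ring_count (j + m)}" for j k
    proof -
      have "hole (j + m) k \<in> inside (closure tower_domain)"
        using ball_hole_subset_inside[of k "j + m"] k by (auto simp: subset_iff)
      then show ?thesis unfolding outside_tower_set by (auto simp: inside_outside)
    qed
    show "hole (j + m) k \<notin> ?E" if k: "k \<in> {1..ring_count (j + m)}" for j k
    proof (rule notE)
      have "1 \<le> k" using k by simp
      then show "\<not> clear_of_tower (j + m) (hole (j + m) k)"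
        unfolding clear_of_tower_def using width_pos[of "j + m"] by (metis diff_self norm_zero not_le)
    qed
    show "(\<Sum>k = 1..ring_count (j + m). width (j + m) * cmod (1 / (\<xi> - exit_point (j + m) k) - 1 / (\<xi> - hole (j + m) k))) \<le> 15"
      if "\<xi> \<in> ?E" for j \<xi>
      by (rule tower_sum_bound[OF clear_of_tower[OF that]])
    show "(\<lambda>j. \<Sum>k = 1..ring_count (j + m). width (j + m) * cmod (1 / (\<xi> - exit_point (j + m) k) - 1 / (\<xi> - hole (j + m) k))) \<longlonglongrightarrow> 0"
      for \<xi>
      by (rule LIMSEQ_ignore_initial_segment[OF tower_sum_tendsto])
  qed
qed

theorem theorem1p8:
  fixes m :: nat
  assumes "m \<ge> 1"
  shows "\<exists>E :: complex set.
           compact E \<and>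
           card (components E) = m \<and>
           (\<forall>C\<in>components E. \<exists>x\<in>C. \<exists>y\<in>C. x \<noteq> y) \<and>
           analytic_capacity E = cauchy_capacity E \<and>
           \<not> (\<exists>\<mu>. complex_borel_measure \<mu> \<and> supported_on \<mu> E \<and>
                  (\<forall>p\<in>sphere_compl E. ahlfors_function E p = cauchy_transform \<mu> p))"
proof (intro exI[of _ "tower_set m"] conjI)
  let ?disc = "\<lambda>j. cball (hole j 1) (width j / 2)"
  show "compact (tower_set m)" by (rule compact_tower_set)
  have hole_disc: "hole j 1 \<in> ?disc j" for j by (simp add: less_imp_le)
  have sub: "closure tower_domain \<inter> ?disc j = {}" for j
    using disc_subset_inside[of j] inside_no_overlap[of "closure tower_domain"] by blast
  have "inj ?disc"
  proof (rule injI)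
    fix i j assume eq: "?disc i = ?disc j"
    show "i = j"
    proof (rule ccontr)
      assume "i \<noteq> j"
      then have "clear_of_tower j (hole i 1)"
        by (rule clear_near_other) (simp add: hole_def less_imp_le)
      then have "width j \<le> cmod (hole i 1 - hole j 1)" by (simp add: clear_of_tower_def)
      moreover have "cmod (hole i 1 - hole j 1) \<le> width j / 2"
        using hole_disc[of i] unfolding eq by (simp add: dist_norm norm_minus_commute)
      ultimately show False using width_pos[of j] by linarith
    qed
  qed
  then have "card (?disc ` {..<m - 1}) = m - 1"
    by (subst card_image) (auto intro: inj_on_subset)
  moreover have "closure tower_domain \<notin> ?disc ` {..<m - 1}"
    using sub hole_disc by blast
  ultimately show "card (components (tower_set m)) = m"
    unfolding components_tower_set using assms by simp
  show "\<forall>C\<in>components (tower_set m). \<exists>x\<in>C. \<exists>y\<in>C. x \<noteq> y"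
  proof
    fix C assume "C \<in> components (tower_set m)"
    then obtain a b where "a \<noteq> b" "a \<in> C" "b \<in> C"
      unfolding components_tower_set
    proof (elim insertE imageE)
      assume C: "C = closure tower_domain"
      have "0 \<in> closure tower_domain" "1 / 2 \<in> closure tower_domain"
      proof -
        have "1 / 2 \<in> tower_domain"
          by (simp add: tower_domain_def square_def in_box_complex_iff)
        then show "0 \<in> closure tower_domain" "1 / 2 \<in> closure tower_domain"
          using zero_in_tower_domain closure_subset[of tower_domain] by blast+
      qed
      then show ?thesis using that[of 0 "1 / 2"] C by simp
    next
      fix j assume "C = ?disc j"
      moreover have "hole j 1 + of_real (width j / 2) \<in> ?disc j"
        by (simp add: dist_norm less_imp_le)
      moreover have "hole j 1 + of_real (width j / 2) \<noteq> hole j 1"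
        using less_imp_neq[OF width_pos[of j]] by simp
      ultimately show ?thesis using that hole_disc by blast
    qed
    then show "\<exists>x\<in>C. \<exists>y\<in>C. x \<noteq> y" by blast
  qed
  show "analytic_capacity (tower_set m) = cauchy_capacity (tower_set m)"
  proof (rule analytic_capacity_eq_cauchy_capacity[OF compact_tower_set open_tower_domain connected_tower_domain])
    show "0 \<in> tower_domain" by (rule zero_in_tower_domain)
    show "tower_domain \<subseteq> tower_set m" using closure_subset[of tower_domain] unfolding tower_set_def by blast
  qed (rule outside_tower_set)
  show "\<not> (\<exists>\<mu>. complex_borel_measure \<mu> \<and> supported_on \<mu> (tower_set m) \<and>
      (\<forall>p\<in>sphere_compl (tower_set m). ahlfors_function (tower_set m) p = cauchy_transform \<mu> p))"
    using tower_set_not_cauchy_transform by blast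
qed

end
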